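(* For any $C^1$-self-conformal measure $\nu$ on $[0,1]$, the spectral dimension of $\Delta_\nu$ exists and equals $\overline q_\nu$; that is, $\underline s_\nu=\overline s_\nu=\overline q_\nu$.
   Context: Self-conformal measures. A $C^1$-conformal iterated function system on $[0,1]$ is a finite family $\{S_i:[0,1]\to[0,1]\}_{i=1,\dots,\ell}$ such that each $S_i$ extends to an injective $C^1$-map $S_i:U\to U$ on an open set $U\supset[0,1]$ with $|S_i'(x)|>0$ for all $x\in U$, and such that $S_i$ is contracting: there is $0<c<1$ with $|S_i(x)-S_i(y)|\le c|x-y|$ for all $x,y\in U$. No separation condition is assumed. It is assumed that the $S_i$ do not all have the same fixed point. Given a probability vector $(p_1,\dots,p_\ell)$ with $p_i>0$, there is a unique Borel probability measure $\nu$ with $\nu=\sum_{i=1}^\ell p_i\,\nu\circ S_i^{-1}$; it is called a $C^1$-self-conformal measure. (It has no atoms, so it may be viewed as a measure on $(0,1)$.) $L^q$-spectrum. For $n\in\mathbb N$, $0\le k<2^n$ let $A^n_k:=(k2^{-n},(k+1)2^{-n}]$, $\mathcal D_{\nu,n}:=\{A^n_k:\nu(A^n_k)>0\}$, $\beta^\nu_n(q):=\frac{1}{\log 2^n}\log\sum_{C\in\mathcal D_{\nu,n}}\nu(C)^q$. There is a unique $q_n\ge0$ with $\beta_n^\nu(q_n)=q_n$; $\overline q_\nu:=\limsup_{n\to\infty}q_n$. Spectral dimension. $\Lambda$ is Lebesgue measure. $H^1_0(0,1)$ is the space of functions $f:[0,1]\to\mathbb R$ with $f(x)=\int_{[0,x]}g\,d\Lambda$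 for some $g\in L^2_\Lambda([0,1])$ and $f(0)=f(1)=0$; $\nabla_\Lambda f:=g$. $C_\nu([0,1])$ is the set of continuous real functions on $[0,1]$ that are affine linear on every connected component of $[0,1]\setminus\operatorname{supp}\nu$. $\operatorname{dom}(\mathcal E_\nu):=H^1_0(0,1)\cap C_\nu([0,1])$, $\mathcal E_\nu(f,g):=\int_{(0,1)}\nabla_\Lambda f\,\nabla_\Lambda g\,d\Lambda$. $\Delta_\nu$ is the non-negative self-adjoint operator on $L^2_\nu$ associated with this closed form; its eigenvalues are the $\lambda$ for which there is $f\in\operatorname{dom}(\mathcal E_\nu)\setminus\{0\}$ with $\mathcal E_\nu(f,g)=\lambda\int fg\,d\nu$ for all $g\in\operatorname{dom}(\mathcal E_\nu)$. $N_\nu(x)$ is the number of eigenvalues $\le x$ (with multiplicity). $\underline{s}_\nu:=\liminf_{x\to\infty}\frac{\log N_\nu(x)}{\log x}$, $\overline{s}_\nu:=\limsup_{x\to\infty}\frac{\log N_\nu(x)}{\log x}$; if they coincide the common value is the spectral dimension. *)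

theory Defs
  imports "HOL-Analysis.Analysis" "HOL-Library.Function_Algebras"
begin

section \<open>Self-conformal measures\<close>

text \<open>A map \<open>f\<close> of \<open>[0,1]\<close> is represented by a function on \<^typ>\<open>real\<close> whose values outside
  \<open>[0,1]\<close> are irrelevant; \<open>T\<close> is the extension of \<open>f\<close> to \<open>U\<close>.\<close>

definition C1_conformal_contraction :: "(real \<Rightarrow> real) \<Rightarrow> bool" where
  "C1_conformal_contraction f \<longleftrightarrow>
     f ` {0..1} \<subseteq> {0..1} \<and>
     (\<exists>U T. open U \<and> {0..1} \<subseteq> U \<and> T ` U \<subseteq> U \<and> (\<forall>x\<in>{0..1}. T x = f x) \<and>
        inj_on T U \<and> T C1_differentiable_on U \<and> (\<forall>x\<in>U. \<bar>deriv T x\<bar> > 0) \<and>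
        (\<exists>c. 0 < c \<and> c < 1 \<and> (\<forall>x\<in>U. \<forall>y\<in>U. \<bar>T x - T y\<bar> \<le> c * \<bar>x - y\<bar>)))"

definition C1_conformal_ifs :: "nat \<Rightarrow> (nat \<Rightarrow> real \<Rightarrow> real) \<Rightarrow> bool" where
  "C1_conformal_ifs l S \<longleftrightarrow> (\<forall>i<l. C1_conformal_contraction (S i))"

text \<open>\<open>\<nu>\<close> is a Borel probability measure with space \<open>[0,1]\<close> satisfying
  \<open>\<nu> = (\<Sum>i<l. p i \<cdot> \<nu> \<circ> (S i)\<^sup>-\<^sup>1)\<close>.\<close>

definition self_conformal_measure ::
    "nat \<Rightarrow> (nat \<Rightarrow> real \<Rightarrow> real) \<Rightarrow> (nat \<Rightarrow> real) \<Rightarrow> real measure \<Rightarrow> bool" where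
  "self_conformal_measure l S p \<nu> \<longleftrightarrow>
     sets \<nu> = sets (restrict_space borel {0..1}) \<and>
     emeasure \<nu> (space \<nu>) = 1 \<and>
     (\<forall>B\<in>sets \<nu>. measure \<nu> B = (\<Sum>i<l. p i * measure \<nu> (S i -` B \<inter> space \<nu>)))"

section \<open>The \<open>L\<^sup>q\<close>-spectrum\<close>

definition dyadic_cell :: "nat \<Rightarrow> nat \<Rightarrow> real set" where
  "dyadic_cell n k = {real k / 2 ^ n <.. real (k + 1) / 2 ^ n}"

definition charged_cells :: "real measure \<Rightarrow> nat \<Rightarrow> real set set" where
  "charged_cells \<nu> n = {dyadic_cell n k | k. k < 2 ^ n \<and> measure \<nu> (dyadic_cell n k) > 0}"

definition Lq_beta :: "real measure \<Rightarrow> nat \<Rightarrow> real \<Rightarrow> real" where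
  "Lq_beta \<nu> n q = (1 / ln (2 ^ n)) * ln (\<Sum>C\<in>charged_cells \<nu> n. measure \<nu> C powr q)"

text \<open>For \<open>n \<ge> 1\<close>, \<open>Lq_beta \<nu> n\<close> is nonincreasing, nonnegative at \<open>0\<close> and zero at \<open>1\<close>, so the fixed
  point exists and is unique; the value at \<open>n = 0\<close> does not affect the limsup.\<close>

definition Lq_fixed_point :: "real measure \<Rightarrow> nat \<Rightarrow> real" where
  "Lq_fixed_point \<nu> n = (THE q. q \<ge> 0 \<and> Lq_beta \<nu> n q = q)"

definition Lq_upper_fixed_point :: "real measure \<Rightarrow> ereal" where
  "Lq_upper_fixed_point \<nu> = limsup (\<lambda>n. ereal (Lq_fixed_point \<nu> n))"

section \<open>The Dirichlet form and its eigenvalues\<close>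

definition measure_support :: "real measure \<Rightarrow> real set" where
  "measure_support \<nu> =
     {x \<in> space \<nu>. \<forall>U. open U \<longrightarrow> x \<in> U \<longrightarrow> measure \<nu> (U \<inter> space \<nu>) > 0}"

definition is_gradient :: "(real \<Rightarrow> real) \<Rightarrow> (real \<Rightarrow> real) \<Rightarrow> bool" where
  "is_gradient f g \<longleftrightarrow>
     g \<in> borel_measurable (lebesgue_on {0..1}) \<and>
     integrable (lebesgue_on {0..1}) (\<lambda>x. (g x)\<^sup>2) \<and>
     (\<forall>x\<in>{0..1}. f x = (LINT t:{0..x}|lebesgue. g t))"

text \<open>The gradient is unique up to Lebesgue null sets, so the choice of representative does not
  affect integrals.\<close>

definition gradient :: "(real \<Rightarrow> real) \<Rightarrow> real \<Rightarrow> real" where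
  "gradient f = (SOME g. is_gradient f g)"

text \<open>Functions on \<open>[0,1]\<close> are encoded as functions on \<^typ>\<open>real\<close> vanishing outside \<open>[0,1]\<close>, so
  that two elements are equal iff they agree on \<open>[0,1]\<close> and dimensions are counted correctly.\<close>

definition H10 :: "(real \<Rightarrow> real) set" where
  "H10 = {f. (\<forall>x. x \<notin> {0..1} \<longrightarrow> f x = 0) \<and> (\<exists>g. is_gradient f g) \<and> f 0 = 0 \<and> f 1 = 0}"

definition C_supp :: "real measure \<Rightarrow> (real \<Rightarrow> real) set" where
  "C_supp \<nu> = {f. continuous_on {0..1} f \<and>
     (\<forall>J\<in>components ({0..1} - measure_support \<nu>). \<exists>a b. \<forall>x\<in>J. f x = a * x + b)}"

definition form_dom :: "real measure \<Rightarrow> (real \<Rightarrow> real) set" where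
  "form_dom \<nu> = H10 \<inter> C_supp \<nu>"

definition dirichlet_form :: "(real \<Rightarrow> real) \<Rightarrow> (real \<Rightarrow> real) \<Rightarrow> real" where
  "dirichlet_form f g = (LINT t:{0<..<1}|lebesgue. gradient f t * gradient g t)"

definition eigenspace :: "real measure \<Rightarrow> real \<Rightarrow> (real \<Rightarrow> real) set" where
  "eigenspace \<nu> ev =
     {f \<in> form_dom \<nu>. \<forall>g\<in>form_dom \<nu>. dirichlet_form f g = ev * (LINT x|\<nu>. f x * g x)}"

definition is_eigenvalue :: "real measure \<Rightarrow> real \<Rightarrow> bool" where
  "is_eigenvalue \<nu> ev \<longleftrightarrow> (\<exists>f\<in>eigenspace \<nu> ev. f \<noteq> (\<lambda>x. 0))"

definition fun_scale :: "real \<Rightarrow> (real \<Rightarrow> real) \<Rightarrow> real \<Rightarrow> real" where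
  "fun_scale c f = (\<lambda>x. c * f x)"

interpretation fun_space: vector_space fun_scale
  by unfold_locales (auto simp: fun_scale_def fun_eq_iff algebra_simps)

definition multiplicity_of :: "real measure \<Rightarrow> real \<Rightarrow> nat" where
  "multiplicity_of \<nu> ev = vector_space.dim fun_scale (eigenspace \<nu> ev)"

text \<open>The operator has compact resolvent, so for the measures considered here only finitely many
  eigenvalues lie below \<open>x\<close>, all of finite multiplicity; the sum and the dimensions (which HOL sets
  to \<open>0\<close> in infinite cases) are therefore genuine.\<close>

definition eigenvalue_count :: "real measure \<Rightarrow> real \<Rightarrow> nat" where
  "eigenvalue_count \<nu> x = (\<Sum>ev | is_eigenvalue \<nu> ev \<and> ev \<le> x. multiplicity_of \<nu> ev)"

definition lower_spectral_dim :: "real measure \<Rightarrow> ereal" where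
  "lower_spectral_dim \<nu> = Liminf at_top (\<lambda>x. ereal (ln (real (eigenvalue_count \<nu> x)) / ln x))"

definition upper_spectral_dim :: "real measure \<Rightarrow> ereal" where
  "upper_spectral_dim \<nu> = Limsup at_top (\<lambda>x. ereal (ln (real (eigenvalue_count \<nu> x)) / ln x))"

end

theory Submission
  imports Defs "HOL-Complex_Analysis.Great_Picard" "HOL-Probability.Probability_Measure"
    "HOL-Real_Asymp.Real_Asymp"
begin

text \<open>Write \<open>J(C) = \<nu>(C) |C|\<close>; the fixed point \<open>q\<close> of the level \<open>n\<close> spectrum is the solution of
  \<open>\<Sum>C. J(C) powr q = 1\<close> over the dyadic cells of level \<open>n\<close>.
  A function vanishing at the midpoints of all cells with \<open>J(C) \<ge> t\<close> satisfies
  \<open>\<integral>f\<^sup>2 d\<nu> \<le> t \<E>(f, f)\<close>, so the number of these cells bounds the number of eigenvalues below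
  \<open>1 / t\<close> from above; conversely tent functions over separated cells of one level, together with a
  variational argument for the Green operator, bound it from below. Up to logarithmic factors the
  eigenvalue count at \<open>1 / t\<close> is therefore the number \<open>M(t)\<close> of cells with \<open>J(C) \<ge> t\<close>.
  The bound \<open>M(t) \<le> t powr (- q) polylog(1 / t)\<close> for \<open>q\<close> above the limsup holds for every measure.
  Self-conformality yields the reverse bound at all scales from a single good level: if
  \<open>\<Sum>C. J(C) powr q\<close> is large at one level, then \<open>\<Sum>I. J(I) powr q\<close> is bounded below over all finite
  interval covers, as one sees by passing to preimages of the cover under the maps of a cut set and
  using concavity of \<open>x powr q\<close> to handle overlaps. Applied to the leaves of the tree of cells with
  \<open>J(C) \<ge> t\<close>, this gives \<open>M(t) \<ge> c t powr (- q)\<close>.\<close>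

text \<open>The limsup is approached along some levels only, while the lower spectral dimension
  needs a bound at every scale. Two obstacles shape this transfer. The pieces
  \<open>foldr S w\<close> of [0,1] may overlap in any way, so the mass of a cell cannot be assigned
  to disjoint pieces; and C^1 maps need not have bounded distortion, so the ratio of a piece is
  known only up to a factor (1 + \<epsilon>)^m. Distortion is paid for by lowering the exponent:
  going from a fixed point q' to q < q' multiplies the level n sum by at least 2 powr (n (q' - q)),
  and \<epsilon> is chosen so that the loss is at most a constant times the square root of this
  gain. Overlaps are paid for by averaging: the pieces meeting one cell are averaged with their
  weights, and Jensen's inequality moves the mean inside the power. This uses q \<le> 1, which holds
  for exponents below a fixed point. An interval of the cover that contains no piece can serve only
  cells near one of its two endpoints, at most four for each; hence the constant 8.\<close>

section \<open>Homogeneous linear systems and discriminants\<close>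

lemma exists_nontrivial_kernel_vector:
  fixes a :: "'i \<Rightarrow> 'j \<Rightarrow> real"
  assumes "finite J" "finite I" "card J < card I"
  shows "\<exists>c. (\<exists>i\<in>I. c i \<noteq> 0) \<and> (\<forall>j\<in>J. (\<Sum>i\<in>I. c i * a i j) = 0)"
  using assms
proof (induction J arbitrary: I a rule: finite_induct)
  case empty
  then have "I \<noteq> {}" by auto
  then show ?case by (intro exI[of _ "\<lambda>_. 1"]) auto
next
  case (insert j J)
  show ?case
  proof (cases "\<forall>i\<in>I. a i j = 0")
    case True
    have "card J < card I" using insert by auto
    from insert.IH[OF \<open>finite I\<close> this, of a] obtain c where
      "\<exists>i\<in>I. c i \<noteq> 0" "\<forall>j\<in>J. (\<Sum>i\<in>I. c i * a i j) = 0" by auto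
    with True show ?thesis by (intro exI[of _ c]) auto
  next
    case False
    then obtain k where k: "k \<in> I" "a k j \<noteq> 0" by auto
    \<comment> \<open>Gaussian elimination: equation \<open>j\<close> removes the unknown
      \<open>k\<close>, and \<open>b\<close> is the coefficient matrix left for the other equations.
      Below, \<open>d k\<close> is the value that makes equation \<open>j\<close> hold.\<close>
    define b where "b i j' = a i j' - a i j / a k j * a k j'" for i j'
    have "card J < card (I - {k})" using insert k by (auto simp: card_Diff_singleton)
    from insert.IH[OF _ this, of b] obtain c where
      c: "\<exists>i\<in>I - {k}. c i \<noteq> 0" "\<forall>j'\<in>J. (\<Sum>i\<in>I - {k}. c i * b i j') = 0"
      using \<open>finite I\<close> by auto
    define d where "d i = (if i = k then - (\<Sum>i\<in>I - {k}. c i * a i j) / a k j else c i)" for i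
    have sum_d: "(\<Sum>i\<in>I. d i * a i j') = d k * a k j' + (\<Sum>i\<in>I - {k}. c i * a i j')" for j'
    proof -
      have "(\<Sum>i\<in>I. d i * a i j') = d k * a k j' + (\<Sum>i\<in>I - {k}. d i * a i j')"
        using k \<open>finite I\<close> by (simp add: sum.remove)
      also have "(\<Sum>i\<in>I - {k}. d i * a i j') = (\<Sum>i\<in>I - {k}. c i * a i j')"
        by (intro sum.cong) (auto simp: d_def)
      finally show ?thesis .
    qed
    have "(\<Sum>i\<in>I. d i * a i j) = 0" unfolding sum_d using k by (simp add: d_def)
    moreover have "(\<Sum>i\<in>I. d i * a i j') = 0" if "j' \<in> J" for j'
    proof -
      have "0 = (\<Sum>i\<in>I - {k}. c i * b i j')" using c that by auto
      also have "\<dots> = (\<Sum>i\<in>I - {k}. c i * a i j') - (\<Sum>i\<in>I - {k}. c i * a i j) / a k j * a k j'"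
        by (simp add: b_def algebra_simps sum_subtractf sum_distrib_left sum_divide_distrib)
      also have "\<dots> = (\<Sum>i\<in>I. d i * a i j')" unfolding sum_d by (simp add: d_def)
      finally show ?thesis by simp
    qed
    moreover have "\<exists>i\<in>I. d i \<noteq> 0" using c by (auto simp: d_def)
    ultimately show ?thesis by (intro exI[of _ d]) auto
  qed
qed

text \<open>Evaluate at the critical point s = - B / C. Stated for bare numbers because it serves
  two semidefinite forms: integrals of products, and the form
  \<open>\<mu> * ip v w - ip (green v) w\<close> of the variational argument.\<close>

lemma quadratic_nonneg_imp_discriminant:
  fixes A B C :: real
  assumes "\<And>s. A + 2 * s * B + s^2 * C \<ge> 0"
  shows "B^2 \<le> A * C"
proof (cases "C = 0")
  case True
  have "B = 0"
  proof (rule ccontr)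
    assume "B \<noteq> 0"
    then show False using assms[of "(- A - 1) / (2 * B)"] True by (simp add: field_simps)
  qed
  with True show ?thesis by simp
next
  case False
  have "0 \<le> A + 2 * 0 * B + 0^2 * C" by (rule assms)
  then have A: "A \<ge> 0" by simp
  have "C > 0"
  proof (rule ccontr)
    assume "\<not> C > 0"
    then have C: "C < 0" using False by simp
    \<comment> \<open>Chosen so large that for negative C the quadratic term outweighs the other
      two, whatever the sign of B.\<close>
    define s where "s = (\<bar>B\<bar> * 2 + A + 1) / (- C) + 1"
    have s: "s \<ge> 1" using C A by (simp add: s_def divide_nonneg_neg)
    have "s * C = - (\<bar>B\<bar> * 2 + A + 1) + C" using C by (simp add: s_def field_simps)
    then have "s * (s * C) = s * (- (\<bar>B\<bar> * 2 + A + 1) + C)" by simp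
    then have eq: "s^2 * C = - 2 * (s * \<bar>B\<bar>) - s * A - s + s * C"
      by (simp add: power2_eq_square algebra_simps)
    have "s * B \<le> s * \<bar>B\<bar>" using s by (intro mult_left_mono) auto
    moreover have "A \<le> s * A" using mult_right_mono[OF s A] by simp
    moreover have "s * C < 0" using s C by (simp add: mult_pos_neg)
    ultimately show False using assms[of s] s unfolding eq by linarith
  qed
  have "0 \<le> A + 2 * (- B / C) * B + (- B / C)^2 * C" by (rule assms)
  also have "\<dots> = A - B^2 / C" using \<open>C > 0\<close> by (simp add: power2_eq_square field_simps)
  finally show ?thesis using \<open>C > 0\<close> by (simp add: field_simps)
qed

section \<open>Gradients and the Dirichlet form\<close>

abbreviation "LB \<equiv> lebesgue_on {0..1::real}"

lemma finite_LB: "finite_measure LB"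
  by (simp add: finite_measure_lebesgue_on)

lemma measurable_LB_id [measurable]: "(\<lambda>x. x) \<in> measurable LB borel"
  using id_borel_measurable_lebesgue_on[of "{0..1}"] by (simp add: id_def)

lemma integrable_mult_square_integrable:
  fixes f g :: "'a \<Rightarrow> real"
  assumes [measurable]: "f \<in> borel_measurable M" "g \<in> borel_measurable M"
    and "integrable M (\<lambda>x. (f x)^2)" "integrable M (\<lambda>x. (g x)^2)"
  shows "integrable M (\<lambda>x. f x * g x)"
proof (rule Bochner_Integration.integrable_bound)
  show "integrable M (\<lambda>x. (f x)^2 + (g x)^2)" using assms by simp
  have "\<bar>a * b\<bar> \<le> a^2 + b^2" for a b :: real
    using sum_squares_bound[of a b] sum_squares_bound[of a "-b"] zero_le_power2[of a] zero_le_power2[of b]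
    by (auto simp: abs_if)
  then show "AE x in M. norm (f x * g x) \<le> norm ((f x)^2 + (g x)^2)" by simp
qed measurable

lemma integral_Cauchy_Schwarz:
  fixes f g :: "'a \<Rightarrow> real"
  assumes [measurable]: "f \<in> borel_measurable M" "g \<in> borel_measurable M"
    and int: "integrable M (\<lambda>x. (f x)^2)" "integrable M (\<lambda>x. (g x)^2)"
  shows "(\<integral>x. f x * g x \<partial>M)^2 \<le> (\<integral>x. (f x)^2 \<partial>M) * (\<integral>x. (g x)^2 \<partial>M)"
proof (rule quadratic_nonneg_imp_discriminant)
  fix s :: real
  note fg = integrable_mult_square_integrable[OF assms]
  have "0 \<le> (\<integral>x. (f x + s * g x)^2 \<partial>M)" by simp
  also have "(\<lambda>x. (f x + s * g x)^2) = (\<lambda>x. (f x)^2 + 2 * s * (f x * g x) + s^2 * (g x)^2)"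
    by (auto simp: power2_eq_square algebra_simps)
  also have "(\<integral>x. \<dots> x \<partial>M) =
      (\<integral>x. (f x)^2 \<partial>M) + 2 * s * (\<integral>x. f x * g x \<partial>M) + s^2 * (\<integral>x. (g x)^2 \<partial>M)"
    using int fg by simp
  finally show "0 \<le> \<dots>" .
qed

text \<open>A Dynkin argument carries the vanishing from rays to all Borel sets. The sets of
  \<open>LB\<close> are merely Lebesgue measurable, but each is an F-sigma set up to a null set, and
  an integrable function whose integral over every measurable set vanishes is zero almost
  everywhere.\<close>

lemma AE_zero_if_interval_integrals_zero:
  fixes d :: "real \<Rightarrow> real"
  assumes d: "integrable LB d"
    and zero: "\<And>x. x \<in> {0..1} \<Longrightarrow> (\<integral>t. indicator {0..x} t * d t \<partial>LB) = 0"
  shows "AE t in LB. d t = 0"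
proof -
  interpret finite_measure LB by (rule finite_LB)
  have space: "space LB = {0..1}" by simp
  have setsB: "A \<inter> {0..1} \<in> sets LB" if "A \<in> sets borel" for A :: "real set"
    using that by (auto simp: sets_restrict_space)
  have meas_ind [measurable]: "indicator A \<in> borel_measurable LB" if "A \<in> sets borel" for A :: "real set"
    using measurable_compose[OF measurable_LB_id, of "indicator A" borel] that by simp
  have int: "integrable LB (\<lambda>t. indicator A t * d t)" if "A \<in> sets borel" for A
  proof (rule Bochner_Integration.integrable_bound[OF d])
    show "(\<lambda>t. indicator A t * d t) \<in> borel_measurable LB" using that d by measurable
  qed (auto simp: indicator_def)
  have total: "(\<integral>t. d t \<partial>LB) = 0"
  proof -
    have "(\<integral>t. d t \<partial>LB) = (\<integral>t. indicator {0..1} t * d t \<partial>LB)"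
      by (intro Bochner_Integration.integral_cong) auto
    then show ?thesis using zero[of 1] by simp
  qed
  have borel: "(\<integral>t. indicator A t * d t \<partial>LB) = 0" if "A \<in> sets borel" for A
  proof -
    have *: "A \<in> sigma_sets UNIV (range (\<lambda>a. {..a::real}))"
      using that unfolding borel_eq_atMost by simp
    have "Int_stable (range (\<lambda>a. {..a::real}))" by (auto simp: Int_stable_def)
    from this subset_UNIV[of "range (\<lambda>a. {..a::real})", folded Pow_UNIV] * show ?thesis
    proof (induction rule: sigma_sets_induct_disjoint)
      case (basic A)
      then obtain a where A: "A = {..a}" by auto
      show ?case
      proof (cases "a < 0")
        case True
        have "(\<integral>t. indicator A t * d t \<partial>LB) = (\<integral>t. 0 \<partial>LB)"
          by (intro Bochner_Integration.integral_cong) (use True A in auto)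
        then show ?thesis by simp
      next
        case False
        have "(\<integral>t. indicator A t * d t \<partial>LB) = (\<integral>t. indicator {0..min a 1} t * d t \<partial>LB)"
          by (intro Bochner_Integration.integral_cong) (use False A in \<open>auto simp: indicator_def\<close>)
        then show ?thesis using zero[of "min a 1"] False by simp
      qed
    next
      case (compl A)
      then have "A \<in> sets borel" unfolding borel_eq_atMost by simp
      have "(\<integral>t. indicator (UNIV - A) t * d t \<partial>LB) = (\<integral>t. d t - indicator A t * d t \<partial>LB)"
        by (intro Bochner_Integration.integral_cong) (auto simp: indicator_def)
      also have "\<dots> = 0" using int[OF \<open>A \<in> sets borel\<close>] d compl total by simp
      finally show ?case .
    next
      case (union A)
      then have A: "A i \<in> sets borel" for i unfolding borel_eq_atMost by (simp add: image_subset_iff)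
      define A' where "A' i = A i \<inter> {0..1}" for i
      have eq: "(\<integral>t. indicator B t * d t \<partial>LB) = (LINT t:(B \<inter> {0..1})|LB. d t)" for B
        unfolding set_lebesgue_integral_def
        by (intro Bochner_Integration.integral_cong) (auto simp: indicator_def)
      have "(\<integral>t. indicator (\<Union>(range A)) t * d t \<partial>LB) = (LINT t:(\<Union>i. A' i)|LB. d t)"
        unfolding eq by (auto simp: A'_def)
      also have "\<dots> = (\<Sum>i. (LINT t:(A' i)|LB. d t))"
      proof (rule lebesgue_integral_countable_add)
        show "A' i \<in> sets LB" for i using setsB[OF A] by (simp add: A'_def)
        show "A' i \<inter> A' j = {}" if "i \<noteq> j" for i j
          using union(1) that by (auto simp: A'_def disjoint_family_on_def)
        show "set_integrable LB (\<Union> (range A')) d"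
          unfolding set_integrable_def
          using \<open>\<And>i. A' i \<in> sets LB\<close> d by (intro integrable_mult_indicator) auto
      qed
      also have "\<dots> = 0" using union(3) by (simp add: A'_def eq[symmetric])
      finally show ?case .
    qed simp
  qed
  show ?thesis
  proof (rule density_zero[OF d])
    fix A assume "A \<in> sets LB"
    then have "A \<in> sets lebesgue" "A \<subseteq> {0..1}" by (auto simp: sets_restrict_space)
    then obtain C T where CT: "fsigma C" "T \<in> null_sets lebesgue" "C \<union> T = A" "disjnt C T"
      using lebesgue_set_almost_fsigma by metis
    have C: "C \<in> sets borel"
      using CT(1) by (auto simp: fsigma.simps)
    have "AE t in lebesgue. t \<notin> T" using CT(2) by (rule AE_not_in)
    then have "AE t in lebesgue. t \<in> {0..1} \<longrightarrow> t \<notin> T" by eventually_elim auto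
    then have "AE t in LB. t \<notin> T" by (subst AE_restrict_space_iff) auto
    then have "AE t in LB. indicator A t *\<^sub>R d t = indicator C t * d t"
      by eventually_elim (use CT in \<open>auto simp: indicator_def\<close>)
    then have "set_lebesgue_integral LB A d = (\<integral>t. indicator C t * d t \<partial>LB)"
      unfolding set_lebesgue_integral_def
      using \<open>A \<in> sets LB\<close> d C by (intro integral_cong_AE) (auto intro!: borel_measurable_times)
    with borel[OF C] show "set_lebesgue_integral LB A d = 0" by simp
  qed
qed

lemma integrable_LB_if_square:
  fixes g :: "real \<Rightarrow> real"
  assumes "g \<in> borel_measurable LB" "integrable LB (\<lambda>x. (g x)\<^sup>2)"
  shows "integrable LB g"
proof -
  interpret finite_measure LB by (rule finite_LB)
  have "integrable LB (\<lambda>x. g x * 1)"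
    by (rule integrable_mult_square_integrable) (use assms in auto)
  then show ?thesis by simp
qed

lemma set_integral_eq_LB:
  assumes "x \<in> {0..1}"
  shows "(LINT t:{0..x}|lebesgue. g t) = (\<integral>t. indicator {0..x} t * g t \<partial>LB :: real)"
proof -
  have "(\<integral>t. indicator {0..x} t * g t \<partial>LB) = (\<integral>t. indicator {0..1} t *\<^sub>R (indicator {0..x} t * g t) \<partial>lebesgue)"
    by (rule integral_restrict_space) auto
  also have "\<dots> = (LINT t:{0..x}|lebesgue. g t)"
    unfolding set_lebesgue_integral_def
    by (intro Bochner_Integration.integral_cong) (use assms in \<open>auto simp: indicator_def\<close>)
  finally show ?thesis by simp
qed

lemma is_gradient_iff:
  "is_gradient f g \<longleftrightarrow> g \<in> borel_measurable LB \<and> integrable LB (\<lambda>x. (g x)\<^sup>2) \<and>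
     (\<forall>x\<in>{0..1}. f x = (\<integral>t. indicator {0..x} t * g t \<partial>LB))"
  unfolding is_gradient_def by (auto simp: set_integral_eq_LB)

lemma integrable_LB_indicator_mult:
  fixes g :: "real \<Rightarrow> real"
  assumes "integrable LB g" "A \<in> sets borel"
  shows "integrable LB (\<lambda>t. indicator A t * g t)"
proof (rule Bochner_Integration.integrable_bound[OF assms(1)])
  have "(indicator A :: real \<Rightarrow> real) \<in> borel_measurable LB"
    using measurable_compose[OF measurable_LB_id, of "indicator A" borel] assms by simp
  then show "(\<lambda>t. indicator A t * g t) \<in> borel_measurable LB" using assms by measurable
qed (auto simp: indicator_def)

text \<open>Neutralises the choice made in \<open>gradient\<close>: integrals do not see which
  representative was taken.\<close>

lemma is_gradient_unique:
  assumes "is_gradient f g" "is_gradient f h"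
  shows "AE t in LB. g t = h t"
proof -
  have int: "integrable LB g" "integrable LB h"
    using assms by (auto simp: is_gradient_iff intro: integrable_LB_if_square)
  have "AE t in LB. g t - h t = 0"
  proof (rule AE_zero_if_interval_integrals_zero)
    fix x :: real assume x: "x \<in> {0..1}"
    have "(\<integral>t. indicator {0..x} t * (g t - h t) \<partial>LB)
      = (\<integral>t. indicator {0..x} t * g t \<partial>LB) - (\<integral>t. indicator {0..x} t * h t \<partial>LB)"
      unfolding right_diff_distrib
      by (intro Bochner_Integration.integral_diff integrable_LB_indicator_mult int) auto
    also have "\<dots> = 0" using assms x unfolding is_gradient_iff by auto
    finally show "(\<integral>t. indicator {0..x} t * (g t - h t) \<partial>LB) = 0" .
  qed (use int in auto)
  then show ?thesis by auto
qed

lemma is_gradient_gradient: "is_gradient f g \<Longrightarrow> is_gradient f (gradient f)"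
  unfolding gradient_def by (rule someI[of "is_gradient f"])

lemma is_gradient_lincomb:
  assumes "finite I" and g: "\<And>i. i \<in> I \<Longrightarrow> is_gradient (f i) (g i)"
  shows "is_gradient (\<lambda>x. \<Sum>i\<in>I. c i * f i x) (\<lambda>x. \<Sum>i\<in>I. c i * g i x)"
proof -
  have meas: "(\<lambda>x. c i * g i x) \<in> borel_measurable LB" if "i \<in> I" for i
  proof -
    have [measurable]: "g i \<in> borel_measurable LB" using g[OF that] by (simp add: is_gradient_iff)
    show ?thesis by measurable
  qed
  have "(\<lambda>x. (\<Sum>i\<in>I. c i * g i x)\<^sup>2) = (\<lambda>x. \<Sum>i\<in>I. \<Sum>j\<in>I. (c i * g i x) * (c j * g j x))"
    by (simp add: power2_eq_square sum_product)
  moreover have "integrable LB (\<lambda>x. (c i * g i x) * (c j * g j x))" if "i \<in> I" "j \<in> I" for i j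
    using g[OF that(1)] g[OF that(2)] meas that unfolding is_gradient_iff
    by (intro integrable_mult_square_integrable) (auto simp: power_mult_distrib)
  moreover have "(\<Sum>i\<in>I. c i * f i x) = (\<integral>t. indicator {0..x} t * (\<Sum>i\<in>I. c i * g i t) \<partial>LB)"
    if x: "x \<in> {0..1}" for x
  proof -
    have "(\<integral>t. indicator {0..x} t * (\<Sum>i\<in>I. c i * g i t) \<partial>LB)
        = (\<integral>t. (\<Sum>i\<in>I. c i * (indicator {0..x} t * g i t)) \<partial>LB)"
      by (simp add: sum_distrib_left mult_ac)
    also have "\<dots> = (\<Sum>i\<in>I. \<integral>t. c i * (indicator {0..x} t * g i t) \<partial>LB)"
    proof (intro Bochner_Integration.integral_sum)
      fix i assume "i \<in> I"
      then have "integrable LB (g i)" 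
        using g[of i] by (auto simp: is_gradient_iff intro: integrable_LB_if_square)
      from integrable_LB_indicator_mult[OF this, of "{0..x}"]
      show "integrable LB (\<lambda>t. c i * (indicat_real {0..x} t * g i t))" by simp
    qed
    also have "\<dots> = (\<Sum>i\<in>I. c i * f i x)"
      using g x by (intro sum.cong) (auto simp: is_gradient_iff)
    finally show ?thesis by simp
  qed
  ultimately show ?thesis
    unfolding is_gradient_iff using meas by auto
qed

text \<open>Lets the form be computed with whatever gradient is at hand. Passing from the open
  interval of the definition to [0,1] only adds the null set {0, 1}.\<close>

lemma dirichlet_form_eq:
  assumes f: "is_gradient f g" and f': "is_gradient f' g'"
  shows "dirichlet_form f f' = (\<integral>t. g t * g' t \<partial>LB)"
proof -
  let ?G = "\<lambda>t. gradient f t * gradient f' t"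
  note gr = is_gradient_gradient[OF f] is_gradient_gradient[OF f']
  have "(\<integral>t. indicator {0<..<1} t *\<^sub>R ?G t \<partial>lebesgue) = (\<integral>t. indicator {0..1} t *\<^sub>R (indicator {0<..<1} t * ?G t) \<partial>lebesgue)"
    by (intro Bochner_Integration.integral_cong) (auto simp: indicator_def)
  also have "\<dots> = (\<integral>t. indicator {0<..<1} t * ?G t \<partial>LB)"
    by (rule integral_restrict_space[symmetric]) auto
  also have "\<dots> = (\<integral>t. g t * g' t \<partial>LB)"
  proof (rule integral_cong_AE)
    have "AE t in lebesgue. t \<notin> {0,1::real}"
      by (rule AE_not_in) (simp add: null_sets_completionI finite_imp_null_set_lborel)
    then have "AE t in lebesgue. t \<in> {0..1} \<longrightarrow> t \<notin> {0,1::real}" by eventually_elim auto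
    then have "AE t in LB. t \<notin> {0,1}" by (subst AE_restrict_space_iff) auto
    moreover have "AE t in LB. t \<in> {0..1}" by (rule AE_I2) simp
    ultimately show "AE t in LB. indicator {0<..<1} t * ?G t = g t * g' t"
      using is_gradient_unique[OF f gr(1)] is_gradient_unique[OF f' gr(2)]
      by eventually_elim (auto simp: indicator_def)
    have [measurable]: "(indicator {0<..<1} :: real \<Rightarrow> real) \<in> borel_measurable LB"
      using measurable_compose[OF measurable_LB_id, of "indicator {0<..<1}" borel] by simp
    have [measurable]: "g \<in> borel_measurable LB" "g' \<in> borel_measurable LB"
      "gradient f \<in> borel_measurable LB" "gradient f' \<in> borel_measurable LB"
      using f f' gr by (auto simp: is_gradient_iff)
    show "(\<lambda>t. indicator {0<..<1} t * ?G t) \<in> borel_measurable LB" by measurable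
    show "(\<lambda>t. g t * g' t) \<in> borel_measurable LB" by measurable
  qed
  finally show ?thesis unfolding dirichlet_form_def set_lebesgue_integral_def .
qed

lemma H10_gradient: "f \<in> H10 \<Longrightarrow> is_gradient f (gradient f)"
  unfolding H10_def by (auto intro: is_gradient_gradient)

lemma H10_lincomb:
  assumes "finite I" "\<And>i. i \<in> I \<Longrightarrow> f i \<in> H10"
  shows "(\<lambda>x. \<Sum>i\<in>I. c i * f i x) \<in> H10"
proof -
  have "is_gradient (\<lambda>x. \<Sum>i\<in>I. c i * f i x) (\<lambda>x. \<Sum>i\<in>I. c i * gradient (f i) x)"
    using assms H10_gradient by (intro is_gradient_lincomb) auto
  then show ?thesis using assms unfolding H10_def by (auto intro!: sum.neutral)
qed

lemma dirichlet_form_commute: "dirichlet_form f g = dirichlet_form g f"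
  unfolding dirichlet_form_def by (simp add: mult.commute)

lemma integrable_gradient_mult:
  assumes "is_gradient f g" "is_gradient f' g'"
  shows "integrable LB (\<lambda>t. g t * g' t)"
  using assms unfolding is_gradient_iff by (intro integrable_mult_square_integrable) auto

lemma dirichlet_form_lincomb:
  assumes I: "finite I" "\<And>i. i \<in> I \<Longrightarrow> f i \<in> H10" and h: "h \<in> H10"
  shows "dirichlet_form (\<lambda>x. \<Sum>i\<in>I. c i * f i x) h = (\<Sum>i\<in>I. c i * dirichlet_form (f i) h)"
proof -
  have gr: "is_gradient (\<lambda>x. \<Sum>i\<in>I. c i * f i x) (\<lambda>x. \<Sum>i\<in>I. c i * gradient (f i) x)"
    using I H10_gradient by (intro is_gradient_lincomb) auto
  have "dirichlet_form (\<lambda>x. \<Sum>i\<in>I. c i * f i x) h =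
      (\<integral>t. (\<Sum>i\<in>I. c i * gradient (f i) t) * gradient h t \<partial>LB)"
    by (rule dirichlet_form_eq[OF gr H10_gradient[OF h]])
  also have "\<dots> = (\<integral>t. (\<Sum>i\<in>I. c i * (gradient (f i) t * gradient h t)) \<partial>LB)"
    by (simp add: sum_distrib_right mult.assoc)
  also have "\<dots> = (\<Sum>i\<in>I. \<integral>t. c i * (gradient (f i) t * gradient h t) \<partial>LB)"
    by (intro Bochner_Integration.integral_sum integrable_mult_right
        integrable_gradient_mult[OF H10_gradient H10_gradient] I h)
  also have "\<dots> = (\<Sum>i\<in>I. c i * dirichlet_form (f i) h)"
    by (intro sum.cong refl) (simp add: dirichlet_form_eq[OF H10_gradient[OF I(2)] H10_gradient[OF h]])
  finally show ?thesis .
qed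

lemma dirichlet_form_self:
  assumes "f \<in> H10"
  shows "dirichlet_form f f = (\<integral>t. (gradient f t)\<^sup>2 \<partial>LB)"
  using dirichlet_form_eq[OF H10_gradient[OF assms] H10_gradient[OF assms]]
  by (simp add: power2_eq_square)

lemma dirichlet_form_self_nonneg: "f \<in> H10 \<Longrightarrow> dirichlet_form f f \<ge> 0"
  by (simp add: dirichlet_form_self)

lemma dirichlet_form_Cauchy_Schwarz:
  assumes "f \<in> H10" "h \<in> H10"
  shows "(dirichlet_form f h)\<^sup>2 \<le> dirichlet_form f f * dirichlet_form h h"
  unfolding dirichlet_form_self[OF assms(1)] dirichlet_form_self[OF assms(2)]
    dirichlet_form_eq[OF H10_gradient[OF assms(1)] H10_gradient[OF assms(2)]]
  using H10_gradient[OF assms(1)] H10_gradient[OF assms(2)] unfolding is_gradient_iff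
  by (intro integral_Cauchy_Schwarz) auto

text \<open>Half-open intervals match \<open>dyadic_cell\<close> and make the energy additive when a
  cell is halved.\<close>

definition energy_on :: "(real \<Rightarrow> real) \<Rightarrow> real \<Rightarrow> real \<Rightarrow> real" where
  "energy_on f a b = (\<integral>t. indicator {a<..b} t * (gradient f t)\<^sup>2 \<partial>LB)"

lemma energy_on_integrable:
  assumes "f \<in> H10"
  shows "integrable LB (\<lambda>t. indicator {a<..b} t * (gradient f t)\<^sup>2)"
  using H10_gradient[OF assms] unfolding is_gradient_iff
  by (intro integrable_LB_indicator_mult) auto

lemma energy_on_add:
  assumes "f \<in> H10" "a \<le> b" "b \<le> c"
  shows "energy_on f a b + energy_on f b c = energy_on f a c"
proof -
  have "energy_on f a b + energy_on f b c = (\<integral>t. indicator {a<..b} t * (gradient f t)\<^sup>2 + indicator {b<..c} t * (gradient f t)\<^sup>2 \<partial>LB)"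
    unfolding energy_on_def by (simp add: energy_on_integrable[OF assms(1)])
  also have "\<dots> = energy_on f a c" unfolding energy_on_def
    by (intro Bochner_Integration.integral_cong) (use assms in \<open>auto simp: indicator_def\<close>)
  finally show ?thesis .
qed

lemma energy_on_nonneg: "energy_on f a b \<ge> 0"
  unfolding energy_on_def by (intro integral_nonneg_AE) auto

lemma AE_LB_neq: "AE t in LB. t \<noteq> (c::real)"
proof -
  have "AE t in lebesgue. t \<notin> {c::real}"
    by (rule AE_not_in) (simp add: null_sets_completionI finite_imp_null_set_lborel)
  then have "AE t in lebesgue. t \<in> {0..1} \<longrightarrow> t \<noteq> c" by eventually_elim auto
  then show ?thesis by (subst AE_restrict_space_iff) auto
qed

lemma energy_on_unit:
  assumes "f \<in> H10"
  shows "energy_on f 0 1 = dirichlet_form f f"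
proof -
  have [measurable]: "gradient f \<in> borel_measurable LB"
    using H10_gradient[OF assms] by (simp add: is_gradient_iff)
  have "AE t in LB. t \<in> {0..1}" by (rule AE_I2) simp
  with AE_LB_neq[of 0] have "AE t in LB. indicator {0<..1} t * (gradient f t)\<^sup>2 = (gradient f t)\<^sup>2"
    by eventually_elim (auto simp: indicator_def)
  then show ?thesis unfolding energy_on_def dirichlet_form_self[OF assms]
    using borel_measurable_integrable[OF energy_on_integrable[OF assms, of 0 1]]
    by (intro integral_cong_AE) auto
qed

lemma integral_indicator_LB:
  assumes "A \<in> sets borel" "A \<subseteq> {0..1}"
  shows "(\<integral>t. indicator A t \<partial>LB) = measure lborel A"
proof -
  have "(\<integral>t. indicator A t \<partial>LB) = measure LB (A \<inter> space LB)"
    by (rule Bochner_Integration.integral_indicator)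
  also have "A \<inter> space LB = A" using assms by auto
  also have "measure LB A = measure lebesgue A" using assms by (subst measure_restrict_space) auto
  finally show ?thesis using assms by simp
qed

text \<open>Cauchy-Schwarz for the increment \<open>f x - f a\<close>, an integral of the gradient
  over (a, x]. The inequality refers to the left endpoint alone, which is all that the bisection in
  \<open>dyadic_cell_Poincare\<close> controls.\<close>

lemma energy_on_Poincare:
  assumes f: "f \<in> H10" and x: "0 \<le> a" "a \<le> x" "x \<le> b" "b \<le> 1"
  shows "(f x - f a)\<^sup>2 \<le> (b - a) * energy_on f a b"
proof -
  interpret finite_measure LB by (rule finite_LB)
  let ?g = "gradient f"
  let ?I = "indicator {a<..x} :: real \<Rightarrow> real"
  note g = H10_gradient[OF f]
  have [measurable]: "?g \<in> borel_measurable LB" and sq: "integrable LB (\<lambda>t. (?g t)\<^sup>2)"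
    using g by (auto simp: is_gradient_iff)
  have int: "integrable LB ?g" using g by (auto simp: is_gradient_iff intro: integrable_LB_if_square)
  have [measurable]: "?I \<in> borel_measurable LB"
    using measurable_compose[OF measurable_LB_id, of ?I borel] by simp
  have "f x - f a = (\<integral>t. indicator {0..x} t * ?g t \<partial>LB) - (\<integral>t. indicator {0..a} t * ?g t \<partial>LB)"
    using g x unfolding is_gradient_iff by auto
  \<comment> \<open>The indicator is idempotent; writing it twice lets Cauchy-Schwarz produce the
    length of (a, x] and the energy on it.\<close>
  also have "\<dots> = (\<integral>t. ?I t * (?I t * ?g t) \<partial>LB)"
  proof (subst Bochner_Integration.integral_diff[symmetric])
    show "(\<integral>t. indicator {0..x} t * ?g t - indicator {0..a} t * ?g t \<partial>LB) = (\<integral>t. ?I t * (?I t * ?g t) \<partial>LB)"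
      using x by (intro Bochner_Integration.integral_cong) (auto simp: indicator_def)
  qed (rule integrable_LB_indicator_mult[OF int], simp)+
  finally have "(f x - f a)\<^sup>2 \<le> (\<integral>t. (?I t)\<^sup>2 \<partial>LB) * (\<integral>t. (?I t * ?g t)\<^sup>2 \<partial>LB)"
  proof (simp only:, intro integral_Cauchy_Schwarz)
    have sq_ind: "(?I t)\<^sup>2 = ?I t" for t by (simp add: indicator_def)
    show "integrable LB (\<lambda>t. (?I t)\<^sup>2)" unfolding sq_ind
      using integrable_LB_indicator_mult[of "\<lambda>_. 1" "{a<..x}"] by simp
    show "integrable LB (\<lambda>t. (?I t * ?g t)\<^sup>2)"
      unfolding power_mult_distrib sq_ind by (rule energy_on_integrable[OF f])
  qed measurable
  also have "\<dots> \<le> (b - a) * energy_on f a b"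
  proof (rule mult_mono)
    have "(\<integral>t. (?I t)\<^sup>2 \<partial>LB) = (\<integral>t. ?I t \<partial>LB)"
      by (intro Bochner_Integration.integral_cong) (auto simp: indicator_def)
    also have "\<dots> = x - a" using x by (subst integral_indicator_LB) auto
    finally show "(\<integral>t. (?I t)\<^sup>2 \<partial>LB) \<le> b - a" using x by simp
    show "(\<integral>t. (?I t * ?g t)\<^sup>2 \<partial>LB) \<le> energy_on f a b"
      unfolding energy_on_def
    proof (rule integral_mono)
      show "integrable LB (\<lambda>t. (?I t * ?g t)\<^sup>2)"
      proof -
        have "(\<lambda>t. (?I t * ?g t)\<^sup>2) = (\<lambda>t. ?I t * (?g t)\<^sup>2)" by (auto simp: indicator_def)
        then show ?thesis using energy_on_integrable[OF f, of a x] by simp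
      qed
    qed (use x energy_on_integrable[OF f] in \<open>auto simp: indicator_def\<close>)
  qed (use x in auto)
  finally show ?thesis .
qed

text \<open>Finite energy gives Hoelder continuity of exponent 1/2.\<close>

lemma H10_continuous_on:
  assumes f: "f \<in> H10"
  shows "continuous_on {0..1} f"
proof -
  have holder: "(f y - f x)\<^sup>2 \<le> (y - x) * dirichlet_form f f" if "0 \<le> x" "x \<le> y" "y \<le> 1" for x y
  proof -
    have "energy_on f x y \<le> dirichlet_form f f"
      using energy_on_unit[OF f] energy_on_add[OF f, of 0 x y] energy_on_add[OF f, of 0 y 1] that
        energy_on_nonneg[of f 0 x] energy_on_nonneg[of f y 1] by simp
    then show ?thesis
      using energy_on_Poincare[OF f that(1,2) order_refl that(3)] that
      by (meson mult_left_mono order_trans diff_ge_0_iff_ge)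
  qed
  let ?D = "dirichlet_form f f"
  show ?thesis
    unfolding continuous_on_iff
  proof (intro ballI allI impI)
    fix x e :: real assume x: "x \<in> {0..1}" and e: "e > 0"
    have D: "?D \<ge> 0" using dirichlet_form_self_nonneg[OF f] .
    show "\<exists>d>0. \<forall>x'\<in>{0..1}. dist x' x < d \<longrightarrow> dist (f x') (f x) < e"
    \<comment> \<open>The summand 1 covers the case of zero energy.\<close>
    proof (intro exI[of _ "e^2 / (?D + 1)"] conjI ballI impI)
      show "0 < e^2 / (?D + 1)" using e D by simp
      fix x' :: real assume x': "x' \<in> {0..1}" "dist x' x < e^2 / (?D + 1)"
      have "(f x' - f x)\<^sup>2 \<le> \<bar>x' - x\<bar> * ?D"
        using holder[of x x'] holder[of x' x] x x' by (cases "x \<le> x'") (auto simp: power2_commute)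
      also have "\<dots> \<le> \<bar>x' - x\<bar> * (?D + 1)" by (intro mult_left_mono) auto
      also have "\<dots> < e^2" using x' D by (simp add: dist_real_def field_simps)
      finally have "\<bar>f x' - f x\<bar> < e" using e power2_less_imp_less[of "\<bar>f x' - f x\<bar>" e] by simp
      then show "dist (f x') (f x) < e" by (simp add: dist_real_def)
    qed
  qed
qed

lemma dirichlet_form_eq_0_imp:
  assumes f: "f \<in> H10" and "dirichlet_form f f = 0"
  shows "f = (\<lambda>x. 0)"
proof
  fix x show "f x = 0"
  proof (cases "x \<in> {0..1}")
    case True
    have "(f x - f 0)\<^sup>2 \<le> (1 - 0) * energy_on f 0 1"
      using True by (intro energy_on_Poincare[OF f]) auto
    then show ?thesis using energy_on_unit[OF f] assms f by (simp add: H10_def)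
  qed (use f in \<open>simp add: H10_def\<close>)
qed

section \<open>The Green operator\<close>

text \<open>The setting for the eigenvalue counts and the upper bound: an arbitrary Borel
  probability measure on [0,1], so that atoms, also at the endpoints, have to be handled.\<close>

locale unit_interval_measure =
  fixes \<nu> :: "real measure"
  assumes sets_nu: "sets \<nu> = sets (restrict_space borel {0..1})"
    and emeasure_space_nu: "emeasure \<nu> (space \<nu>) = 1"

sublocale unit_interval_measure \<subseteq> prob_space \<nu>
  by (rule prob_spaceI) (rule emeasure_space_nu)

context unit_interval_measure
begin

lemma space_nu [simp]: "space \<nu> = {0..1}"
  using sets_eq_imp_space_eq[OF sets_nu] by simp

lemma sets_nu_iff: "A \<in> sets \<nu> \<longleftrightarrow> A \<in> sets borel \<and> A \<subseteq> {0..1}"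
  unfolding sets_nu by (auto simp: sets_restrict_space_iff)

lemma measurable_nu_id [measurable]: "(\<lambda>x. x) \<in> measurable \<nu> borel"
  unfolding measurable_cong_sets[OF sets_nu refl] by (rule measurable_restrict_space1) simp

lemma continuous_on_measurable_nu:
  fixes f :: "real \<Rightarrow> real"
  assumes "continuous_on {0..1} f"
  shows "f \<in> borel_measurable \<nu>"
  unfolding measurable_cong_sets[OF sets_nu refl]
  using assms by (rule borel_measurable_continuous_on_restrict)

lemma continuous_on_bounded_unit:
  fixes f :: "real \<Rightarrow> real"
  assumes "continuous_on {0..1} f"
  obtains M where "M \<ge> 0" "\<And>x. x \<in> {0..1} \<Longrightarrow> \<bar>f x\<bar> \<le> M"
proof -
  have "bounded (f ` {0..1})"
    by (intro compact_imp_bounded compact_continuous_image assms) auto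
  then obtain M where "\<forall>x\<in>{0..1}. \<bar>f x\<bar> \<le> M" by (auto simp: bounded_iff)
  then show ?thesis by (intro that[of "max M 0"]) force+
qed

lemma continuous_on_integrable_nu:
  fixes f :: "real \<Rightarrow> real"
  assumes "continuous_on {0..1} f"
  shows "integrable \<nu> f"
proof -
  obtain M where "\<And>x. x \<in> {0..1} \<Longrightarrow> \<bar>f x\<bar> \<le> M" using continuous_on_bounded_unit[OF assms] by blast
  then show ?thesis
    by (intro integrable_const_bound[where B=M] continuous_on_measurable_nu assms AE_I2) auto
qed

abbreviation ip :: "(real \<Rightarrow> real) \<Rightarrow> (real \<Rightarrow> real) \<Rightarrow> real" where
  "ip f g \<equiv> (\<integral>x. f x * g x \<partial>\<nu>)"

lemma integrable_ip:
  "continuous_on {0..1} f \<Longrightarrow> continuous_on {0..1} g \<Longrightarrow> integrable \<nu> (\<lambda>x. f x * g x :: real)"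
  by (intro continuous_on_integrable_nu continuous_intros)

lemma ip_self_nonneg: "ip f f \<ge> 0"
  by (intro integral_nonneg_AE) auto

text \<open>The kernel is the Green function of -u'' on [0,1] with Dirichlet boundary conditions, so
  \<open>green f\<close> solves -u'' = f \<nu> weakly. The value 0 outside [0,1] follows the
  encoding of \<open>H10\<close>.\<close>

definition green :: "(real \<Rightarrow> real) \<Rightarrow> real \<Rightarrow> real" where
  "green f x = (if x \<in> {0..1} then (\<integral>y. (min x y - x * y) * f y \<partial>\<nu>) else 0)"

text \<open>The Green kernel is differentiated in its first argument under the integral; it has
  slope 1 - y to the left of y and - y to the right.\<close>

definition green_slope :: "(real \<Rightarrow> real) \<Rightarrow> real \<Rightarrow> real" where
  "green_slope f s = (\<integral>y. ((if s < y then 1 else 0) - y) * f y \<partial>\<nu>)"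

text \<open>One exchange of integrals with two uses: with u an indicator of [0, x] it shows that
  \<open>green_slope\<close> is the gradient of \<open>green\<close>, and with u the gradient of an
  element of \<open>H10\<close> it yields the weak equation.\<close>

lemma green_slope_Fubini:
  assumes f: "continuous_on {0..1} f" and u: "is_gradient v u"
  shows "(\<integral>s. green_slope f s * u s \<partial>LB) = (\<integral>y. f y * (v y - y * v 1) \<partial>\<nu>)"
proof -
  interpret L: finite_measure LB by (rule finite_LB)
  interpret P: pair_sigma_finite LB \<nu> ..
  have [measurable]: "u \<in> borel_measurable LB" using u by (simp add: is_gradient_iff)
  have iu: "integrable LB u" using u by (auto simp: is_gradient_iff intro: integrable_LB_if_square)
  have [measurable]: "f \<in> borel_measurable \<nu>" by (rule continuous_on_measurable_nu[OF f])
  obtain M where M: "M \<ge> 0" "\<And>x. x \<in> {0..1} \<Longrightarrow> \<bar>f x\<bar> \<le> M"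
    using continuous_on_bounded_unit[OF f] by blast
  define F where "F s y = ((if s < y then 1 else 0) - y) * f y * u s" for s y :: real
  have Fm [measurable]: "case_prod F \<in> borel_measurable (LB \<Otimes>\<^sub>M \<nu>)"
  proof -
    have [measurable]: "fst \<in> borel_measurable (LB \<Otimes>\<^sub>M \<nu>)" "snd \<in> borel_measurable (LB \<Otimes>\<^sub>M \<nu>)"
      using measurable_compose[OF measurable_fst measurable_LB_id]
        measurable_compose[OF measurable_snd measurable_nu_id] by (auto simp: comp_def)
    have "(\<lambda>z. ((if fst z < snd z then 1 else 0) - snd z) * f (snd z) * u (fst z)) \<in> borel_measurable (LB \<Otimes>\<^sub>M \<nu>)"
      by measurable
    then show ?thesis by (simp add: F_def case_prod_beta')
  qed
  have F_int: "integrable (LB \<Otimes>\<^sub>M \<nu>) (case_prod F)"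
  proof (rule P.Fubini_integrable)
    have bound: "\<bar>F s y\<bar> \<le> M * \<bar>u s\<bar>" if "y \<in> {0..1}" for s y
    proof -
      have "\<bar>(if s < y then 1 else 0) - y\<bar> \<le> 1" using that by auto
      then have "\<bar>((if s < y then 1 else 0) - y) * f y\<bar> \<le> 1 * M"
        unfolding abs_mult using M that by (intro mult_mono) auto
      then show ?thesis unfolding F_def abs_mult[of _ "u s"] by (intro mult_right_mono) auto
    qed
    have int2: "integrable \<nu> (F s)" for s
      unfolding F_def
    proof (intro integrable_const_bound[where B="M * \<bar>u s\<bar>"] AE_I2)
      show "(\<lambda>y. ((if s < y then 1 else 0) - y) * f y * u s) \<in> borel_measurable \<nu>" by measurable
    qed (use bound[unfolded F_def] in auto)
    then show "AE x in LB. integrable \<nu> (\<lambda>y. case_prod F (x, y))" by simp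
    show "integrable LB (\<lambda>x. LINT y|\<nu>. norm (case_prod F (x, y)))"
    proof (rule Bochner_Integration.integrable_bound)
      show "integrable LB (\<lambda>s. M * \<bar>u s\<bar>)" using iu by simp
      show "(\<lambda>x. LINT y|\<nu>. norm (case_prod F (x, y))) \<in> borel_measurable LB" by measurable
      have "\<bar>LINT y|\<nu>. \<bar>F s y\<bar>\<bar> \<le> M * \<bar>u s\<bar>" for s
      proof -
        have "(LINT y|\<nu>. \<bar>F s y\<bar>) \<le> (LINT y|\<nu>. M * \<bar>u s\<bar>)"
          using int2[of s] bound by (intro integral_mono) auto
        then show ?thesis using prob_space by simp
      qed
      then show "AE s in LB. norm (LINT y|\<nu>. norm (case_prod F (s, y))) \<le> norm (M * \<bar>u s\<bar>)"
        using M by (intro AE_I2) (auto simp: abs_mult)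
    qed
  qed measurable
  have "(\<integral>s. green_slope f s * u s \<partial>LB) = (\<integral>s. (\<integral>y. F s y \<partial>\<nu>) \<partial>LB)"
    unfolding green_slope_def F_def by simp
  also have "\<dots> = (\<integral>y. (\<integral>s. F s y \<partial>LB) \<partial>\<nu>)"
    by (rule P.Fubini_integral[OF F_int, symmetric])
  also have "\<dots> = (\<integral>y. f y * (v y - y * v 1) \<partial>\<nu>)"
  proof (rule Bochner_Integration.integral_cong[OF refl])
    fix y assume "y \<in> space \<nu>"
    then have y: "y \<in> {0..1}" by simp
    have i1: "integrable LB (\<lambda>s. indicator {0..y} s * u s)" "integrable LB (\<lambda>s. indicator {0..1} s * u s)"
      by (intro integrable_LB_indicator_mult iu; simp)+
    have "(\<integral>s. F s y \<partial>LB) = (\<integral>s. f y * (indicator {0..y} s * u s - y * (indicator {0..1} s * u s)) \<partial>LB)"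
    proof (rule integral_cong_AE)
      have "AE t in LB. t \<in> {0..1}" by (rule AE_I2) simp
      \<comment> \<open>At s = y the strict inequality in \<open>F\<close> and the closed interval
        {0..y} disagree; a single point is null for Lebesgue measure.\<close>
      with AE_LB_neq[of y] show "AE s in LB. F s y = f y * (indicator {0..y} s * u s - y * (indicator {0..1} s * u s))"
        by eventually_elim (use y in \<open>auto simp: F_def indicator_def algebra_simps\<close>)
      show "(\<lambda>s. F s y) \<in> borel_measurable LB" unfolding F_def by measurable
      show "(\<lambda>s. f y * (indicator {0..y} s * u s - y * (indicator {0..1} s * u s))) \<in> borel_measurable LB"
        using borel_measurable_integrable[OF i1(1)] borel_measurable_integrable[OF i1(2)] by measurable
    qed
    also have "\<dots> = f y * (v y - y * v 1)"
      using i1 y u by (simp add: is_gradient_iff)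
    finally show "(\<integral>s. F s y \<partial>LB) = f y * (v y - y * v 1)" .
  qed
  finally show ?thesis .
qed

text \<open>The test function that recovers \<open>green f x\<close> from its slope;
  \<open>tent\<close> is a combination of four such functions.\<close>

lemma is_gradient_min:
  assumes "x \<in> {0..1}"
  shows "is_gradient (\<lambda>z. min z x) (indicator {0..x})"
proof -
  have "(indicator {0..x} :: real \<Rightarrow> real) \<in> borel_measurable LB"
    using measurable_compose[OF measurable_LB_id, of "indicator {0..x}" borel] by simp
  moreover have "(\<lambda>t. (indicator {0..x} t)\<^sup>2) = (indicator {0..x} :: real \<Rightarrow> real)"
    by (auto simp: indicator_def)
  moreover have "min z x = (\<integral>t. indicator {0..z} t * indicator {0..x} t \<partial>LB)" if "z \<in> {0..1}" for z
  proof -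
    have "(\<integral>t. indicator {0..z} t * indicator {0..x} t \<partial>LB) = (\<integral>t. indicator {0..min z x} t \<partial>LB :: real)"
      by (intro Bochner_Integration.integral_cong) (auto simp: indicator_def)
    also have "\<dots> = min z x" using assms that by (subst integral_indicator_LB) auto
    finally show ?thesis by simp
  qed
  moreover have "integrable LB (indicator {0..x} :: real \<Rightarrow> real)"
  proof -
    interpret finite_measure LB by (rule finite_LB)
    show ?thesis using integrable_LB_indicator_mult[of "\<lambda>_. 1" "{0..x}"] by simp
  qed
  ultimately show ?thesis unfolding is_gradient_iff by auto
qed

lemma is_gradient_green:
  assumes f: "continuous_on {0..1} f"
  shows "is_gradient (green f) (green_slope f)"
  unfolding is_gradient_iff
proof (intro conjI ballI)
  interpret L: finite_measure LB by (rule finite_LB)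
  have [measurable]: "f \<in> borel_measurable \<nu>" by (rule continuous_on_measurable_nu[OF f])
  obtain M where M: "M \<ge> 0" "\<And>x. x \<in> {0..1} \<Longrightarrow> \<bar>f x\<bar> \<le> M"
    using continuous_on_bounded_unit[OF f] by blast
  show meas: "green_slope f \<in> borel_measurable LB"
    unfolding green_slope_def
  proof (rule borel_measurable_lebesgue_integral)
    have [measurable]: "fst \<in> borel_measurable (LB \<Otimes>\<^sub>M \<nu>)" "snd \<in> borel_measurable (LB \<Otimes>\<^sub>M \<nu>)"
      using measurable_compose[OF measurable_fst measurable_LB_id]
        measurable_compose[OF measurable_snd measurable_nu_id] by (auto simp: comp_def)
    have "(\<lambda>z. ((if fst z < snd z then 1 else 0) - snd z) * f (snd z)) \<in> borel_measurable (LB \<Otimes>\<^sub>M \<nu>)"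
      by measurable
    then show "(\<lambda>(x, y). ((if x < y then 1 else 0) - y) * f y) \<in> borel_measurable (LB \<Otimes>\<^sub>M \<nu>)"
      by (simp add: case_prod_beta')
  qed
  have "\<bar>green_slope f s\<bar> \<le> M" for s
  proof -
    have "\<bar>((if s < y then 1 else 0) - y) * f y\<bar> \<le> 1 * M" if "y \<in> {0..1}" for y
      unfolding abs_mult using M that by (intro mult_mono) auto
    then have "(\<integral>y. \<bar>((if s < y then 1 else 0) - y) * f y\<bar> \<partial>\<nu>) \<le> (\<integral>y. M \<partial>\<nu>)"
      using M by (intro integral_mono_AE' AE_I2) auto
    also have "\<dots> = M" using prob_space by simp
    finally show ?thesis unfolding green_slope_def by (rule order_trans[OF integral_abs_bound])
  qed
  then have "\<bar>(green_slope f s)\<^sup>2\<bar> \<le> M^2" for s by (simp add: abs_le_square_iff[symmetric] M)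
  then show "integrable LB (\<lambda>x. (green_slope f x)\<^sup>2)"
    using meas by (intro L.integrable_const_bound[where B="M^2"] AE_I2) auto
  fix x :: real assume x: "x \<in> {0..1}"
  have "(\<integral>t. indicator {0..x} t * green_slope f t \<partial>LB) = (\<integral>t. green_slope f t * indicator {0..x} t \<partial>LB)"
    by (simp add: mult.commute)
  also have "\<dots> = (\<integral>y. f y * (min y x - y * min 1 x) \<partial>\<nu>)"
    by (rule green_slope_Fubini[OF f is_gradient_min[OF x]])
  also have "\<dots> = green f x"
    unfolding green_def using x by (auto simp: min.commute mult_ac intro!: Bochner_Integration.integral_cong)
  finally show "green f x = (\<integral>t. indicator {0..x} t * green_slope f t \<partial>LB)" by simp
qed

lemma green_H10:
  assumes "continuous_on {0..1} f"
  shows "green f \<in> H10"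
proof -
  have "green f 0 = 0" unfolding green_def
    by simp (rule integral_eq_zero_AE, rule AE_I2, simp add: min_def)
  moreover have "green f 1 = 0" unfolding green_def
    by simp (rule integral_eq_zero_AE, rule AE_I2, simp add: min_def)
  ultimately show ?thesis unfolding H10_def using is_gradient_green[OF assms]
    by (auto simp: green_def)
qed

text \<open>The weak form of -u'' = f \<nu>, saying that \<open>green\<close> inverts the operator.
  The boundary value \<open>v 1 = 0\<close> removes the correction term of
  \<open>green_slope_Fubini\<close>.\<close>

lemma dirichlet_form_green:
  assumes f: "continuous_on {0..1} f" and v: "v \<in> H10"
  shows "dirichlet_form (green f) v = ip f v"
  unfolding dirichlet_form_eq[OF is_gradient_green[OF f] H10_gradient[OF v]]
    green_slope_Fubini[OF f H10_gradient[OF v]]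
  using v by (simp add: H10_def)

text \<open>The kernel is 1-Lipschitz in its first argument. This supplies the equicontinuity for
  Arzela-Ascoli in the variational argument.\<close>

lemma green_Lipschitz:
  assumes f: "continuous_on {0..1} f" and "x \<in> {0..1}" "x' \<in> {0..1}"
  shows "\<bar>green f x - green f x'\<bar> \<le> \<bar>x - x'\<bar> * (\<integral>y. \<bar>f y\<bar> \<partial>\<nu>)"
proof -
  let ?G = "\<lambda>x y. min x y - x * y :: real"
  have int: "integrable \<nu> (\<lambda>y. ?G x y * f y)" for x
    by (intro continuous_on_integrable_nu continuous_intros f)
  have "green f x - green f x' = (\<integral>y. ?G x y * f y - ?G x' y * f y \<partial>\<nu>)"
    using assms(2,3) int by (simp add: green_def)
  then have "\<bar>green f x - green f x'\<bar> \<le> (\<integral>y. \<bar>?G x y * f y - ?G x' y * f y\<bar> \<partial>\<nu>)"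
    by (simp only: integral_abs_bound)
  also have "\<dots> \<le> (\<integral>y. \<bar>x - x'\<bar> * \<bar>f y\<bar> \<partial>\<nu>)"
  proof (rule integral_mono)
    show "integrable \<nu> (\<lambda>y. \<bar>?G x y * f y - ?G x' y * f y\<bar>)"
      by (intro continuous_on_integrable_nu continuous_intros f)
    show "integrable \<nu> (\<lambda>y. \<bar>x - x'\<bar> * \<bar>f y\<bar>)"
      by (intro continuous_on_integrable_nu continuous_intros f)
    fix y assume "y \<in> space \<nu>"
    then have y: "0 \<le> y" "y \<le> 1" by auto
    have *: "\<bar>?G u y - ?G v y\<bar> \<le> v - u" if "u \<le> v" for u v
    proof -
      have "0 \<le> (v - u) * y" "(v - u) * y \<le> v - u"
        using y that by (auto intro: mult_left_le)
      then show ?thesis using that by (auto simp: min_def abs_if algebra_simps)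
    qed
    have "\<bar>?G x y - ?G x' y\<bar> \<le> \<bar>x - x'\<bar>"
      using *[of x x'] *[of x' x] by (cases "x \<le> x'") (auto simp: abs_minus_commute)
    then have "\<bar>?G x y - ?G x' y\<bar> * \<bar>f y\<bar> \<le> \<bar>x - x'\<bar> * \<bar>f y\<bar>" by (intro mult_right_mono) auto
    then show "\<bar>?G x y * f y - ?G x' y * f y\<bar> \<le> \<bar>x - x'\<bar> * \<bar>f y\<bar>"
      by (simp add: abs_mult[symmetric] algebra_simps)
  qed
  finally show ?thesis by simp
qed

lemma green_0 [simp]: "green f 0 = 0"
  unfolding green_def by simp (rule integral_eq_zero_AE, rule AE_I2, simp add: min_def)

lemma green_bound:
  assumes f: "continuous_on {0..1} f" and "x \<in> {0..1}"
  shows "\<bar>green f x\<bar> \<le> (\<integral>y. \<bar>f y\<bar> \<partial>\<nu>)"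
proof -
  have "\<bar>green f x - green f 0\<bar> \<le> \<bar>x - 0\<bar> * (\<integral>y. \<bar>f y\<bar> \<partial>\<nu>)"
    by (rule green_Lipschitz) (use assms in auto)
  also have "\<dots> \<le> 1 * (\<integral>y. \<bar>f y\<bar> \<partial>\<nu>)"
    using assms by (intro mult_right_mono) auto
  finally show ?thesis by simp
qed

lemma ip_Cauchy_Schwarz:
  assumes "continuous_on {0..1} f" "continuous_on {0..1} g"
  shows "(ip f g)\<^sup>2 \<le> ip f f * ip g g"
  using integral_Cauchy_Schwarz[OF continuous_on_measurable_nu[OF assms(1)] continuous_on_measurable_nu[OF assms(2)]]
    integrable_ip[OF assms(1) assms(1)] integrable_ip[OF assms(2) assms(2)]
  by (simp add: power2_eq_square)

lemma integral_abs_le_sqrt_ip: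
  assumes f: "continuous_on {0..1} f"
  shows "(\<integral>y. \<bar>f y\<bar> \<partial>\<nu>) \<le> sqrt (ip f f)"
proof -
  have "(ip (\<lambda>y. \<bar>f y\<bar>) (\<lambda>_. 1))\<^sup>2 \<le> ip (\<lambda>y. \<bar>f y\<bar>) (\<lambda>y. \<bar>f y\<bar>) * ip (\<lambda>_. 1) (\<lambda>_. 1)"
    by (intro ip_Cauchy_Schwarz continuous_intros f)
  then have "(\<integral>y. \<bar>f y\<bar> \<partial>\<nu>)\<^sup>2 \<le> ip f f" using prob_space by simp
  then show ?thesis by (rule real_le_rsqrt)
qed

text \<open>By compactness, finitely many open sets of measure zero cover \<open>K\<close>.\<close>

lemma measure_compact_off_support:
  assumes K: "compact K" "K \<subseteq> {0..1} - measure_support \<nu>"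
  shows "measure \<nu> K = 0"
proof -
  have "\<forall>x\<in>K. \<exists>U. open U \<and> x \<in> U \<and> \<not> measure \<nu> (U \<inter> space \<nu>) > 0"
  proof
    fix x assume "x \<in> K"
    then have "x \<in> space \<nu>" "x \<notin> measure_support \<nu>" using K(2) by auto
    then show "\<exists>U. open U \<and> x \<in> U \<and> \<not> measure \<nu> (U \<inter> space \<nu>) > 0"
      unfolding measure_support_def by blast
  qed
  then obtain U where U: "\<And>x. x \<in> K \<Longrightarrow> open (U x) \<and> x \<in> U x \<and> \<not> measure \<nu> (U x \<inter> space \<nu>) > 0"
    by metis
  from compactE_image[OF K(1), of K U] U obtain F where
    F: "F \<subseteq> K" "finite F" "K \<subseteq> (\<Union>x\<in>F. U x)" by blast
  have Us: "U x \<inter> {0..1} \<in> sets \<nu>" if "x \<in> F" for x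
    using U[of x] F that by (auto simp: sets_nu_iff)
  have "measure \<nu> K \<le> measure \<nu> (\<Union>x\<in>F. U x \<inter> {0..1})"
  proof (rule finite_measure_mono)
    show "K \<subseteq> (\<Union>x\<in>F. U x \<inter> {0..1})" using F K(2) by auto
    show "(\<Union>x\<in>F. U x \<inter> {0..1}) \<in> sets \<nu>" by (rule sets.finite_UN[OF F(2) Us])
  qed
  also have "\<dots> \<le> (\<Sum>x\<in>F. measure \<nu> (U x \<inter> {0..1}))"
    using Us F by (intro finite_measure_subadditive_finite) auto
  also have "\<dots> = 0"
    using U F by (intro sum.neutral) (auto simp: not_less intro!: antisym)
  finally show ?thesis by (simp add: measure_le_0_iff)
qed

text \<open>For y outside the interval spanned by x and \<open>x0\<close>, the kernel is affine in
  its first argument along that interval. Inside a gap of the support the interval is null, so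
  almost no y is excluded.\<close>

lemma green_C_supp:
  assumes f: "continuous_on {0..1} f"
  shows "green f \<in> C_supp \<nu>"
  unfolding C_supp_def
proof (intro CollectI conjI ballI)
  show "continuous_on {0..1} (green f)" by (rule H10_continuous_on[OF green_H10[OF f]])
  fix J assume J: "J \<in> components ({0..1} - measure_support \<nu>)"
  then have JJ: "connected J" "J \<subseteq> {0..1} - measure_support \<nu>" "J \<noteq> {}"
    by (auto simp: in_components_connected in_components_subset in_components_nonempty)
  then obtain x0 where x0: "x0 \<in> J" by auto
  let ?s = "green_slope f x0"
  show "\<exists>a b. \<forall>x\<in>J. green f x = a * x + b"
  proof (intro exI ballI)
    fix x assume x: "x \<in> J"
    let ?K = "{min x x0..max x x0}"
    have "min x x0 \<in> J" "max x x0 \<in> J" using x x0 by (auto simp: min_def max_def)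
    then have K: "?K \<subseteq> J" using JJ(1) by (intro connected_contains_Icc)
    have "?K \<subseteq> {0..1}" using K JJ(2) by blast
    then have Kn: "?K \<in> sets \<nu>" by (simp add: sets_nu_iff del: atLeastatMost_subset_iff)
    have "measure \<nu> ?K = 0"
      by (rule measure_compact_off_support[OF compact_Icc subset_trans[OF K JJ(2)]])
    then have "?K \<in> null_sets \<nu>" using Kn by (simp add: null_sets_def emeasure_eq_measure)
    then have AE: "AE y in \<nu>. y \<notin> ?K" by (rule AE_not_in)
    have xx: "x \<in> {0..1}" "x0 \<in> {0..1}" using JJ x x0 by auto
    have fm [measurable]: "f \<in> borel_measurable \<nu>" by (rule continuous_on_measurable_nu[OF f])
    have "green f x - green f x0 = (\<integral>y. (min x y - x * y) * f y \<partial>\<nu>) - (\<integral>y. (min x0 y - x0 * y) * f y \<partial>\<nu>)"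
      using xx by (simp add: green_def)
    also have "\<dots> = (\<integral>y. (min x y - x * y) * f y - (min x0 y - x0 * y) * f y \<partial>\<nu>)"
      by (intro Bochner_Integration.integral_diff[symmetric] continuous_on_integrable_nu continuous_intros f)
    also have "\<dots> = (\<integral>y. (x - x0) * (((if x0 < y then 1 else 0) - y) * f y) \<partial>\<nu>)"
    proof (rule integral_cong_AE)
      show "AE y in \<nu>. (min x y - x * y) * f y - (min x0 y - x0 * y) * f y =
          (x - x0) * (((if x0 < y then 1 else 0) - y) * f y)"
        using AE by eventually_elim (auto simp: min_def max_def algebra_simps split: if_splits)
    qed measurable
    also have "\<dots> = (x - x0) * ?s" unfolding green_slope_def by simp
    finally show "green f x = ?s * x + (green f x0 - ?s * x0)" by (simp add: algebra_simps)
  qed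
qed

lemma green_form_dom: "continuous_on {0..1} f \<Longrightarrow> green f \<in> form_dom \<nu>"
  by (simp add: form_dom_def green_H10 green_C_supp)

end

lemma C_supp_lincomb:
  assumes "finite I" "\<And>i. i \<in> I \<Longrightarrow> f i \<in> C_supp \<nu>"
  shows "(\<lambda>x. \<Sum>i\<in>I. c i * f i x) \<in> C_supp \<nu>"
  unfolding C_supp_def
proof (intro CollectI conjI ballI)
  show "continuous_on {0..1} (\<lambda>x. \<Sum>i\<in>I. c i * f i x)"
    using assms(2) unfolding C_supp_def by (intro continuous_intros) auto
  fix J assume J: "J \<in> components ({0..1} - measure_support \<nu>)"
  then have "\<forall>i\<in>I. \<exists>a b. \<forall>x\<in>J. f i x = a * x + b"
    using assms(2) unfolding C_supp_def by blast
  then obtain a b where ab: "\<And>i x. i \<in> I \<Longrightarrow> x \<in> J \<Longrightarrow> f i x = a i * x + b i" by metis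
  show "\<exists>a b. \<forall>x\<in>J. (\<Sum>i\<in>I. c i * f i x) = a * x + b"
  proof (intro exI ballI)
    fix x assume "x \<in> J"
    then have "(\<Sum>i\<in>I. c i * f i x) = (\<Sum>i\<in>I. c i * (a i * x + b i))"
      by (intro sum.cong) (auto simp: ab)
    also have "\<dots> = (\<Sum>i\<in>I. c i * a i) * x + (\<Sum>i\<in>I. c i * b i)"
      by (simp add: distrib_left sum.distrib sum_distrib_right mult.assoc)
    finally show "(\<Sum>i\<in>I. c i * f i x) = (\<Sum>i\<in>I. c i * a i) * x + (\<Sum>i\<in>I. c i * b i)" .
  qed
qed

lemma form_dom_lincomb:
  assumes "finite I" "\<And>i. i \<in> I \<Longrightarrow> f i \<in> form_dom \<nu>"
  shows "(\<lambda>x. \<Sum>i\<in>I. c i * f i x) \<in> form_dom \<nu>"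
  using assms C_supp_lincomb[of I f \<nu> c] H10_lincomb[of I f c] by (auto simp: form_dom_def)

context unit_interval_measure
begin

lemma form_dom_continuous: "f \<in> form_dom \<nu> \<Longrightarrow> continuous_on {0..1} f"
  by (simp add: form_dom_def H10_continuous_on)

text \<open>Test the eigenvalue equation with \<open>green u\<close>. This makes the orthogonal
  complement of eigenfunctions with nonzero eigenvalues invariant under
  \<open>green\<close>.\<close>

lemma eigenspace_green:
  assumes f: "f \<in> eigenspace \<nu> ev" and u: "continuous_on {0..1} u"
  shows "ev * ip (green u) f = ip u f"
proof -
  have "f \<in> H10" using f by (auto simp: eigenspace_def form_dom_def)
  then have "ip u f = dirichlet_form (green u) f" by (simp add: dirichlet_form_green[OF u])
  also have "\<dots> = dirichlet_form f (green u)" by (rule dirichlet_form_commute)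
  also have "\<dots> = ev * ip f (green u)"
    using f green_form_dom[OF u] by (auto simp: eigenspace_def)
  finally show ?thesis by (simp add: mult.commute)
qed

lemma green_continuous: "continuous_on {0..1} u \<Longrightarrow> continuous_on {0..1} (green u)"
  by (rule H10_continuous_on[OF green_H10])

text \<open>Both sides are the Dirichlet form of \<open>green u\<close> and
  \<open>green v\<close>.\<close>

lemma green_symmetric:
  assumes "continuous_on {0..1} u" "continuous_on {0..1} v"
  shows "ip (green u) v = ip u (green v)"
  using dirichlet_form_green[OF assms(1) green_H10[OF assms(2)]]
    dirichlet_form_green[OF assms(2) green_H10[OF assms(1)]]
  by (simp add: dirichlet_form_commute[of "green v"] mult.commute)

lemma green_nonneg:
  assumes "continuous_on {0..1} u"
  shows "ip (green u) u \<ge> 0"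
proof -
  have "ip (green u) u = dirichlet_form (green u) (green u)"
    using green_symmetric[OF assms assms] dirichlet_form_green[OF assms green_H10[OF assms]] by simp
  then show ?thesis using dirichlet_form_self_nonneg[OF green_H10[OF assms]] by simp
qed

lemma green_lin:
  assumes "continuous_on {0..1} u" "continuous_on {0..1} v"
  shows "green (\<lambda>x. a * u x + b * v x) x = a * green u x + b * green v x"
proof (cases "x \<in> {0..1}")
  case True
  have "(\<integral>y. (min x y - x * y) * (a * u y + b * v y) \<partial>\<nu>) =
     (\<integral>y. a * ((min x y - x * y) * u y) + b * ((min x y - x * y) * v y) \<partial>\<nu>)"
    by (simp add: algebra_simps)
  also have "\<dots> = (\<integral>y. a * ((min x y - x * y) * u y) \<partial>\<nu>) + (\<integral>y. b * ((min x y - x * y) * v y) \<partial>\<nu>)"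
    by (intro Bochner_Integration.integral_add continuous_on_integrable_nu continuous_intros assms)
  finally show ?thesis using True by (simp add: green_def)
next
  case False
  then show ?thesis by (simp add: green_def del: atLeastAtMost_iff)
qed

lemma ip_lin:
  assumes "continuous_on {0..1} u" "continuous_on {0..1} v" "continuous_on {0..1} w"
  shows "ip (\<lambda>x. a * u x + b * v x) w = a * ip u w + b * ip v w"
proof -
  have "ip (\<lambda>x. a * u x + b * v x) w = (\<integral>y. a * (u y * w y) + b * (v y * w y) \<partial>\<nu>)"
    by (simp add: algebra_simps)
  also have "\<dots> = (\<integral>y. a * (u y * w y) \<partial>\<nu>) + (\<integral>y. b * (v y * w y) \<partial>\<nu>)"
    by (intro Bochner_Integration.integral_add continuous_on_integrable_nu continuous_intros assms)
  finally show ?thesis by simp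
qed

lemma abs_ip_le:
  assumes f: "continuous_on {0..1} f" and g: "continuous_on {0..1} g"
    and e: "\<And>x. x \<in> {0..1} \<Longrightarrow> \<bar>f x\<bar> \<le> e"
  shows "\<bar>ip f g\<bar> \<le> e * (\<integral>x. \<bar>g x\<bar> \<partial>\<nu>)"
proof -
  have "\<bar>ip f g\<bar> \<le> (\<integral>x. \<bar>f x * g x\<bar> \<partial>\<nu>)" by (rule integral_abs_bound)
  also have "\<dots> \<le> (\<integral>x. e * \<bar>g x\<bar> \<partial>\<nu>)"
    by (intro integral_mono continuous_on_integrable_nu continuous_intros f g)
       (use e in \<open>auto simp: abs_mult intro!: mult_right_mono\<close>)
  finally show ?thesis by simp
qed

text \<open>Bounds the Rayleigh quotients of \<open>green\<close>, so that the supremum in the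
  variational argument is finite.\<close>

lemma ip_green_le:
  assumes f: "continuous_on {0..1} f"
  shows "ip (green f) f \<le> ip f f"
proof -
  have "ip (green f) f \<le> (\<integral>x. \<bar>f x\<bar> \<partial>\<nu>) * (\<integral>x. \<bar>f x\<bar> \<partial>\<nu>)"
    using abs_ip_le[OF green_continuous[OF f] f green_bound[OF f]] by simp
  also have "\<dots> \<le> sqrt (ip f f) * sqrt (ip f f)"
    by (intro mult_mono integral_abs_le_sqrt_ip f) (auto intro!: integral_nonneg_AE real_sqrt_ge_zero)
  finally show ?thesis by (simp add: ip_self_nonneg)
qed

text \<open>Maximising \<open>ip (green u) u\<close> over the unit sphere of the orthogonal complement \<open>Z\<close> of \<open>B\<close>: along a
  maximising sequence \<open>u n\<close> the residuals \<open>\<mu> u n - green (u n)\<close> tend to zero, while the functions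
  \<open>green (u n)\<close> have a uniformly convergent subsequence, whose limit is the eigenfunction.\<close>

lemma exists_orthogonal_eigenfunction:
  assumes B: "\<And>f. f \<in> B \<Longrightarrow> \<exists>ev. ev \<noteq> 0 \<and> f \<in> eigenspace \<nu> ev"
    and g: "g \<in> H10" "\<And>f. f \<in> B \<Longrightarrow> ip g f = 0" "ip g g > 0" "dirichlet_form g g \<le> x * ip g g"
  shows "\<exists>h ev. h \<in> eigenspace \<nu> ev \<and> h \<noteq> (\<lambda>x. 0) \<and> ev \<le> x \<and> (\<forall>f\<in>B. ip h f = 0)"
proof -
  \<comment> \<open>The argument stays among continuous functions: \<open>green\<close> preserves
    continuity, and compactness is obtained in the uniform norm.\<close>
  define Z where "Z = {u. continuous_on {0..1} u \<and> (\<forall>f\<in>B. ip u f = 0)}"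
  have Bc: "continuous_on {0..1} f" if "f \<in> B" for f
    using B[OF that] by (auto simp: eigenspace_def intro: form_dom_continuous)
  have Zc: "continuous_on {0..1} u" if "u \<in> Z" for u using that by (simp add: Z_def)
  have Zgreen: "green u \<in> Z" if "u \<in> Z" for u
    unfolding Z_def
  proof (intro CollectI conjI ballI)
    show "continuous_on {0..1} (green u)" by (rule green_continuous[OF Zc[OF that]])
    fix f assume f: "f \<in> B"
    then obtain ev where "ev \<noteq> 0" "f \<in> eigenspace \<nu> ev" using B by blast
    with eigenspace_green[OF _ Zc[OF that], of f ev] f that show "ip (green u) f = 0"
      by (auto simp: Z_def)
  qed
  have Zlin: "(\<lambda>x. a * u x + b * v x) \<in> Z" if "u \<in> Z" "v \<in> Z" for a b u v
    using that Bc by (auto simp: Z_def ip_lin intro!: continuous_intros)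
  define \<mu> where "\<mu> = Sup ((\<lambda>u. ip (green u) u) ` {u\<in>Z. ip u u = 1})"
  have bdd: "bdd_above ((\<lambda>u. ip (green u) u) ` {u\<in>Z. ip u u = 1})"
    by (rule bdd_aboveI[of _ 1]) (use ip_green_le Zc in force)
  have green_scale: "ip (green (\<lambda>x. c * u x)) (\<lambda>x. c * u x) = c^2 * ip (green u) u" if "u \<in> Z" for c u
    using green_lin[OF Zc[OF that] Zc[OF that], of c 0] by (simp add: power2_eq_square mult_ac)
  have R_le: "ip (green u) u \<le> \<mu> * ip u u" if u: "u \<in> Z" for u
  proof (cases "ip u u = 0")
    case True
    then show ?thesis using ip_green_le[OF Zc[OF u]] by simp
  next
    case False
    then have pos: "ip u u > 0" using ip_self_nonneg[of u] by linarith
    define c where "c = 1 / sqrt (ip u u)"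
    have c2: "c^2 = 1 / ip u u" using pos by (simp add: c_def power_divide)
    have "(\<lambda>x. c * u x) \<in> Z" using Zlin[OF u u, of c 0] by simp
    moreover have "ip (\<lambda>x. c * u x) (\<lambda>x. c * u x) = c^2 * ip u u"
      by (simp add: power2_eq_square mult_ac)
    ultimately have "ip (green (\<lambda>x. c * u x)) (\<lambda>x. c * u x) \<le> \<mu>"
      unfolding \<mu>_def using c2 pos by (intro cSup_upper bdd imageI) auto
    then have "c^2 * ip (green u) u \<le> \<mu>" by (simp only: green_scale[OF u])
    then show ?thesis unfolding c2 using pos by (simp add: field_simps)
  qed
  have gZ: "g \<in> Z" using g H10_continuous_on by (auto simp: Z_def)
  have "x \<ge> 0"
    using g(3,4) dirichlet_form_self_nonneg[OF g(1)] by (metis order_trans zero_le_mult_iff not_le)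
  \<comment> \<open>Cauchy-Schwarz for the Dirichlet form of \<open>green g\<close> and
    \<open>g\<close>: a quotient of at most x for the form forces a quotient of at least 1 / x for
    \<open>green\<close>.\<close>
  have "1 \<le> \<mu> * x"
  proof -
    have "(ip g g)\<^sup>2 = (dirichlet_form (green g) g)\<^sup>2" by (simp add: dirichlet_form_green[OF Zc[OF gZ] g(1)])
    also have "\<dots> \<le> dirichlet_form (green g) (green g) * dirichlet_form g g"
      by (intro dirichlet_form_Cauchy_Schwarz green_H10 Zc[OF gZ] g(1))
    also have "dirichlet_form (green g) (green g) = ip (green g) g"
      using green_symmetric[OF Zc[OF gZ] Zc[OF gZ]] dirichlet_form_green[OF Zc[OF gZ] green_H10[OF Zc[OF gZ]]] by simp
    also have "ip (green g) g * dirichlet_form g g \<le> (\<mu> * ip g g) * (x * ip g g)"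
      using R_le[OF gZ] g(4) green_nonneg[OF Zc[OF gZ]] dirichlet_form_self_nonneg[OF g(1)]
      by (intro mult_mono) auto
    finally have "1 * (ip g g)\<^sup>2 \<le> (\<mu> * x) * (ip g g)\<^sup>2" by (simp add: power2_eq_square mult_ac)
    then show ?thesis using g(3) by (simp del: mult_1)
  qed
  then have "\<mu> > 0" "x > 0" using \<open>x \<ge> 0\<close>
    by (auto simp: zero_less_mult_iff dest: order.strict_trans2[OF zero_less_one])
  define N where "N = sqrt (ip g g)"
  have ne: "{u\<in>Z. ip u u = 1} \<noteq> {}"
  proof -
    have "(\<lambda>x. (1 / N) * g x) \<in> Z" using Zlin[OF gZ gZ, of "1/N" 0] by simp
    moreover have "ip (\<lambda>x. (1 / N) * g x) (\<lambda>x. (1 / N) * g x) = (1 / N)^2 * ip g g"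
      by (simp add: power2_eq_square mult_ac)
    ultimately show ?thesis using g(3) by (auto simp: N_def power_divide)
  qed
  have "\<exists>u. u \<in> Z \<and> ip u u = 1 \<and> ip (green u) u > \<mu> - 1 / (real n + 1)" for n
  proof -
    have "\<mu> - 1 / (real n + 1) < \<mu>" by simp
    then obtain z where "z \<in> (\<lambda>u. ip (green u) u) ` {u\<in>Z. ip u u = 1}" "\<mu> - 1 / (real n + 1) < z"
      using less_cSup_iff[OF _ bdd] ne unfolding \<mu>_def by blast
    then show ?thesis by auto
  qed
  then obtain u where u: "\<And>n. u n \<in> Z" "\<And>n. ip (u n) (u n) = 1"
      "\<And>n::nat. ip (green (u n)) (u n) > \<mu> - 1 / (real n + 1)" by metis
  have uc: "continuous_on {0..1} (u n)" for n using Zc u by auto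
  have uabs: "(\<integral>y. \<bar>u n y\<bar> \<partial>\<nu>) \<le> 1" for n
    using integral_abs_le_sqrt_ip[OF uc[of n]] u(2)[of n] by simp
  define F where "F n = green (u n)" for n
  define r where "r n = (\<lambda>x. \<mu> * u n x + (-1) * F n x)" for n
  have FZ: "F n \<in> Z" for n unfolding F_def by (rule Zgreen[OF u(1)])
  have rZ: "r n \<in> Z" for n unfolding r_def by (rule Zlin[OF u(1) FZ])
  \<comment> \<open>On \<open>Z\<close> the form \<open>\<mu> * ip v w - ip (green v) w\<close> is
    nonnegative by maximality of \<mu>. Its Cauchy-Schwarz inequality for \<open>u n\<close> and
    \<open>r n\<close> bounds the square of \<open>ip (r n) (r n)\<close> by the defect of
    \<open>u n\<close>, at most 1 / (n + 1), times \<open>\<mu> * ip (r n) (r n)\<close>.\<close>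
  have r_small: "ip (r n) (r n) \<le> \<mu> / (real n + 1)" for n
  proof -
    let ?a = "\<lambda>v w. \<mu> * ip v w - ip (green v) w"
    let ?U = "u n" and ?R = "r n"
    have "(?a ?U ?R)\<^sup>2 \<le> ?a ?U ?U * ?a ?R ?R"
    proof (rule quadratic_nonneg_imp_discriminant)
      fix s :: real
      note cont = Zc[OF rZ[of n]] uc[of n] green_continuous[OF uc[of n]] green_continuous[OF Zc[OF rZ[of n]]]
      let ?W = "\<lambda>x. 1 * ?U x + s * ?R x"
      have W: "?W \<in> Z" by (rule Zlin[OF u(1) rZ])
      have gW: "green ?W = (\<lambda>x. 1 * green ?U x + s * green ?R x)"
        by (rule ext, rule green_lin[OF cont(2) cont(1)])
      have e1: "ip ?W v = ip ?U v + s * ip ?R v" if "continuous_on {0..1} v" for v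
        using ip_lin[OF cont(2) cont(1) that, of 1 s] by simp
      have e2: "ip (green ?W) v = ip (green ?U) v + s * ip (green ?R) v" if "continuous_on {0..1} v" for v
        unfolding gW using ip_lin[OF cont(3) cont(4) that, of 1 s] by simp
      have e3: "ip v ?W = ip v ?U + s * ip v ?R" if "continuous_on {0..1} v" for v
        using e1[OF that] by (simp add: mult.commute)
      have sym: "ip (green ?R) ?U = ip (green ?U) ?R" "ip ?R ?U = ip ?U ?R"
        using green_symmetric[OF cont(1) cont(2)] by (simp_all add: mult.commute)
      have "0 \<le> ?a ?W ?W" using R_le[OF W] by simp
      also have "\<dots> = ?a ?U ?U + 2 * s * ?a ?U ?R + s^2 * ?a ?R ?R"
        unfolding e1[OF Zc[OF W]] e2[OF Zc[OF W]] e3[OF cont(1)] e3[OF cont(2)] e3[OF cont(3)] e3[OF cont(4)] sym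
        by (simp add: power2_eq_square algebra_simps)
      finally show "0 \<le> ?a ?U ?U + 2 * s * ?a ?U ?R + s^2 * ?a ?R ?R" .
    qed
    moreover have "?a ?U ?R = ip ?R ?R"
    proof -
      have "ip ?R ?R = \<mu> * ip ?U ?R + (-1) * ip (F n) ?R"
        using ip_lin[OF uc[of n] Zc[OF FZ[of n]] Zc[OF rZ[of n]], of \<mu> "-1"] unfolding r_def .
      then show ?thesis by (simp add: F_def)
    qed
    moreover have "?a ?U ?U * ?a ?R ?R \<le> ?a ?U ?U * (\<mu> * ip ?R ?R)"
      using R_le[OF u(1)[of n]] green_nonneg[OF Zc[OF rZ[of n]]] by (intro mult_left_mono) auto
    ultimately have *: "ip ?R ?R * ip ?R ?R \<le> (?a ?U ?U * \<mu>) * ip ?R ?R"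
      by (simp add: power2_eq_square mult_ac)
    have "ip ?R ?R \<le> ?a ?U ?U * \<mu>"
    proof (cases "ip ?R ?R = 0")
      case True
      have "?a ?U ?U * \<mu> \<ge> 0" using R_le[OF u(1)[of n]] \<open>\<mu> > 0\<close> by simp
      then show ?thesis using True by simp
    next
      case False
      then have "ip ?R ?R > 0" using ip_self_nonneg[of ?R] by linarith
      then show ?thesis using * by (rule mult_right_le_imp_le[rotated])
    qed
    also have "\<dots> \<le> (1 / (real n + 1)) * \<mu>"
      using u(2)[of n] u(3)[of n] \<open>\<mu> > 0\<close> by (intro mult_right_mono) auto
    finally show ?thesis by simp
  qed
  have "\<exists>h k. continuous_on {0..1} h \<and> strict_mono (k :: nat \<Rightarrow> nat) \<and>
     (\<forall>e>0. \<exists>N. \<forall>n x. n \<ge> N \<and> x \<in> {0..1} \<longrightarrow> norm (F (k n) x - h x) < e)"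
  proof (rule Arzela_Ascoli[of "{0..1}" F 1])
    show "norm (F n x) \<le> 1" if "x \<in> {0..1}" for n x
      using green_bound[OF uc that, of n] uabs[of n] by (simp add: F_def)
    fix x e :: real assume x: "x \<in> {0..1}" and e: "e > 0"
    have lip: "\<bar>F n x - F n y\<bar> \<le> \<bar>x - y\<bar>" if "y \<in> {0..1}" for n y
    proof -
      have "\<bar>F n x - F n y\<bar> \<le> \<bar>x - y\<bar> * (\<integral>y. \<bar>u n y\<bar> \<partial>\<nu>)"
        unfolding F_def by (rule green_Lipschitz[OF uc x that])
      also have "\<dots> \<le> \<bar>x - y\<bar> * 1" by (intro mult_left_mono uabs) auto
      finally show ?thesis by simp
    qed
    show "\<exists>d>0. \<forall>n y. y \<in> {0..1} \<and> norm (x - y) < d \<longrightarrow> norm (F n x - F n y) < e"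
    proof (intro exI[of _ e] conjI allI impI e)
      fix n y assume "y \<in> {0..1} \<and> norm (x - y) < e"
      then show "norm (F n x - F n y) < e" using lip[of y n] by simp
    qed
  qed (simp, blast)
  then obtain h k where hc: "continuous_on {0..1} h" and k: "strict_mono (k :: nat \<Rightarrow> nat)"
    and conv: "\<And>e. e > 0 \<Longrightarrow> \<exists>N. \<forall>n x. n \<ge> N \<and> x \<in> {0..1} \<longrightarrow> \<bar>F (k n) x - h x\<bar> < e"
    by auto
  have FC: "continuous_on {0..1} (F n)" for n by (rule Zc[OF FZ])
  have approx: "\<exists>n. (\<forall>x\<in>{0..1}. \<bar>F (k n) x - h x\<bar> < e) \<and> 1 / (real (k n) + 1) < e" if "e > 0" for e
  proof -
    obtain N where N: "\<forall>n x. n \<ge> N \<and> x \<in> {0..1} \<longrightarrow> \<bar>F (k n) x - h x\<bar> < e" using conv[OF \<open>e > 0\<close>] by auto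
    obtain M :: nat where M: "1 / e < real M" using reals_Archimedean2 by blast
    have "k (max N M) \<ge> M" using seq_suble[OF k, of "max N M"] by simp
    then have "1 / e < real (k (max N M)) + 1" using M by linarith
    then have "1 / (real (k (max N M)) + 1) < e" using \<open>e > 0\<close>
      by (simp add: field_simps)
    then show ?thesis using N by (intro exI[of _ "max N M"]) auto
  qed
  \<comment> \<open>Apply \<open>green\<close> to the residual: \<open>green (r m)\<close> is
    \<open>\<mu> * F m - green (F m)\<close>. It is uniformly small, and along the subsequence
    \<open>F m\<close> tends to \<open>h\<close> uniformly.\<close>
  have hgreen: "green h x = \<mu> * h x" if x: "x \<in> {0..1}" for x
  proof (rule ccontr)
    assume "green h x \<noteq> \<mu> * h x"
    define d where "d = \<bar>green h x - \<mu> * h x\<bar>"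
    have "d > 0" using \<open>green h x \<noteq> \<mu> * h x\<close> by (simp add: d_def)
    \<comment> \<open>Makes both \<open>e * (1 + \<mu>)\<close> and the square root of
      \<open>\<mu> * e\<close> at most d / 4, so the total error is at most d / 2.\<close>
    define e where "e = min (d / (4 * (1 + \<mu>))) (d^2 / (16 * \<mu>))"
    have "e \<le> d / (4 * (1 + \<mu>))" "e \<le> d^2 / (16 * \<mu>)" by (auto simp: e_def)
    then have e: "e * (1 + \<mu>) \<le> d / 4" "\<mu> * e \<le> (d / 4)^2"
      using \<open>\<mu> > 0\<close> by (auto simp: pos_le_divide_eq power_divide algebra_simps)
    have e0: "e > 0" using \<open>d > 0\<close> \<open>\<mu> > 0\<close> by (simp add: e_def)
    obtain n where n: "\<And>x. x\<in>{0..1} \<Longrightarrow> \<bar>F (k n) x - h x\<bar> < e" "1 / (real (k n) + 1) < e"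
      using approx[OF e0] by blast
    let ?m = "k n"
    have "green (r ?m) x = \<mu> * F ?m x - green (F ?m) x"
      unfolding r_def by (subst green_lin[OF uc FC]) (simp add: F_def)
    moreover have "\<bar>green (r ?m) x\<bar> \<le> d / 4"
    proof -
      have "\<bar>green (r ?m) x\<bar> \<le> sqrt (ip (r ?m) (r ?m))"
        using green_bound[OF Zc[OF rZ] x] integral_abs_le_sqrt_ip[OF Zc[OF rZ]] by (rule order_trans)
      also have "\<dots> \<le> sqrt (\<mu> * e)"
      proof (rule real_sqrt_le_mono[OF order_trans[OF r_small]])
        show "\<mu> / (real ?m + 1) \<le> \<mu> * e"
          using mult_left_mono[of "1 / (real ?m + 1)" e \<mu>] n(2) \<open>\<mu> > 0\<close> by simp
      qed
      also have "\<dots> \<le> d / 4" using e(2) \<open>d > 0\<close> by (intro real_le_lsqrt) auto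
      finally show ?thesis .
    qed
    moreover have "\<bar>green (F ?m) x - green h x\<bar> \<le> e"
    proof -
      have "green (\<lambda>y. 1 * F ?m y + (-1) * h y) x = green (F ?m) x - green h x"
        by (subst green_lin[OF FC hc]) simp
      moreover have "\<bar>green (\<lambda>y. 1 * F ?m y + (-1) * h y) x\<bar> \<le> (\<integral>y. \<bar>1 * F ?m y + (-1) * h y\<bar> \<partial>\<nu>)"
        by (intro green_bound continuous_intros FC hc x)
      moreover have "(\<integral>y. \<bar>1 * F ?m y + (-1) * h y\<bar> \<partial>\<nu>) \<le> (\<integral>y. e \<partial>\<nu>)"
        using n(1) by (intro integral_mono continuous_on_integrable_nu continuous_intros FC hc) (auto intro: less_imp_le)
      ultimately show ?thesis using prob_space by simp
    qed
    moreover have "\<bar>\<mu> * F ?m x - \<mu> * h x\<bar> \<le> \<mu> * e"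
      using n(1)[OF x] \<open>\<mu> > 0\<close> by (simp add: right_diff_distrib[symmetric] abs_mult)
    ultimately have "d \<le> d / 4 + e + \<mu> * e" unfolding d_def by linarith
    then show False using e(1) \<open>d > 0\<close> by (simp add: algebra_simps)
  qed
  have h_orth: "ip h f = 0" if f: "f \<in> B" for f
  proof (rule ccontr)
    assume "ip h f \<noteq> 0"
    define I where "I = (\<integral>x. \<bar>f x\<bar> \<partial>\<nu>)"
    have "I \<ge> 0" unfolding I_def by (intro integral_nonneg_AE) auto
    define e where "e = \<bar>ip h f\<bar> / (2 * (I + 1))"
    have e: "e > 0" using \<open>ip h f \<noteq> 0\<close> \<open>I \<ge> 0\<close> by (simp add: e_def)
    obtain n where n: "\<And>x. x\<in>{0..1} \<Longrightarrow> \<bar>F (k n) x - h x\<bar> < e" using approx[OF e] by blast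
    have "ip (\<lambda>x. 1 * F (k n) x + (-1) * h x) f = - ip h f"
      using FZ[of "k n"] f by (subst ip_lin[OF FC hc Bc[OF f]]) (simp add: Z_def)
    moreover have "\<bar>ip (\<lambda>x. 1 * F (k n) x + (-1) * h x) f\<bar> \<le> e * I"
      unfolding I_def using n by (intro abs_ip_le continuous_intros FC hc Bc[OF f]) (auto intro: less_imp_le)
    ultimately have "\<bar>ip h f\<bar> \<le> e * I" by simp
    also have "\<dots> \<le> \<bar>ip h f\<bar> / 2" unfolding e_def using \<open>I \<ge> 0\<close> by (simp add: field_simps)
    finally show False using \<open>ip h f \<noteq> 0\<close> by simp
  qed
  \<comment> \<open>If \<open>h\<close> were zero, \<open>F (k n)\<close> would tend to zero
    uniformly, while its product with the normalised \<open>u (k n)\<close> tends to \<mu> >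
    0.\<close>
  have h_nz: "\<exists>x\<in>{0..1}. h x \<noteq> 0"
  proof (rule ccontr)
    assume "\<not> (\<exists>x\<in>{0..1}. h x \<noteq> 0)"
    then have hz: "\<And>x. x \<in> {0..1} \<Longrightarrow> h x = 0" by blast
    have "\<mu> / 2 > 0" using \<open>\<mu> > 0\<close> by simp
    from approx[OF this] obtain n where
      n: "\<And>x. x\<in>{0..1} \<Longrightarrow> \<bar>F (k n) x - h x\<bar> < \<mu> / 2" "1 / (real (k n) + 1) < \<mu> / 2" by blast
    have "\<bar>ip (F (k n)) (u (k n))\<bar> \<le> (\<mu> / 2) * (\<integral>x. \<bar>u (k n) x\<bar> \<partial>\<nu>)"
      using n(1) hz by (intro abs_ip_le FC uc) (force intro: less_imp_le)
    also have "\<dots> \<le> (\<mu> / 2) * 1" using \<open>\<mu> > 0\<close> by (intro mult_left_mono uabs) auto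
    finally show False using u(3)[of "k n"] n(2) unfolding F_def by linarith
  qed
  \<comment> \<open>The limit \<open>h\<close> is controlled on [0,1] only, whereas
    \<open>green h\<close> vanishes outside, as \<open>H10\<close> demands. The sum over one index
    fits the lemmas on linear combinations.\<close>
  define h0 where "h0 = (\<lambda>x. \<Sum>i\<in>{()}. (1 / \<mu>) * green h x)"
  have h0_eq: "h0 x = h x" if "x \<in> {0..1}" for x using hgreen[OF that] \<open>\<mu> > 0\<close> by (simp add: h0_def)
  have h0_ip: "ip h0 f = ip h f" for f
    by (intro Bochner_Integration.integral_cong) (auto simp: h0_eq)
  have h0_dom: "h0 \<in> form_dom \<nu>"
    unfolding h0_def by (intro form_dom_lincomb green_form_dom hc) auto
  have "h0 \<in> eigenspace \<nu> (1 / \<mu>)"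
    unfolding eigenspace_def
  proof (intro CollectI conjI ballI h0_dom)
    fix v assume "v \<in> form_dom \<nu>"
    then have v: "v \<in> H10" by (simp add: form_dom_def)
    have "dirichlet_form h0 v = (1 / \<mu>) * dirichlet_form (green h) v"
      unfolding h0_def by (subst dirichlet_form_lincomb) (auto intro: green_H10 hc v)
    also have "\<dots> = (1 / \<mu>) * ip h0 v" by (simp add: dirichlet_form_green[OF hc v] h0_ip)
    finally show "dirichlet_form h0 v = 1 / \<mu> * ip h0 v" .
  qed
  moreover have "h0 \<noteq> (\<lambda>x. 0)" using h_nz h0_eq by (metis)
  moreover have "1 / \<mu> \<le> x" using \<open>1 \<le> \<mu> * x\<close> \<open>\<mu> > 0\<close> by (simp add: field_simps)
  moreover have "\<forall>f\<in>B. ip h0 f = 0" using h_orth by (simp add: h0_ip)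
  ultimately show ?thesis by blast
qed

end

section \<open>Counting eigenvalues\<close>

lemma sum_fun_scale: "(\<Sum>f\<in>B. fun_scale (c f) (g f)) = (\<lambda>x. \<Sum>f\<in>B. c f * g f x)"
  by (induction B rule: infinite_finite_induct) (auto simp: fun_scale_def fun_eq_iff)

lemma independent_fun_lincomb:
  assumes "fun_space.independent B" "finite B" "(\<lambda>x. \<Sum>f\<in>B. c f * f x) = (\<lambda>x. 0)" "f \<in> B"
  shows "c f = 0"
proof -
  have "(\<Sum>f\<in>B. fun_scale (c f) f) = 0"
    using assms(3) unfolding sum_fun_scale[where g="\<lambda>f. f"] by (simp add: zero_fun_def)
  then show ?thesis using assms fun_space.dependent_finite[OF assms(2)] by blast
qed

context unit_interval_measure
begin

lemma ip_sum:
  assumes "finite I" "\<And>i. i \<in> I \<Longrightarrow> continuous_on {0..1} (f i)" "continuous_on {0..1} g"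
  shows "ip (\<lambda>x. \<Sum>i\<in>I. c i * f i x) g = (\<Sum>i\<in>I. c i * ip (f i) g)"
proof -
  have "ip (\<lambda>x. \<Sum>i\<in>I. c i * f i x) g = (\<integral>x. (\<Sum>i\<in>I. c i * (f i x * g x)) \<partial>\<nu>)"
    by (simp add: sum_distrib_right mult.assoc)
  also have "\<dots> = (\<Sum>i\<in>I. \<integral>x. c i * (f i x * g x) \<partial>\<nu>)"
    by (intro Bochner_Integration.integral_sum integrable_mult_right integrable_ip assms)
  finally show ?thesis by simp
qed

lemma ip_commute: "ip f g = ip g f"
  by (simp add: mult.commute)

lemma eigenspace_form_dom: "f \<in> eigenspace \<nu> ev \<Longrightarrow> f \<in> form_dom \<nu>"
  by (simp add: eigenspace_def)

lemma eigenspace_form: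
  "f \<in> eigenspace \<nu> ev \<Longrightarrow> g \<in> form_dom \<nu> \<Longrightarrow> dirichlet_form f g = ev * ip f g"
  by (simp add: eigenspace_def)

lemma form_dom_H10: "f \<in> form_dom \<nu> \<Longrightarrow> f \<in> H10"
  by (simp add: form_dom_def)

lemma eigenspace_lincomb:
  assumes "finite I" "\<And>i. i \<in> I \<Longrightarrow> f i \<in> eigenspace \<nu> ev"
  shows "(\<lambda>x. \<Sum>i\<in>I. c i * f i x) \<in> eigenspace \<nu> ev"
  unfolding eigenspace_def
proof (intro CollectI conjI ballI)
  have dom: "f i \<in> form_dom \<nu>" if "i \<in> I" for i using assms that eigenspace_form_dom by blast
  then show "(\<lambda>x. \<Sum>i\<in>I. c i * f i x) \<in> form_dom \<nu>" using assms by (intro form_dom_lincomb) auto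
  fix g assume g: "g \<in> form_dom \<nu>"
  have "dirichlet_form (\<lambda>x. \<Sum>i\<in>I. c i * f i x) g = (\<Sum>i\<in>I. c i * dirichlet_form (f i) g)"
    using assms dom g form_dom_H10 by (intro dirichlet_form_lincomb) auto
  also have "\<dots> = (\<Sum>i\<in>I. c i * (ev * ip (f i) g))"
    using assms g by (intro sum.cong) (auto simp: eigenspace_form)
  also have "\<dots> = ev * ip (\<lambda>x. \<Sum>i\<in>I. c i * f i x) g"
    by (subst ip_sum) (use assms dom g form_dom_continuous in \<open>auto simp: sum_distrib_left mult_ac\<close>)
  finally show "dirichlet_form (\<lambda>x. \<Sum>i\<in>I. c i * f i x) g = ev * ip (\<lambda>x. \<Sum>i\<in>I. c i * f i x) g" .
qed

text \<open>Norm zero only means zero \<nu>-almost everywhere; the eigenvalue equation turns it into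
  zero energy, and this forces f to vanish at every point.\<close>

lemma eigenfunction_zero_if_ip_zero:
  assumes f: "f \<in> eigenspace \<nu> ev" and "ip f f = 0"
  shows "f = (\<lambda>x. 0)"
  using assms eigenspace_form[OF f eigenspace_form_dom[OF f]]
  by (intro dirichlet_form_eq_0_imp form_dom_H10 eigenspace_form_dom[OF f]) simp

lemma eigenspaces_orthogonal:
  assumes "f \<in> eigenspace \<nu> ev" "g \<in> eigenspace \<nu> ev'" "ev \<noteq> ev'"
  shows "ip f g = 0"
proof -
  have "ev * ip f g = dirichlet_form f g"
    using assms eigenspace_form eigenspace_form_dom by simp
  also have "\<dots> = dirichlet_form g f" by (rule dirichlet_form_commute)
  also have "\<dots> = ev' * ip g f" using assms eigenspace_form eigenspace_form_dom by blast
  also have "ip g f = ip f g" by (rule ip_commute)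
  finally show ?thesis using assms(3) by simp
qed

text \<open>\<open>Q\<close> is a set of nodes such that functions vanishing on \<open>Q\<close> satisfy a Poincare inequality
  strong enough to exclude Rayleigh quotients up to \<open>x\<close>.\<close>

lemma card_independent_eigenfunctions_le:
  assumes Q: "finite Q" "\<And>f. f \<in> H10 \<Longrightarrow> (\<forall>y\<in>Q. f y = 0) \<Longrightarrow> ip f f \<le> t * dirichlet_form f f"
    and t: "0 \<le> t" "t * x < 1"
    and V: "finite V" "\<And>ev. ev \<in> V \<Longrightarrow> ev \<le> x"
    and B: "\<And>ev. ev \<in> V \<Longrightarrow> B ev \<subseteq> eigenspace \<nu> ev" "\<And>ev. ev \<in> V \<Longrightarrow> finite (B ev)"
      "\<And>ev. ev \<in> V \<Longrightarrow> fun_space.independent (B ev)"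
  shows "(\<Sum>ev\<in>V. card (B ev)) \<le> card Q"
proof (rule ccontr)
  let ?I = "Sigma V B"
  assume "\<not> ?thesis"
  then have "card Q < card ?I" using V B by simp
  moreover have fI: "finite ?I" using V B by auto
  \<comment> \<open>The nodes impose \<open>card Q\<close> linear conditions, fewer than there are
    coefficients, so some nontrivial combination of the basis functions vanishes on
    \<open>Q\<close>.\<close>
  ultimately obtain c where c: "\<exists>i\<in>?I. c i \<noteq> 0" "\<forall>y\<in>Q. (\<Sum>i\<in>?I. c i * snd i y) = 0"
    using exists_nontrivial_kernel_vector[OF Q(1), of ?I "\<lambda>i y. snd i y"] by blast
  define e where "e ev = (\<lambda>x. \<Sum>b\<in>B ev. c (ev, b) * b x)" for ev
  define f where "f = (\<lambda>x. \<Sum>ev\<in>V. 1 * e ev x)"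
  have e: "e ev \<in> eigenspace \<nu> ev" if "ev \<in> V" for ev
    unfolding e_def using that B by (intro eigenspace_lincomb) auto
  note e_dom = eigenspace_form_dom[OF e]
  have f_dom: "f \<in> form_dom \<nu>" unfolding f_def using e_dom V by (intro form_dom_lincomb) auto
  have "f y = (\<Sum>i\<in>?I. c i * snd i y)" for y
    unfolding f_def e_def using V B by (simp add: sum.Sigma case_prod_beta')
  then have f_node: "ip f f \<le> t * dirichlet_form f f"
    using c(2) by (intro Q(2) form_dom_H10 f_dom) auto
  have ip_ef: "ip (e ev) f = ip (e ev) (e ev)" if "ev \<in> V" for ev
  proof -
    have "ip (e ev) f = ip f (e ev)" by (rule ip_commute)
    also have "\<dots> = (\<Sum>ev'\<in>V. 1 * ip (e ev') (e ev))"
      unfolding f_def using e_dom that by (intro ip_sum V form_dom_continuous)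
    also have "\<dots> = (\<Sum>ev'\<in>V. if ev' = ev then ip (e ev) (e ev) else 0)"
    proof (intro sum.cong refl)
      fix ev' assume "ev' \<in> V"
      then show "1 * ip (e ev') (e ev) = (if ev' = ev then ip (e ev) (e ev) else 0)"
        using eigenspaces_orthogonal[OF e[of ev'] e[OF that]] by auto
    qed
    also have "\<dots> = ip (e ev) (e ev)" using V that by simp
    finally show ?thesis .
  qed
  have ip_ff: "ip f f = (\<Sum>ev\<in>V. ip (e ev) (e ev))"
  proof -
    have fx: "(\<Sum>ev\<in>V. 1 * e ev x) = f x" for x by (simp add: f_def)
    have "ip f f = (\<Sum>ev\<in>V. 1 * ip (e ev) f)"
      using ip_sum[OF V(1), of e f "\<lambda>_. 1"] e_dom f_dom form_dom_continuous unfolding fx by blast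
    then show ?thesis using ip_ef by simp
  qed
  have "dirichlet_form f f = (\<Sum>ev\<in>V. 1 * dirichlet_form (e ev) f)"
    using dirichlet_form_lincomb[OF V(1), of e f "\<lambda>_. 1", folded f_def] e_dom f_dom form_dom_H10 by blast
  also have "\<dots> = (\<Sum>ev\<in>V. ev * ip (e ev) (e ev))"
    using ip_ef by (intro sum.cong refl) (simp add: eigenspace_form[OF e f_dom])
  also have "\<dots> \<le> (\<Sum>ev\<in>V. x * ip (e ev) (e ev))"
    using V ip_self_nonneg by (intro sum_mono mult_right_mono) auto
  also have "\<dots> = x * ip f f" by (simp add: ip_ff sum_distrib_left)
  finally have "dirichlet_form f f \<le> x * ip f f" .
  \<comment> \<open>As \<open>t * x < 1\<close>, the two estimates are compatible only with
    \<open>ip f f = 0\<close>; orthogonality passes this on to the component in each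
    eigenspace.\<close>
  with f_node t have "ip f f \<le> t * (x * ip f f)" by (meson mult_left_mono order_trans)
  then have "(1 - t * x) * ip f f \<le> 0" by (simp add: algebra_simps)
  then have "ip f f = 0" using t ip_self_nonneg[of f] by (simp add: mult_le_0_iff)
  then have zero: "ip (e ev) (e ev) = 0" if "ev \<in> V" for ev
    using sum_nonneg_eq_0_iff[OF V(1), of "\<lambda>ev. ip (e ev) (e ev)"] ip_self_nonneg that ip_ff by auto
  have "c (ev, b) = 0" if "ev \<in> V" "b \<in> B ev" for ev b
    using eigenfunction_zero_if_ip_zero[OF e[OF that(1)] zero[OF that(1)]]
    unfolding e_def using that B by (intro independent_fun_lincomb[of "B ev" "\<lambda>b. c (ev, b)" b]) auto
  then show False using c(1) by auto
qed

text \<open>Guards against the value 0 that sums and dimensions take in infinite cases. Finiteness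
  comes from \<open>card_independent_eigenfunctions_le\<close>, applied to \<open>card Q + 1\<close>
  eigenvalues with one eigenfunction each, or to \<open>card Q + 1\<close> elements of one
  basis.\<close>

lemma eigenvalue_bases:
  assumes Q: "finite Q" "\<And>f. f \<in> H10 \<Longrightarrow> (\<forall>y\<in>Q. f y = 0) \<Longrightarrow> ip f f \<le> t * dirichlet_form f f"
    and t: "0 \<le> t" "t * x < 1"
  obtains B where "finite {ev. is_eigenvalue \<nu> ev \<and> ev \<le> x}"
    "\<And>ev. ev \<le> x \<Longrightarrow> B ev \<subseteq> eigenspace \<nu> ev \<and> finite (B ev) \<and> fun_space.independent (B ev) \<and>
       eigenspace \<nu> ev \<subseteq> fun_space.span (B ev) \<and> card (B ev) = multiplicity_of \<nu> ev"
proof -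
  let ?E = "{ev. is_eigenvalue \<nu> ev \<and> ev \<le> x}"
  have "finite ?E"
  proof (rule ccontr)
    assume "infinite ?E"
    then obtain V where V: "V \<subseteq> ?E" "finite V" "card V = Suc (card Q)"
      using infinite_arbitrarily_large by blast
    then have "\<forall>ev\<in>V. \<exists>f. f \<in> eigenspace \<nu> ev \<and> f \<noteq> 0"
      unfolding is_eigenvalue_def by (auto simp: zero_fun_def)
    then obtain f where f: "\<And>ev. ev \<in> V \<Longrightarrow> f ev \<in> eigenspace \<nu> ev \<and> f ev \<noteq> 0" by metis
    have "(\<Sum>ev\<in>V. card {f ev}) \<le> card Q"
      by (rule card_independent_eigenfunctions_le[OF Q t]) (use V f in auto)
    then show False using V by simp
  qed
  moreover have "\<exists>B. B \<subseteq> eigenspace \<nu> ev \<and> finite B \<and> fun_space.independent B \<and>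
       eigenspace \<nu> ev \<subseteq> fun_space.span B \<and> card B = multiplicity_of \<nu> ev" if "ev \<le> x" for ev
  proof -
    obtain B where B: "B \<subseteq> eigenspace \<nu> ev" "fun_space.independent B"
      "eigenspace \<nu> ev \<subseteq> fun_space.span B" "card B = fun_space.dim (eigenspace \<nu> ev)"
      using fun_space.basis_exists .
    have "finite B"
    proof (rule ccontr)
      assume "infinite B"
      then obtain C where C: "C \<subseteq> B" "finite C" "card C = Suc (card Q)"
        using infinite_arbitrarily_large by blast
      have "(\<Sum>ev\<in>{ev}. card C) \<le> card Q"
        by (rule card_independent_eigenfunctions_le[OF Q t])
           (use B C that fun_space.independent_mono in auto)
      then show False using C by simp
    qed
    with B show ?thesis unfolding multiplicity_of_def by blast
  qed
  ultimately show ?thesis using that by metis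
qed

lemma eigenvalue_count_le:
  assumes Q: "finite Q" "\<And>f. f \<in> H10 \<Longrightarrow> (\<forall>y\<in>Q. f y = 0) \<Longrightarrow> ip f f \<le> t * dirichlet_form f f"
    and t: "0 \<le> t" "t * x < 1"
  shows "eigenvalue_count \<nu> x \<le> card Q"
proof -
  obtain B where B: "finite {ev. is_eigenvalue \<nu> ev \<and> ev \<le> x}"
    "\<And>ev. ev \<le> x \<Longrightarrow> B ev \<subseteq> eigenspace \<nu> ev \<and> finite (B ev) \<and> fun_space.independent (B ev) \<and>
       eigenspace \<nu> ev \<subseteq> fun_space.span (B ev) \<and> card (B ev) = multiplicity_of \<nu> ev"
    using eigenvalue_bases[OF Q t] by blast
  have "eigenvalue_count \<nu> x = (\<Sum>ev | is_eigenvalue \<nu> ev \<and> ev \<le> x. card (B ev))"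
    unfolding eigenvalue_count_def using B(2) by (intro sum.cong) auto
  also have "\<dots> \<le> card Q"
    by (rule card_independent_eigenfunctions_le[OF Q t B(1)]) (use B(2) in auto)
  finally show ?thesis .
qed

text \<open>The Dirichlet condition excludes zero modes. This provides the nonzero eigenvalues
  required by \<open>exists_orthogonal_eigenfunction\<close>.\<close>

lemma eigenvalue_pos:
  assumes "f \<in> eigenspace \<nu> ev" "f \<noteq> (\<lambda>x. 0)"
  shows "ev > 0"
proof -
  have "ip f f \<noteq> 0" using eigenfunction_zero_if_ip_zero[OF assms(1)] assms(2) by blast
  then have "ip f f > 0" using ip_self_nonneg[of f] by linarith
  moreover have "dirichlet_form f f > 0"
    using dirichlet_form_eq_0_imp[of f] assms dirichlet_form_self_nonneg[of f] form_dom_H10 eigenspace_form_dom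
    by (metis less_eq_real_def)
  ultimately show ?thesis
    using eigenspace_form[OF assms(1) eigenspace_form_dom[OF assms(1)]] by (simp add: zero_less_mult_iff)
qed

text \<open>The lower half of the min-max principle. Were there fewer eigenfunctions than
  \<open>u i\<close>, some combination of the \<open>u i\<close> would be orthogonal to all of them,
  and \<open>exists_orthogonal_eigenfunction\<close> would produce one more. The nodes
  \<open>Q\<close> serve only to make the counted sets finite.\<close>

lemma card_le_eigenvalue_count:
  assumes Q: "finite Q" "\<And>f. f \<in> H10 \<Longrightarrow> (\<forall>y\<in>Q. f y = 0) \<Longrightarrow> ip f f \<le> t * dirichlet_form f f"
    and t: "0 \<le> t" "t * x < 1"
    and u: "finite I" "\<And>i. i \<in> I \<Longrightarrow> u i \<in> H10"
    and le: "\<And>c. dirichlet_form (\<lambda>y. \<Sum>i\<in>I. c i * u i y) (\<lambda>y. \<Sum>i\<in>I. c i * u i y)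
        \<le> x * ip (\<lambda>y. \<Sum>i\<in>I. c i * u i y) (\<lambda>y. \<Sum>i\<in>I. c i * u i y)"
    and pos: "\<And>c. \<exists>i\<in>I. c i \<noteq> 0 \<Longrightarrow> ip (\<lambda>y. \<Sum>i\<in>I. c i * u i y) (\<lambda>y. \<Sum>i\<in>I. c i * u i y) > 0"
  shows "card I \<le> eigenvalue_count \<nu> x"
proof (rule ccontr)
  assume less: "\<not> ?thesis"
  let ?E = "{ev. is_eigenvalue \<nu> ev \<and> ev \<le> x}"
  obtain B where B: "finite ?E"
    "\<And>ev. ev \<le> x \<Longrightarrow> B ev \<subseteq> eigenspace \<nu> ev \<and> finite (B ev) \<and> fun_space.independent (B ev) \<and>
       eigenspace \<nu> ev \<subseteq> fun_space.span (B ev) \<and> card (B ev) = multiplicity_of \<nu> ev"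
    using eigenvalue_bases[OF Q t] by blast
  define A where "A = (\<Union>ev\<in>?E. B ev)"
  have fA: "finite A" unfolding A_def using B by auto
  have "card A \<le> (\<Sum>ev\<in>?E. card (B ev))" unfolding A_def by (rule card_UN_le[OF B(1)])
  also have "\<dots> = eigenvalue_count \<nu> x"
    unfolding eigenvalue_count_def using B(2) by (intro sum.cong) auto
  finally have "card A < card I" using less by simp
  from exists_nontrivial_kernel_vector[OF fA u(1) this, of "\<lambda>i f. ip (u i) f"] obtain c where
    c: "\<exists>i\<in>I. c i \<noteq> 0" "\<forall>f\<in>A. (\<Sum>i\<in>I. c i * ip (u i) f) = 0" by blast
  define g where "g = (\<lambda>y. \<Sum>i\<in>I. c i * u i y)"
  have A_eig: "\<exists>ev. ev \<noteq> 0 \<and> f \<in> eigenspace \<nu> ev" if "f \<in> A" for f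
  proof -
    obtain ev where ev: "ev \<in> ?E" "f \<in> B ev" using \<open>f \<in> A\<close> by (auto simp: A_def)
    have "f \<noteq> 0"
    proof
      assume "f = 0"
      then have "fun_space.dependent (B ev)" using ev(2) fun_space.dependent_zero by blast
      then show False using ev(1) B(2)[of ev] by blast
    qed
    moreover have "f \<in> eigenspace \<nu> ev" using ev B(2)[of ev] by blast
    ultimately show ?thesis using eigenvalue_pos[of f ev] by (intro exI[of _ ev]) (auto simp: zero_fun_def)
  qed
  have Ac: "continuous_on {0..1} f" if "f \<in> A" for f
    using A_eig[OF that] eigenspace_form_dom form_dom_continuous by blast
  have g_orth: "ip g f = 0" if "f \<in> A" for f
    unfolding g_def using c(2) that by (subst ip_sum) (use u H10_continuous_on Ac in auto)
  have "\<exists>h ev. h \<in> eigenspace \<nu> ev \<and> h \<noteq> (\<lambda>x. 0) \<and> ev \<le> x \<and> (\<forall>f\<in>A. ip h f = 0)"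
  proof (rule exists_orthogonal_eigenfunction[OF A_eig _ g_orth])
    show "g \<in> H10" unfolding g_def by (rule H10_lincomb[OF u])
    show "ip g g > 0" unfolding g_def by (rule pos[OF c(1)])
    show "dirichlet_form g g \<le> x * ip g g" unfolding g_def by (rule le)
  qed
  then obtain h ev where h: "h \<in> eigenspace \<nu> ev" "h \<noteq> (\<lambda>x. 0)" "ev \<le> x" "\<forall>f\<in>A. ip h f = 0" by blast
  then have evE: "ev \<in> ?E" unfolding is_eigenvalue_def by auto
  \<comment> \<open>The new eigenfunction lies in the span of a basis to which it is orthogonal, so
    its norm is zero.\<close>
  have "h \<in> fun_space.span (B ev)" using B(2)[OF h(3)] h(1) by blast
  then obtain d where d: "h = (\<Sum>b\<in>B ev. fun_scale (d b) b)"
    using B(2)[OF h(3)] by (auto simp: fun_space.span_finite)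
  have BA: "B ev \<subseteq> A" using evE by (auto simp: A_def)
  have "ip h h = ip (\<lambda>x. \<Sum>b\<in>B ev. d b * b x) h"
    by (subst (1) d) (simp add: sum_fun_scale[where g="\<lambda>f. f"])
  also have "\<dots> = (\<Sum>b\<in>B ev. d b * ip b h)"
    using B(2)[OF h(3)] BA Ac eigenspace_form_dom[OF h(1)] form_dom_continuous by (intro ip_sum) auto
  also have "\<dots> = 0" using h(4) BA by (intro sum.neutral) (auto simp: mult.commute)
  finally show False using eigenfunction_zero_if_ip_zero[OF h(1)] h(2) by simp
qed

section \<open>Charged dyadic cells\<close>

definition heavy_cells :: "real \<Rightarrow> (nat \<times> nat) set" where
  "heavy_cells t = {(n, k). k < 2 ^ n \<and> measure \<nu> (dyadic_cell n k) / 2 ^ n \<ge> t}"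

lemma heavy_cells_level:
  assumes "t > 0" "1 / 2 ^ L < t" "(n, k) \<in> heavy_cells t"
  shows "n < L"
proof (rule ccontr)
  assume "\<not> n < L"
  then have "(2::real) ^ L \<le> 2 ^ n" by (intro power_increasing) auto
  have "t \<le> measure \<nu> (dyadic_cell n k) / 2 ^ n" using assms by (auto simp: heavy_cells_def)
  also have "\<dots> \<le> 1 / 2 ^ n" by (intro divide_right_mono) auto
  also have "\<dots> \<le> 1 / 2 ^ L" using \<open>2 ^ L \<le> 2 ^ n\<close> by (intro divide_left_mono) auto
  finally show False using assms(2) by simp
qed

lemma exists_inverse_power_less: "t > 0 \<Longrightarrow> \<exists>L. 1 / 2 ^ L < (t::real)"
  using real_arch_pow_inv[of t "1/2"] by (auto simp: power_one_over)

lemma finite_heavy_cells: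
  assumes "t > 0"
  shows "finite (heavy_cells t)"
proof -
  obtain L where L: "1 / 2 ^ L < t" using exists_inverse_power_less[OF assms] by blast
  have "heavy_cells t \<subseteq> Sigma {..<L} (\<lambda>n. {..<2 ^ n})"
    using heavy_cells_level[OF assms L] by (auto simp: heavy_cells_def)
  then show ?thesis by (rule finite_subset) auto
qed

lemma dyadic_cell_subset: "k < 2 ^ n \<Longrightarrow> dyadic_cell n k \<subseteq> {0..1}"
proof -
  assume "k < 2 ^ n"
  then have "real (k + 1) \<le> 2 ^ n"
    by (metis Suc_eq_plus1 Suc_leI of_nat_le_iff of_nat_numeral of_nat_power)
  then have "real (k + 1) / 2 ^ n \<le> 1" by simp
  moreover have "0 \<le> real k / 2 ^ n" by simp
  ultimately show ?thesis unfolding dyadic_cell_def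
    using order_trans[of _ "real (k + 1) / 2 ^ n" 1] order.strict_trans1[of 0 "real k / 2 ^ n"]
    by (intro subsetI) (metis atLeastAtMost_iff greaterThanAtMost_iff less_imp_le)
qed

lemma dyadic_cell_sets [measurable]: "k < 2 ^ n \<Longrightarrow> dyadic_cell n k \<in> sets \<nu>"
  using dyadic_cell_subset[of k n] by (auto simp: sets_nu_iff dyadic_cell_def)

lemma integrable_indicator_square:
  assumes "continuous_on {0..1} f" "A \<in> sets \<nu>"
  shows "integrable \<nu> (\<lambda>x. indicator A x * (f x)\<^sup>2 :: real)"
  using integrable_mult_indicator[OF assms(2), of "\<lambda>x. (f x)\<^sup>2"]
    continuous_on_integrable_nu[of "\<lambda>x. (f x)\<^sup>2"] assms(1)
  by (simp add: continuous_intros)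

text \<open>Induction on the distance \<open>d\<close> to a level without heavy cells. On a light
  cell the zero at the left endpoint and \<open>energy_on_Poincare\<close> give the factor J(C) < t.
  A heavy cell is halved, and its midpoint node is the left endpoint of the right half.\<close>

lemma dyadic_cell_Poincare:
  assumes t: "t > 0" "1 / 2 ^ L < t" and f: "f \<in> H10"
    and nodes: "\<And>n k. (n, k) \<in> heavy_cells t \<Longrightarrow> f (real (2 * k + 1) / 2 ^ (n + 1)) = 0"
    and nk: "n + d = L" "k < 2 ^ n" "f (real k / 2 ^ n) = 0"
  shows "(\<integral>x. indicator (dyadic_cell n k) x * (f x)\<^sup>2 \<partial>\<nu>) \<le> t * energy_on f (real k / 2 ^ n) (real (k + 1) / 2 ^ n)"
  using nk
proof (induction d arbitrary: n k)
  have light: "(\<integral>x. indicator (dyadic_cell n k) x * (f x)\<^sup>2 \<partial>\<nu>) \<le> t * energy_on f (real k / 2 ^ n) (real (k + 1) / 2 ^ n)"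
    if nh: "(n, k) \<notin> heavy_cells t" and k: "k < 2 ^ n" and f0: "f (real k / 2 ^ n) = 0" for n k
  proof -
    let ?a = "real k / 2 ^ n" and ?b = "real (k + 1) / 2 ^ n"
    let ?C = "dyadic_cell n k" and ?E = "energy_on f (real k / 2 ^ n) (real (k + 1) / 2 ^ n)"
    have "?b \<in> ?C" by (auto simp: dyadic_cell_def divide_strict_right_mono)
    then have b: "?b \<le> 1" using dyadic_cell_subset[OF k] by auto
    have ba: "?b - ?a = 1 / 2 ^ n" by (simp add: diff_divide_distrib[symmetric])
    have "(\<integral>x. indicator ?C x * (f x)\<^sup>2 \<partial>\<nu>) \<le> (\<integral>x. indicator ?C x * (?E / 2 ^ n) \<partial>\<nu>)"
    proof (rule integral_mono)
      show "integrable \<nu> (\<lambda>x. indicator ?C x * (f x)\<^sup>2)"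
        by (intro integrable_indicator_square H10_continuous_on f dyadic_cell_sets k)
      show "integrable \<nu> (\<lambda>x. indicator ?C x * (?E / 2 ^ n))"
        by (intro integrable_mult_left integrable_real_indicator dyadic_cell_sets k) (simp add: emeasure_eq_measure)
      fix x
      show "indicator ?C x * (f x)\<^sup>2 \<le> indicator ?C x * (?E / 2 ^ n)"
      proof (cases "x \<in> ?C")
        case True
        then have "(f x - f ?a)\<^sup>2 \<le> (?b - ?a) * ?E"
          using b by (intro energy_on_Poincare f) (auto simp: dyadic_cell_def)
        then show ?thesis using f0 True unfolding ba by simp
      qed simp
    qed
    also have "\<dots> = (measure \<nu> ?C / 2 ^ n) * ?E"
      using dyadic_cell_subset[OF k] by (simp add: Int_absorb2)
    also have "\<dots> \<le> t * ?E"
      using nh k energy_on_nonneg[of f ?a ?b] by (intro mult_right_mono) (auto simp: heavy_cells_def)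
    finally show ?thesis .
  qed
  {
    case 0
    then have "(n, k) \<notin> heavy_cells t" using heavy_cells_level[OF t] by fastforce
    then show ?case using light 0 by blast
  next
    case (Suc d)
    show ?case
    proof (cases "(n, k) \<in> heavy_cells t")
      case True
      let ?l = "real k / 2 ^ n" and ?m = "real (2 * k + 1) / 2 ^ (n + 1)" and ?r = "real (k + 1) / 2 ^ n"
      have l: "real (2 * k) / 2 ^ (n + 1) = ?l" and r: "real (2 * k + 1 + 1) / 2 ^ (n + 1) = ?r"
        by (simp_all add: field_simps)
      have lm: "?l \<le> ?m" "?m \<le> ?r" unfolding l[symmetric] r[symmetric] by (intro divide_right_mono; simp)+
      have k2: "2 * k < 2 ^ (n + 1)" "2 * k + 1 < 2 ^ (n + 1)" using Suc.prems(2) by auto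
      have fm: "f ?m = 0" by (rule nodes[OF True])
      have IH1: "(\<integral>x. indicator (dyadic_cell (n+1) (2*k)) x * (f x)\<^sup>2 \<partial>\<nu>) \<le> t * energy_on f ?l ?m"
        using Suc.IH[of "n+1" "2*k"] Suc.prems(1,3) k2 unfolding l by simp
      have IH2: "(\<integral>x. indicator (dyadic_cell (n+1) (2*k+1)) x * (f x)\<^sup>2 \<partial>\<nu>) \<le> t * energy_on f ?m ?r"
        using Suc.IH[of "n+1" "2*k+1", OF _ k2(2) fm] Suc.prems(1) unfolding r by simp
      have cells: "dyadic_cell (n+1) (2*k) = {?l<..?m}" "dyadic_cell (n+1) (2*k+1) = {?m<..?r}"
        "dyadic_cell n k = {?l<..?r}"
        unfolding dyadic_cell_def l r by simp_all
      have "(\<integral>x. indicator (dyadic_cell n k) x * (f x)\<^sup>2 \<partial>\<nu>)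
         = (\<integral>x. indicator (dyadic_cell (n+1) (2*k)) x * (f x)\<^sup>2 + indicator (dyadic_cell (n+1) (2*k+1)) x * (f x)\<^sup>2 \<partial>\<nu>)"
        unfolding cells by (intro Bochner_Integration.integral_cong) (use lm in \<open>auto simp: indicator_def\<close>)
      also have "\<dots> = (\<integral>x. indicator (dyadic_cell (n+1) (2*k)) x * (f x)\<^sup>2 \<partial>\<nu>) + (\<integral>x. indicator (dyadic_cell (n+1) (2*k+1)) x * (f x)\<^sup>2 \<partial>\<nu>)"
        by (intro Bochner_Integration.integral_add integrable_indicator_square H10_continuous_on f dyadic_cell_sets k2)
      also have "\<dots> \<le> t * (energy_on f ?l ?m + energy_on f ?m ?r)"
        using IH1 IH2 by (simp add: distrib_left)
      also have "energy_on f ?l ?m + energy_on f ?m ?r = energy_on f ?l ?r"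
        by (rule energy_on_add[OF f lm])
      finally show ?thesis .
    qed (use light Suc in blast)
  }
qed

text \<open>The nodes are the midpoints of the heavy cells. The second claim exports them, since the
  lower bound for the count needs a finite node set too.\<close>

lemma eigenvalue_count_le_card_heavy_cells:
  assumes t: "t > 0" "t * x < 1"
  shows "eigenvalue_count \<nu> x \<le> card (heavy_cells t)"
    and "\<exists>Q. finite Q \<and> (\<forall>f\<in>H10. (\<forall>y\<in>Q. f y = 0) \<longrightarrow> ip f f \<le> t * dirichlet_form f f)"
proof -
  define Q where "Q = (\<lambda>(n, k). real (2 * k + 1) / 2 ^ (n + 1)) ` heavy_cells t"
  obtain L where L: "1 / 2 ^ L < t" using exists_inverse_power_less[OF t(1)] by blast
  have fQ: "finite Q" unfolding Q_def by (intro finite_imageI finite_heavy_cells t)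
  have *: "ip f f \<le> t * dirichlet_form f f" if f: "f \<in> H10" "\<forall>y\<in>Q. f y = 0" for f
  proof -
    have "(\<integral>x. indicator (dyadic_cell 0 0) x * (f x)\<^sup>2 \<partial>\<nu>) \<le> t * energy_on f (real 0 / 2 ^ 0) (real (0 + 1) / 2 ^ 0)"
    proof (rule dyadic_cell_Poincare[OF t(1) L f(1), of 0 L 0])
      show "f (real (2 * k + 1) / 2 ^ (n + 1)) = 0" if "(n, k) \<in> heavy_cells t" for n k
        using f(2) that unfolding Q_def by force
    qed (use f in \<open>auto simp: H10_def\<close>)
    \<comment> \<open>The half-open unit cell misses 0; even an atom there is harmless because
      \<open>f 0 = 0\<close>.\<close>
    moreover have "(\<integral>x. indicator (dyadic_cell 0 0) x * (f x)\<^sup>2 \<partial>\<nu>) = ip f f"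
    proof (rule Bochner_Integration.integral_cong[OF refl])
      fix x assume "x \<in> space \<nu>"
      then show "indicator (dyadic_cell 0 0) x * (f x)\<^sup>2 = f x * f x"
        using f(1) by (cases "x = 0") (auto simp: dyadic_cell_def power2_eq_square H10_def)
    qed
    ultimately show ?thesis by (simp add: energy_on_unit[OF f(1)])
  qed
  have "eigenvalue_count \<nu> x \<le> card Q"
    by (rule eigenvalue_count_le[OF fQ *]) (use t in auto)
  also have "\<dots> \<le> card (heavy_cells t)"
    unfolding Q_def by (rule card_image_le[OF finite_heavy_cells[OF t(1)]])
  finally show "eigenvalue_count \<nu> x \<le> card (heavy_cells t)" .
  show "\<exists>Q. finite Q \<and> (\<forall>f\<in>H10. (\<forall>y\<in>Q. f y = 0) \<longrightarrow> ip f f \<le> t * dirichlet_form f f)"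
    using fQ * by blast
qed

section \<open>Tent functions over separated cells\<close>

definition closed_cell :: "nat \<Rightarrow> nat \<Rightarrow> real set" where
  "closed_cell n k = {real k / 2 ^ n..real (k + 1) / 2 ^ n}"

lemma mem_closed_cell_iff: "x \<in> closed_cell n k \<longleftrightarrow> real k \<le> 2 ^ n * x \<and> 2 ^ n * x \<le> real k + 1"
  by (auto simp: closed_cell_def field_simps)

text \<open>In the variable y this is the trapezoid that is 1 on [k, k + 1], vanishes outside (k -
  1, k + 2) and is affine between. As a combination of minima it inherits its gradient from
  \<open>is_gradient_min\<close>.\<close>

definition tent :: "nat \<Rightarrow> nat \<Rightarrow> real \<Rightarrow> real" where
  "tent n k z = (let y = 2 ^ n * z in
     min y (real k) - min y (real k - 1) - min y (real k + 2) + min y (real k + 1))"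

definition tent_slope :: "nat \<Rightarrow> nat \<Rightarrow> real \<Rightarrow> real" where
  "tent_slope n k z = 2 ^ n * (indicator {real k - 1<..real k} (2 ^ n * z) - indicator {real k + 1<..real k + 2} (2 ^ n * z))"

lemma is_gradient_cong:
  assumes "is_gradient f g" "\<And>x. x \<in> {0..1} \<Longrightarrow> f x = f' x" "\<And>x. x \<in> {0..1} \<Longrightarrow> g x = g' x"
  shows "is_gradient f' g'"
proof -
  have "g' \<in> borel_measurable LB \<longleftrightarrow> g \<in> borel_measurable LB"
    using assms(3) by (intro measurable_cong) auto
  moreover have "integrable LB (\<lambda>x. (g' x)\<^sup>2) \<longleftrightarrow> integrable LB (\<lambda>x. (g x)\<^sup>2)"
    using assms(3) by (intro Bochner_Integration.integrable_cong) auto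
  moreover have "(\<integral>t. indicator {0..x} t * g' t \<partial>LB) = (\<integral>t. indicator {0..x} t * g t \<partial>LB)" for x :: real
    using assms(3) by (intro Bochner_Integration.integral_cong) auto
  ultimately show ?thesis using assms unfolding is_gradient_iff by simp
qed

lemma is_gradient_tent:
  assumes k: "1 \<le> k" "k + 2 \<le> 2 ^ n"
  shows "is_gradient (tent n k) (tent_slope n k)"
proof -
  \<comment> \<open>The four break points of the trapezoid; the minima at the two inner ones enter
    with a positive sign, those at the outer ones with a negative sign.\<close>
  define P where "P i = (real k - 1 + real i) / 2 ^ n" for i :: nat
  define c :: "nat \<Rightarrow> real" where "c i = (if i \<in> {1, 2} then 2 ^ n else - (2 ^ n))" for i
  have k': "real k + 2 \<le> 2 ^ n" using k(2)
    by (metis of_nat_add of_nat_le_iff of_nat_numeral of_nat_power)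
  have P: "P i \<in> {0..1}" if "i < 4" for i
    using k k' that unfolding P_def by (auto simp: field_simps)
  have "is_gradient (\<lambda>x. \<Sum>i<4. c i * min x (P i)) (\<lambda>x. \<Sum>i<4. c i * indicator {0..P i} x)"
    using P by (intro is_gradient_lincomb is_gradient_min) auto
  moreover have "(\<Sum>i<4. c i * min x (P i)) = tent n k x" for x
  proof -
    have "2 ^ n * min x (P i) = min (2 ^ n * x) (real k - 1 + real i)" for i
      unfolding P_def by (auto simp: min_def field_simps)
    then have *: "c i * min x (P i) = (if i \<in> {1, 2} then 1 else -1) * min (2 ^ n * x) (real k - 1 + real i)" for i
      unfolding c_def by simp
    show ?thesis unfolding * by (simp add: eval_nat_numeral tent_def Let_def algebra_simps)
  qed
  moreover have "(\<Sum>i<4. c i * indicator {0..P i} x) = tent_slope n k x" if "x \<in> {0..1}" for x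
  proof -
    have "indicator {0..P i} x = (if 2 ^ n * x \<le> real k - 1 + real i then 1 else 0 :: real)" for i
      using that unfolding P_def by (auto simp: indicator_def field_simps)
    then show ?thesis using k(1)
      by (auto simp: eval_nat_numeral tent_slope_def c_def indicator_def)
  qed
  ultimately show ?thesis by (rule is_gradient_cong) auto
qed

text \<open>The bounds on k keep the support in [0,1]; the first and the last cell of a level carry
  no tent.\<close>

lemma tent_H10:
  assumes k: "1 \<le> k" "k + 2 \<le> 2 ^ n"
  shows "tent n k \<in> H10"
proof -
  have k': "real k + 2 \<le> 2 ^ n" using k(2)
    by (metis of_nat_add of_nat_le_iff of_nat_numeral of_nat_power)
  have "tent n k x = 0" if "x \<le> 0 \<or> x \<ge> 1" for x
    using that
  proof
    assume "x \<le> 0"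
    then have "2 ^ n * x \<le> 0" by (simp add: mult_nonneg_nonpos)
    then show ?thesis using k(1) by (simp add: tent_def Let_def min_def)
  next
    assume "x \<ge> 1"
    then have "2 ^ n * x \<ge> 2 ^ n * 1" by (intro mult_left_mono) auto
    then have "2 ^ n * x \<ge> real k + 2" using k' by linarith
    then show ?thesis by (simp add: tent_def Let_def min_def)
  qed
  then show ?thesis unfolding H10_def using is_gradient_tent[OF k] by auto
qed

text \<open>There are two flanks, each of length 2^(-n) and with squared slope 4^n.\<close>

lemma tent_form_self:
  assumes k: "1 \<le> k" "k + 2 \<le> 2 ^ n"
  shows "dirichlet_form (tent n k) (tent n k) = 2 * 2 ^ n"
proof -
  interpret L: finite_measure LB by (rule finite_LB)
  have k': "real k + 2 \<le> 2 ^ n" using k(2)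
    by (metis of_nat_add of_nat_le_iff of_nat_numeral of_nat_power)
  let ?A = "{(real k - 1) / 2 ^ n<..real k / 2 ^ n}" and ?B = "{(real k + 1) / 2 ^ n<..(real k + 2) / 2 ^ n}"
  have sub: "?A \<subseteq> {0..1}" "?B \<subseteq> {0..1}"
  proof -
    have "{m / 2 ^ n<..m' / 2 ^ n} \<subseteq> {0..1}" if "0 \<le> m" "m' \<le> 2 ^ n" for m m' :: real
    proof -
      have "0 \<le> m / 2 ^ n" "m' / 2 ^ n \<le> 1" using that by auto
      then show ?thesis using order.strict_trans1[of 0 "m / 2 ^ n"] order_trans[of _ "m' / 2 ^ n" 1]
        by (intro subsetI) (metis atLeastAtMost_iff greaterThanAtMost_iff less_imp_le)
    qed
    then show "?A \<subseteq> {0..1}" "?B \<subseteq> {0..1}" using k k' by simp_all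
  qed
  have "dirichlet_form (tent n k) (tent n k) = (\<integral>t. tent_slope n k t * tent_slope n k t \<partial>LB)"
    by (rule dirichlet_form_eq[OF is_gradient_tent[OF k] is_gradient_tent[OF k]])
  also have "\<dots> = (\<integral>t. 4 ^ n * (indicator ?A t + indicator ?B t) \<partial>LB)"
    by (intro Bochner_Integration.integral_cong)
       (auto simp: tent_slope_def indicator_def field_simps power_mult_distrib[symmetric])
  also have "\<dots> = 4 ^ n * ((\<integral>t. indicator ?A t \<partial>LB) + (\<integral>t. indicator ?B t \<partial>LB))"
    using integrable_LB_indicator_mult[of "\<lambda>_. 1" ?A] integrable_LB_indicator_mult[of "\<lambda>_. 1" ?B] by simp
  also have "\<dots> = 4 ^ n * (1 / 2 ^ n + 1 / 2 ^ n)"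
    using sub by (subst (1 2) integral_indicator_LB) (auto simp: divide_right_mono diff_divide_distrib[symmetric])
  also have "(4::real) ^ n = 2 ^ n * 2 ^ n" by (simp flip: power_mult_distrib)
  also have "2 ^ n * 2 ^ n * (1 / 2 ^ n + 1 / 2 ^ n) = 2 * (2 ^ n :: real)" by simp
  finally show ?thesis .
qed

text \<open>A tent over cell k reaches from k - 1 to k + 2, so index distance 3 separates the
  flanks.\<close>

lemma tent_form_disjoint:
  assumes k: "1 \<le> k" "k + 2 \<le> 2 ^ n" and j: "1 \<le> j" "j + 2 \<le> 2 ^ n" and kj: "k + 3 \<le> j \<or> j + 3 \<le> k"
  shows "dirichlet_form (tent n k) (tent n j) = 0"
proof -
  have kj': "real k + 3 \<le> real j \<or> real j + 3 \<le> real k" using kj by linarith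
  have "dirichlet_form (tent n k) (tent n j) = (\<integral>t. tent_slope n k t * tent_slope n j t \<partial>LB)"
    by (rule dirichlet_form_eq[OF is_gradient_tent[OF k] is_gradient_tent[OF j]])
  also have "\<dots> = (\<integral>t. 0 \<partial>LB)"
    by (intro Bochner_Integration.integral_cong)
       (use kj' in \<open>auto simp: tent_slope_def indicator_def\<close>)
  finally show ?thesis by simp
qed

text \<open>For a combination with coefficients \<open>c k\<close> the energy equals 2 * 2^n times
  the sum of their squares, and the plateaus alone make its norm square at least t * 2^n times that
  sum. The quotient is 2 / t.\<close>

lemma card_le_eigenvalue_count_tents:
  assumes t: "t > 0" and K: "finite K" "\<And>k. k \<in> K \<Longrightarrow> 1 \<le> k \<and> k + 2 \<le> 2 ^ n"
    and mass: "\<And>k. k \<in> K \<Longrightarrow> t \<le> measure \<nu> (closed_cell n k) / 2 ^ n"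
    and sep: "\<And>k j. k \<in> K \<Longrightarrow> j \<in> K \<Longrightarrow> k < j \<Longrightarrow> k + 3 \<le> j"
  shows "card K \<le> eigenvalue_count \<nu> (2 / t)"
proof -
  \<comment> \<open>The nodes are used for finiteness only, so any positive threshold below t / 2
    serves.\<close>
  have "t / 3 > 0" "t / 3 * (2 / t) < 1" using t by auto
  from eigenvalue_count_le_card_heavy_cells(2)[OF this] obtain Q where
    Q: "finite Q" "\<And>f. f \<in> H10 \<Longrightarrow> (\<forall>y\<in>Q. f y = 0) \<Longrightarrow> ip f f \<le> t / 3 * dirichlet_form f f" by blast
  have sep': "k + 3 \<le> j \<or> j + 3 \<le> k" if "k \<in> K" "j \<in> K" "k \<noteq> j" for k j
    using sep[of k j] sep[of j k] that by linarith
  have H: "tent n k \<in> H10" if "k \<in> K" for k using K(2)[OF that] tent_H10 by blast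
  define u where "u c = (\<lambda>y. \<Sum>k\<in>K. c k * tent n k y)" for c
  have uH: "u c \<in> H10" for c unfolding u_def by (rule H10_lincomb[OF K(1) H])
  have form: "dirichlet_form (u c) (u c) = 2 * 2 ^ n * (\<Sum>k\<in>K. (c k)\<^sup>2)" for c
  proof -
    have ku: "dirichlet_form (tent n k) (u c) = c k * (2 * 2 ^ n)" if k: "k \<in> K" for k
    proof -
      have "dirichlet_form (tent n k) (u c) = dirichlet_form (u c) (tent n k)" by (rule dirichlet_form_commute)
      also have "\<dots> = (\<Sum>j\<in>K. c j * dirichlet_form (tent n j) (tent n k))"
        unfolding u_def by (rule dirichlet_form_lincomb[OF K(1) H H[OF k]])
      also have "\<dots> = (\<Sum>j\<in>K. if j = k then c k * (2 * 2 ^ n) else 0)"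
        using K(2) k sep' tent_form_self tent_form_disjoint by (intro sum.cong) auto
      finally show ?thesis using k K by simp
    qed
    have "dirichlet_form (u c) (u c) = (\<Sum>k\<in>K. c k * dirichlet_form (tent n k) (u c))"
      using dirichlet_form_lincomb[OF K(1) H uH[of c], where c = c] unfolding u_def .
    also have "\<dots> = 2 * 2 ^ n * (\<Sum>k\<in>K. (c k)\<^sup>2)"
      by (simp add: ku power2_eq_square sum_distrib_left mult_ac)
    finally show ?thesis .
  qed
  have csets: "closed_cell n k \<in> sets \<nu>" if "k \<in> K" for k
  proof -
    have "real k + 2 \<le> 2 ^ n" using K(2)[OF that]
      by (metis of_nat_add of_nat_le_iff of_nat_numeral of_nat_power)
    then have "closed_cell n k \<subseteq> {0..1}"
      unfolding closed_cell_def by (auto simp: field_simps intro: order_trans[OF _ divide_right_mono[of "real k + 1" "2^n"]])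
    then show ?thesis by (simp add: sets_nu_iff closed_cell_def del: atLeastatMost_subset_iff)
  qed
  have one: "tent n k x = 1" if "x \<in> closed_cell n k" for k x
    using that unfolding mem_closed_cell_iff by (simp add: tent_def Let_def min_def)
  have zero: "tent n j x = 0" if "x \<in> closed_cell n k" "k + 3 \<le> j \<or> j + 3 \<le> k" for k j x
  proof -
    have "real k + 3 \<le> real j \<or> real j + 3 \<le> real k" using that(2) by linarith
    then show ?thesis using that(1) unfolding mem_closed_cell_iff by (auto simp: tent_def Let_def min_def)
  qed
  have ip_ge: "t * 2 ^ n * (\<Sum>k\<in>K. (c k)\<^sup>2) \<le> ip (u c) (u c)" for c
  proof -
    have int: "integrable \<nu> (\<lambda>x. (c k)\<^sup>2 * indicator (closed_cell n k) x)" if "k \<in> K" for k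
      by (intro integrable_mult_right integrable_real_indicator csets that) (simp add: emeasure_eq_measure)
    have "t * 2 ^ n * (\<Sum>k\<in>K. (c k)\<^sup>2) \<le> (\<Sum>k\<in>K. (c k)\<^sup>2 * measure \<nu> (closed_cell n k))"
      unfolding sum_distrib_left
    proof (rule sum_mono)
      fix k assume "k \<in> K"
      then have "t * 2 ^ n \<le> measure \<nu> (closed_cell n k)" using mass by (simp add: field_simps)
      then have "(c k)\<^sup>2 * (t * 2 ^ n) \<le> (c k)\<^sup>2 * measure \<nu> (closed_cell n k)" by (intro mult_left_mono) auto
      then show "t * 2 ^ n * (c k)\<^sup>2 \<le> (c k)\<^sup>2 * measure \<nu> (closed_cell n k)" by (simp add: mult_ac)
    qed
    also have "\<dots> = (\<Sum>k\<in>K. \<integral>x. (c k)\<^sup>2 * indicator (closed_cell n k) x \<partial>\<nu>)"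
    proof (intro sum.cong refl)
      fix k assume "k \<in> K"
      then have "closed_cell n k \<inter> space \<nu> = closed_cell n k" using sets.sets_into_space[OF csets] by blast
      then show "(c k)\<^sup>2 * measure \<nu> (closed_cell n k) = (\<integral>x. (c k)\<^sup>2 * indicator (closed_cell n k) x \<partial>\<nu>)" by simp
    qed
    also have "\<dots> = (\<integral>x. (\<Sum>k\<in>K. (c k)\<^sup>2 * indicator (closed_cell n k) x) \<partial>\<nu>)"
      by (intro Bochner_Integration.integral_sum[symmetric] int)
    also have "\<dots> \<le> ip (u c) (u c)"
    proof (rule integral_mono)
      show "integrable \<nu> (\<lambda>x. \<Sum>k\<in>K. (c k)\<^sup>2 * indicator (closed_cell n k) x)"
        using int by (intro Bochner_Integration.integrable_sum)
      show "integrable \<nu> (\<lambda>x. u c x * u c x)" by (intro integrable_ip H10_continuous_on uH)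
      fix x
      show "(\<Sum>k\<in>K. (c k)\<^sup>2 * indicator (closed_cell n k) x) \<le> u c x * u c x"
      proof (cases "\<exists>k\<in>K. x \<in> closed_cell n k")
        case True
        then obtain k where k: "k \<in> K" "x \<in> closed_cell n k" by blast
        have other: "tent n j x = 0" "x \<notin> closed_cell n j" if "j \<in> K" "j \<noteq> k" for j
          using zero[OF k(2)] one[of x j] sep'[OF k(1) that(1)] that by auto
        have "u c x = (\<Sum>j\<in>K. if j = k then c k else 0)"
          unfolding u_def using other one[OF k(2)] by (intro sum.cong) auto
        moreover have "(\<Sum>j\<in>K. (c j)\<^sup>2 * indicator (closed_cell n j) x) = (\<Sum>j\<in>K. if j = k then (c k)\<^sup>2 else 0)"
          using other k by (intro sum.cong) auto
        ultimately show ?thesis using k(1) K(1) by (simp add: power2_eq_square)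
      next
        case False
        then have "(\<Sum>k\<in>K. (c k)\<^sup>2 * indicator (closed_cell n k) x) = 0" by (intro sum.neutral) auto
        then show ?thesis by simp
      qed
    qed
    finally show ?thesis .
  qed
  show ?thesis
  proof (rule card_le_eigenvalue_count[OF Q, where u = "tent n"])
    show "dirichlet_form (\<lambda>y. \<Sum>i\<in>K. c i * tent n i y) (\<lambda>y. \<Sum>i\<in>K. c i * tent n i y)
       \<le> 2 / t * ip (\<lambda>y. \<Sum>i\<in>K. c i * tent n i y) (\<lambda>y. \<Sum>i\<in>K. c i * tent n i y)" for c
      using ip_ge[of c] form[of c] t unfolding u_def by (simp add: field_simps)
    show "0 < ip (\<lambda>y. \<Sum>i\<in>K. c i * tent n i y) (\<lambda>y. \<Sum>i\<in>K. c i * tent n i y)" if nz: "\<exists>i\<in>K. c i \<noteq> 0" for c :: "nat \<Rightarrow> real"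
    proof -
      obtain i where "i \<in> K" "c i \<noteq> 0" using nz by blast
      then have "(\<Sum>k\<in>K. (c k)\<^sup>2) > 0"
        using K(1) by (intro sum_pos2[of K i]) auto
      then have "0 < t * 2 ^ n * (\<Sum>k\<in>K. (c k)\<^sup>2)" using t by simp
      then show ?thesis using ip_ge[of c] unfolding u_def by linarith
    qed
  qed (use t K(1) H in auto)
qed

end

section \<open>Iterated function systems with subexponential distortion\<close>

text \<open>What is kept of C^1 conformality: two-sided Lipschitz bounds, and near similarity on
  sets of small diameter. Derivatives do not appear in the argument on covers.\<close>

locale self_conformal = unit_interval_measure +
  fixes l :: nat and S :: "nat \<Rightarrow> real \<Rightarrow> real" and p :: "nat \<Rightarrow> real" and lam a0 :: real
  assumes maps: "i < l \<Longrightarrow> x \<in> {0..1} \<Longrightarrow> S i x \<in> {0..1}"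
    and lam: "0 < lam" "lam < 1"
    and contraction: "i < l \<Longrightarrow> x \<in> {0..1} \<Longrightarrow> y \<in> {0..1} \<Longrightarrow> \<bar>S i x - S i y\<bar> \<le> lam * \<bar>x - y\<bar>"
    and a0: "0 < a0"
    and expansion: "i < l \<Longrightarrow> x \<in> {0..1} \<Longrightarrow> y \<in> {0..1} \<Longrightarrow> a0 * \<bar>x - y\<bar> \<le> \<bar>S i x - S i y\<bar>"
    and local_distortion: "\<epsilon> > 0 \<Longrightarrow> \<exists>\<eta>>0. \<forall>i<l. \<forall>X\<subseteq>{0..1}. (\<forall>u\<in>X. \<forall>v\<in>X. \<bar>u - v\<bar> \<le> \<eta>) \<longrightarrow>
      (\<exists>m>0. \<forall>u\<in>X. \<forall>v\<in>X. m * \<bar>u - v\<bar> \<le> \<bar>S i u - S i v\<bar> \<and> \<bar>S i u - S i v\<bar> \<le> (1 + \<epsilon>) * m * \<bar>u - v\<bar>)"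
    and p_pos: "i < l \<Longrightarrow> p i > 0"
    and p_sum: "(\<Sum>i<l. p i) = 1"
    and self_similar: "B \<in> sets \<nu> \<Longrightarrow> measure \<nu> B = (\<Sum>i<l. p i * measure \<nu> (S i -` B \<inter> {0..1}))"
begin

text \<open>A word \<open>w\<close> acts by the composition \<open>foldr S w\<close> of its letters.\<close>

abbreviation words :: "nat list set" where "words \<equiv> lists {..<l}"

definition weight :: "nat list \<Rightarrow> real" where "weight w = prod_list (map p w)"

lemma weight_pos: "w \<in> words \<Longrightarrow> weight w > 0"
  by (induction w) (auto simp: weight_def p_pos)

lemma word_maps: "w \<in> words \<Longrightarrow> x \<in> {0..1} \<Longrightarrow> foldr S w x \<in> {0..1}"
proof (induction w)
  case (Cons i w)
  then show ?case using maps[of i "foldr S w x"] by simp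
qed simp

lemma word_contraction:
  "w \<in> words \<Longrightarrow> x \<in> {0..1} \<Longrightarrow> y \<in> {0..1} \<Longrightarrow> \<bar>foldr S w x - foldr S w y\<bar> \<le> lam ^ length w * \<bar>x - y\<bar>"
proof (induction w)
  case (Cons i w)
  then have w: "w \<in> words" "i < l" by auto
  have "\<bar>foldr S (i # w) x - foldr S (i # w) y\<bar> \<le> lam * \<bar>foldr S w x - foldr S w y\<bar>"
    using contraction[OF w(2) word_maps[OF w(1) Cons.prems(2)] word_maps[OF w(1) Cons.prems(3)]] by simp
  also have "\<dots> \<le> lam * (lam ^ length w * \<bar>x - y\<bar>)"
    using Cons.IH[OF w(1) Cons.prems(2,3)] lam by (intro mult_left_mono) auto
  finally show ?case by (simp add: mult_ac)
qed simp

lemma word_continuous: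
  assumes w: "w \<in> words"
  shows "continuous_on {0..1} (foldr S w)"
  unfolding continuous_on_iff
proof (intro ballI allI impI)
  fix x e :: real assume x: "x \<in> {0..1}" and e: "e > 0"
  have le: "\<bar>foldr S w y - foldr S w x\<bar> \<le> \<bar>y - x\<bar>" if "y \<in> {0..1}" for y
  proof -
    have "lam ^ length w * \<bar>y - x\<bar> \<le> 1 * \<bar>y - x\<bar>"
      using lam by (intro mult_right_mono power_le_one) auto
    then show ?thesis using word_contraction[OF w that x] by simp
  qed
  show "\<exists>d>0. \<forall>y\<in>{0..1}. dist y x < d \<longrightarrow> dist (foldr S w y) (foldr S w x) < e"
  proof (intro exI[of _ e] conjI ballI impI e)
    fix y assume "y \<in> {0..1}" "dist y x < e"
    then show "dist (foldr S w y) (foldr S w x) < e" using le[of y] by (simp add: dist_real_def)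
  qed
qed

lemma word_preimage_sets:
  assumes w: "w \<in> words" and B: "B \<in> sets \<nu>"
  shows "foldr S w -` B \<inter> {0..1} \<in> sets \<nu>"
  using measurable_sets[OF continuous_on_measurable_nu[OF word_continuous[OF w]], of B] B
  by (simp add: sets_nu_iff)

text \<open>A letter is put in front of w, hence acts on the image of w. Once w has
  \<open>k0\<close> letters this image has diameter below \<eta> and the new letter costs a factor 1
  + \<epsilon>; the \<open>k0\<close> innermost letters cost at most the crude ratio
  \<open>lam / a0\<close> each, which gives the constant \<open>K ^ k0\<close>.\<close>

lemma word_distortion:
  assumes e: "\<epsilon> > 0"
  obtains A where "A \<ge> 1" "\<And>w. w \<in> words \<Longrightarrow> \<exists>r>0. \<forall>x\<in>{0..1}. \<forall>y\<in>{0..1}.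
     r * \<bar>x - y\<bar> \<le> \<bar>foldr S w x - foldr S w y\<bar> \<and>
     \<bar>foldr S w x - foldr S w y\<bar> \<le> A * (1 + \<epsilon>) ^ length w * r * \<bar>x - y\<bar>"
proof -
  obtain \<eta> where \<eta>: "\<eta> > 0" "\<And>i X. i < l \<Longrightarrow> X \<subseteq> {0..1} \<Longrightarrow> (\<forall>u\<in>X. \<forall>v\<in>X. \<bar>u - v\<bar> \<le> \<eta>) \<Longrightarrow>
      \<exists>m>0. \<forall>u\<in>X. \<forall>v\<in>X. m * \<bar>u - v\<bar> \<le> \<bar>S i u - S i v\<bar> \<and> \<bar>S i u - S i v\<bar> \<le> (1 + \<epsilon>) * m * \<bar>u - v\<bar>"
    using local_distortion[OF e] by metis
  obtain k0 where k0: "lam ^ k0 < \<eta>" using real_arch_pow_inv[OF \<eta>(1) lam(2)] by blast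
  define K where "K = max 1 (lam / a0)"
  have K: "K \<ge> 1" "lam \<le> K * a0" using a0 by (auto simp: K_def field_simps max_def)
  have main: "\<exists>r>0. \<forall>x\<in>{0..1}. \<forall>y\<in>{0..1}.
     r * \<bar>x - y\<bar> \<le> \<bar>foldr S w x - foldr S w y\<bar> \<and>
     \<bar>foldr S w x - foldr S w y\<bar> \<le> K ^ min k0 (length w) * (1 + \<epsilon>) ^ length w * r * \<bar>x - y\<bar>"
    if "w \<in> words" for w
    using that
  proof (induction w rule: list.induct)
    case Nil
    show ?case by (intro exI[of _ 1]) simp
  next
    case (Cons i w)
    then have w: "w \<in> words" "i < l" by auto
    obtain r where r: "r > 0" "\<And>x y. x \<in> {0..1} \<Longrightarrow> y \<in> {0..1} \<Longrightarrow>
       r * \<bar>x - y\<bar> \<le> \<bar>foldr S w x - foldr S w y\<bar> \<and>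
       \<bar>foldr S w x - foldr S w y\<bar> \<le> K ^ min k0 (length w) * (1 + \<epsilon>) ^ length w * r * \<bar>x - y\<bar>"
      using Cons.IH[OF w(1)] by blast
    let ?X = "foldr S w ` {0..1}"
    let ?C = "K ^ min k0 (length w) * (1 + \<epsilon>) ^ length w"
    let ?C' = "K ^ min k0 (length (i # w)) * (1 + \<epsilon>) ^ length (i # w)"
    have X: "?X \<subseteq> {0..1}" using word_maps[OF w(1)] by blast
    have "\<exists>m M. m > 0 \<and> 0 \<le> M \<and> M * ?C \<le> ?C' * m \<and> (\<forall>u\<in>?X. \<forall>v\<in>?X. m * \<bar>u - v\<bar> \<le> \<bar>S i u - S i v\<bar> \<and> \<bar>S i u - S i v\<bar> \<le> M * \<bar>u - v\<bar>)"
    proof (cases "length w < k0")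
      case True
      have C: "?C \<ge> 0" using K(1) e by simp
      have "?C \<le> (1 + \<epsilon>) * ?C" using mult_right_mono[OF _ C, of 1 "1 + \<epsilon>"] e by simp
      with K(2) have "lam * ?C \<le> K * a0 * ((1 + \<epsilon>) * ?C)"
        by (rule mult_mono) (use K(1) a0 C in simp_all)
      also have "\<dots> = ?C' * a0"
      proof -
        have "min k0 (length w) = length w" "min k0 (length (i # w)) = Suc (length w)" using True by auto
        then show ?thesis by simp
      qed
      finally have "lam * ?C \<le> ?C' * a0" .
      moreover have "a0 * \<bar>u - v\<bar> \<le> \<bar>S i u - S i v\<bar> \<and> \<bar>S i u - S i v\<bar> \<le> lam * \<bar>u - v\<bar>"
        if "u \<in> ?X" "v \<in> ?X" for u v
        using contraction[OF w(2)] expansion[OF w(2)] subsetD[OF X that(1)] subsetD[OF X that(2)] by blast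
      ultimately show ?thesis
        using a0 lam by (intro exI[of _ a0] exI[of _ lam]) (simp del: image_iff)
    next
      case False
      have "\<bar>u - v\<bar> \<le> \<eta>" if uv: "u \<in> ?X" "v \<in> ?X" for u v
      proof -
        obtain x y where xy: "x \<in> {0..1}" "y \<in> {0..1}" "u = foldr S w x" "v = foldr S w y" using uv by blast
        have "\<bar>u - v\<bar> \<le> lam ^ length w * \<bar>x - y\<bar>" using word_contraction[OF w(1) xy(1,2)] xy by simp
        also have "\<dots> \<le> lam ^ k0 * 1"
          using lam False xy by (intro mult_mono power_decreasing) auto
        finally show ?thesis using k0 by simp
      qed
      then obtain m where m: "m > 0" "\<forall>u\<in>?X. \<forall>v\<in>?X. m * \<bar>u - v\<bar> \<le> \<bar>S i u - S i v\<bar> \<and> \<bar>S i u - S i v\<bar> \<le> (1 + \<epsilon>) * m * \<bar>u - v\<bar>"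
        using \<eta>(2)[OF w(2) X] by blast
      have "(1 + \<epsilon>) * m * ?C \<le> ?C' * m" using False by (simp add: min_def mult_ac)
      then show ?thesis using m e by (intro exI[of _ m] exI[of _ "(1 + \<epsilon>) * m"]) auto
    qed
    then obtain m M where m: "m > 0" "0 \<le> M" "M * ?C \<le> ?C' * m"
      "\<And>u v. u \<in> ?X \<Longrightarrow> v \<in> ?X \<Longrightarrow> m * \<bar>u - v\<bar> \<le> \<bar>S i u - S i v\<bar> \<and> \<bar>S i u - S i v\<bar> \<le> M * \<bar>u - v\<bar>"
      by blast
    show ?case
    proof (intro exI[of _ "m * r"] conjI ballI)
      show "m * r > 0" using m r by simp
      fix x y :: real assume xy: "x \<in> {0..1}" "y \<in> {0..1}"
      let ?u = "foldr S w x" and ?v = "foldr S w y"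
      have uv: "m * \<bar>?u - ?v\<bar> \<le> \<bar>S i ?u - S i ?v\<bar>" "\<bar>S i ?u - S i ?v\<bar> \<le> M * \<bar>?u - ?v\<bar>"
        using m(4)[of ?u ?v] xy by blast+
      have "m * (r * \<bar>x - y\<bar>) \<le> m * \<bar>?u - ?v\<bar>" using r(2)[OF xy] m by (intro mult_left_mono) auto
      then show "m * r * \<bar>x - y\<bar> \<le> \<bar>foldr S (i # w) x - foldr S (i # w) y\<bar>" using uv(1) by simp
      have "M * \<bar>?u - ?v\<bar> \<le> M * (?C * r * \<bar>x - y\<bar>)" using r(2)[OF xy] m by (intro mult_left_mono) auto
      also have "\<dots> = (M * ?C) * (r * \<bar>x - y\<bar>)" by simp
      also have "\<dots> \<le> (?C' * m) * (r * \<bar>x - y\<bar>)" using m(3) r(1) by (intro mult_right_mono) auto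
      finally show "\<bar>foldr S (i # w) x - foldr S (i # w) y\<bar> \<le> ?C' * (m * r) * \<bar>x - y\<bar>" using uv(2) by simp
    qed
  qed
  show ?thesis
  proof (rule that[of "K ^ k0"])
    show "K ^ k0 \<ge> 1" using K by simp
    fix w assume "w \<in> words"
    then obtain r where r: "r > 0" "\<And>x y. x \<in> {0..1} \<Longrightarrow> y \<in> {0..1} \<Longrightarrow>
       r * \<bar>x - y\<bar> \<le> \<bar>foldr S w x - foldr S w y\<bar> \<and>
       \<bar>foldr S w x - foldr S w y\<bar> \<le> K ^ min k0 (length w) * (1 + \<epsilon>) ^ length w * r * \<bar>x - y\<bar>"
      using main[of w] by meson
    have "K ^ min k0 (length w) * (1 + \<epsilon>) ^ length w * r * d \<le> K ^ k0 * (1 + \<epsilon>) ^ length w * r * d" if "d \<ge> 0" for d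
      using that r(1) e K by (intro mult_right_mono power_increasing) auto
    then show "\<exists>r>0. \<forall>x\<in>{0..1}. \<forall>y\<in>{0..1}. r * \<bar>x - y\<bar> \<le> \<bar>foldr S w x - foldr S w y\<bar> \<and>
     \<bar>foldr S w x - foldr S w y\<bar> \<le> K ^ k0 * (1 + \<epsilon>) ^ length w * r * \<bar>x - y\<bar>"
      using r by (intro exI[of _ r]) (meson abs_ge_zero order_trans)
  qed
qed

text \<open>Records only the self-similarity identity that a cut through the tree of words yields,
  not the combinatorial property of being a cut.\<close>

definition cut_set :: "nat list set \<Rightarrow> bool" where
  "cut_set W \<longleftrightarrow> finite W \<and> W \<subseteq> words \<and>
     (\<forall>B\<in>sets \<nu>. measure \<nu> B = (\<Sum>w\<in>W. weight w * measure \<nu> (foldr S w -` B \<inter> {0..1})))"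

definition small :: "real \<Rightarrow> nat list \<Rightarrow> bool" where
  "small \<rho> w \<longleftrightarrow> (\<forall>x\<in>{0..1}. \<forall>y\<in>{0..1}. \<bar>foldr S w x - foldr S w y\<bar> \<le> \<rho>)"

text \<open>Words are extended on the right, which subdivides their images, until the image has
  diameter at most \<rho>. The induction stops the process after \<open>N\<close> letters, and all
  words are small once \<open>lam ^ N < \<rho>\<close>. The parent \<open>v\<close>, still too
  large, later bounds the size of the image from below.\<close>

lemma exists_cut_set:
  assumes \<rho>: "0 < \<rho>" "\<rho> < 1"
  shows "\<exists>W. cut_set W \<and> (\<forall>w\<in>W. small \<rho> w \<and> (\<exists>v i. w = v @ [i] \<and> v \<in> words \<and> i < l \<and> \<not> small \<rho> v))"
proof -
  have step: "\<exists>W. cut_set W \<and> (\<forall>w\<in>W. length w \<le> N) \<and>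
     (\<forall>w\<in>W. (small \<rho> w \<and> (\<exists>v i. w = v @ [i] \<and> v \<in> words \<and> i < l \<and> \<not> small \<rho> v)) \<or> (length w = N \<and> \<not> small \<rho> w))" for N
  proof (induction N)
    case 0
    have "\<not> small \<rho> []"
    proof
      assume "small \<rho> []"
      then have "\<bar>foldr S [] 1 - foldr S [] 0\<bar> \<le> \<rho>" unfolding small_def by (auto simp del: foldr.simps)
      then show False using \<rho> by simp
    qed
    moreover have "cut_set {[]}"
    proof -
      have "B \<inter> {0..1} = B" if "B \<in> sets \<nu>" for B using that by (auto simp: sets_nu_iff)
      then show ?thesis unfolding cut_set_def by (auto simp: weight_def)
    qed
    ultimately show ?case by (intro exI[of _ "{[]}"]) auto
  next
    case (Suc N)
    then obtain W where W: "cut_set W" "\<forall>w\<in>W. length w \<le> N"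
      "\<forall>w\<in>W. (small \<rho> w \<and> (\<exists>v i. w = v @ [i] \<and> v \<in> words \<and> i < l \<and> \<not> small \<rho> v)) \<or> (length w = N \<and> \<not> small \<rho> w)"
      by blast
    define G where "G = {w\<in>W. small \<rho> w}"
    define U where "U = {w\<in>W. \<not> small \<rho> w}"
    define E where "E = (\<lambda>(w, i). w @ [i]) ` (U \<times> {..<l})"
    have fin: "finite G" "finite U" "finite E" "finite W"
      using W(1) by (auto simp: G_def U_def E_def cut_set_def)
    have Ww: "w \<in> words" if "w \<in> W" for w using W(1) that by (auto simp: cut_set_def)
    have UN: "length w = N" if "w \<in> U" for w using W(3) that by (auto simp: U_def)
    have "G \<inter> E = {}" using W(2) UN by (force simp: G_def E_def)
    have inj: "inj_on (\<lambda>(w, i). w @ [i]) (U \<times> {..<l})" by (auto simp: inj_on_def)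
    have "cut_set (G \<union> E)"
      unfolding cut_set_def
    proof (intro conjI ballI)
      show "finite (G \<union> E)" using fin by auto
      show "G \<union> E \<subseteq> words" using Ww by (force simp: G_def E_def U_def)
      fix B assume B: "B \<in> sets \<nu>"
      let ?f = "\<lambda>w. weight w * measure \<nu> (foldr S w -` B \<inter> {0..1})"
      \<comment> \<open>Self-similarity is applied to the preimage under w, so the new letter acts
        first.\<close>
      have split: "?f w = (\<Sum>i<l. ?f (w @ [i]))" if w: "w \<in> U" for w
      proof -
        have ww: "w \<in> words" using Ww w by (auto simp: U_def)
        have "measure \<nu> (foldr S w -` B \<inter> {0..1}) =
          (\<Sum>i<l. p i * measure \<nu> (S i -` (foldr S w -` B \<inter> {0..1}) \<inter> {0..1}))"
          by (rule self_similar[OF word_preimage_sets[OF ww B]])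
        also have "\<dots> = (\<Sum>i<l. p i * measure \<nu> (foldr S (w @ [i]) -` B \<inter> {0..1}))"
          using maps by (intro sum.cong arg_cong2[where f="(*)"] arg_cong[where f="measure \<nu>"]) auto
        finally show ?thesis by (simp add: sum_distrib_left weight_def mult_ac)
      qed
      have "measure \<nu> B = sum ?f W" using W(1) B by (auto simp: cut_set_def)
      also have "W = G \<union> U" by (auto simp: G_def U_def)
      also have "sum ?f (G \<union> U) = sum ?f G + sum ?f U"
        by (rule sum.union_disjoint) (use fin in \<open>auto simp: G_def U_def\<close>)
      also have "sum ?f U = (\<Sum>w\<in>U. \<Sum>i<l. ?f (w @ [i]))" using split by (intro sum.cong) auto
      also have "\<dots> = (\<Sum>(w, i)\<in>U \<times> {..<l}. ?f (w @ [i]))" by (rule sum.cartesian_product)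
      also have "\<dots> = sum ?f E" unfolding E_def using sum.reindex[OF inj, of ?f] by (simp add: comp_def case_prod_beta')
      also have "sum ?f G + sum ?f E = sum ?f (G \<union> E)"
        by (rule sum.union_disjoint[symmetric]) (use fin \<open>G \<inter> E = {}\<close> in auto)
      finally show "measure \<nu> B = sum ?f (G \<union> E)" .
    qed
    moreover have "\<forall>w\<in>G \<union> E. length w \<le> Suc N" using W(2) UN by (force simp: G_def E_def)
    moreover have "(small \<rho> w \<and> (\<exists>v i. w = v @ [i] \<and> v \<in> words \<and> i < l \<and> \<not> small \<rho> v)) \<or> (length w = Suc N \<and> \<not> small \<rho> w)"
      if wGE: "w \<in> G \<union> E" for w
    proof (cases "w \<in> G")
      case True
      then show ?thesis using W(3) by (auto simp: G_def)
    next
      case False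
      then obtain v i where v: "w = v @ [i]" "v \<in> U" "i < l" using wGE by (auto simp: E_def)
      then have "v \<in> words" "\<not> small \<rho> v" "length w = Suc N" using UN Ww by (auto simp: U_def)
      then show ?thesis using v by blast
    qed
    ultimately show ?case by (intro exI[of _ "G \<union> E"]) blast
  qed
  obtain N where N: "lam ^ N < \<rho>" using real_arch_pow_inv[OF \<rho>(1) lam(2)] by blast
  obtain W where W: "cut_set W"
      "\<forall>w\<in>W. (small \<rho> w \<and> (\<exists>v i. w = v @ [i] \<and> v \<in> words \<and> i < l \<and> \<not> small \<rho> v)) \<or> (length w = N \<and> \<not> small \<rho> w)"
    using step[of N] by blast
  have "small \<rho> w" if "w \<in> W" "length w = N" for w
    unfolding small_def
  proof (intro ballI)
    fix x y :: real assume xy: "x \<in> {0..1}" "y \<in> {0..1}"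
    have "w \<in> words" using W(1) that by (auto simp: cut_set_def)
    then have "\<bar>foldr S w x - foldr S w y\<bar> \<le> lam ^ N * \<bar>x - y\<bar>" using word_contraction xy that by blast
    also have "\<dots> \<le> lam ^ N * 1" using xy lam by (intro mult_left_mono) auto
    finally show "\<bar>foldr S w x - foldr S w y\<bar> \<le> \<rho>" using N by simp
  qed
  then show ?thesis using W by blast
qed

text \<open>The parent of a word has an image longer than \<rho>, which by
  \<open>word_distortion\<close> bounds its ratio from below; the last letter costs a further factor
  \<open>a0\<close>. The length \<open>m\<close> of the parent satisfies
  \<open>\<rho> < lam ^ m\<close>, so that (1 + \<epsilon>)^m can later be compared with a power of
  \<rho>.\<close>

lemma cut_set_fine:
  assumes e: "\<epsilon> > 0"
  obtains A where "A \<ge> 1" "\<And>\<rho>. 0 < \<rho> \<Longrightarrow> \<rho> < 1 \<Longrightarrow> \<exists>W. cut_set W \<and> [] \<notin> W \<and>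
     (\<forall>w\<in>W. small \<rho> w \<and> (\<exists>m. \<rho> < lam ^ m \<and>
        (\<forall>x\<in>{0..1}. \<forall>y\<in>{0..1}. \<rho> / (A * (1 + \<epsilon>) ^ m) * \<bar>x - y\<bar> \<le> \<bar>foldr S w x - foldr S w y\<bar>)))"
proof -
  obtain A where A: "A \<ge> 1" "\<And>w. w \<in> words \<Longrightarrow> \<exists>r>0. \<forall>x\<in>{0..1}. \<forall>y\<in>{0..1}.
     r * \<bar>x - y\<bar> \<le> \<bar>foldr S w x - foldr S w y\<bar> \<and>
     \<bar>foldr S w x - foldr S w y\<bar> \<le> A * (1 + \<epsilon>) ^ length w * r * \<bar>x - y\<bar>"
    using word_distortion[OF e] by blast
  define A' where "A' = max 1 (A / a0)"
  have "A / a0 \<le> A'" by (simp add: A'_def)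
  then have A': "A' \<ge> 1" "A \<le> A' * a0"
    unfolding pos_divide_le_eq[OF a0] by (simp_all add: A'_def)
  show ?thesis
  proof (rule that[OF A'(1)])
    fix \<rho> :: real assume \<rho>: "0 < \<rho>" "\<rho> < 1"
    obtain W where W: "cut_set W" "\<forall>w\<in>W. small \<rho> w \<and> (\<exists>v i. w = v @ [i] \<and> v \<in> words \<and> i < l \<and> \<not> small \<rho> v)"
      using exists_cut_set[OF \<rho>] by blast
    have "\<exists>m. \<rho> < lam ^ m \<and> (\<forall>x\<in>{0..1}. \<forall>y\<in>{0..1}. \<rho> / (A' * (1 + \<epsilon>) ^ m) * \<bar>x - y\<bar> \<le> \<bar>foldr S w x - foldr S w y\<bar>)"
      if wW: "w \<in> W" for w
    proof -
      obtain v i where v: "w = v @ [i]" "v \<in> words" "i < l" "\<not> small \<rho> v" using bspec[OF W(2) wW] by auto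
      obtain x y where xy: "x \<in> {0..1}" "y \<in> {0..1}" "\<rho> < \<bar>foldr S v x - foldr S v y\<bar>"
        using v(4) unfolding small_def by (meson not_le)
      have xy1: "\<bar>x - y\<bar> \<le> 1" using xy(1,2) by auto
      let ?m = "length v"
      have "\<rho> < lam ^ ?m * \<bar>x - y\<bar>" using xy word_contraction[OF v(2) xy(1,2)] by linarith
      also have "\<dots> \<le> lam ^ ?m * 1" using xy1 lam by (intro mult_left_mono) auto
      finally have m: "\<rho> < lam ^ ?m" by simp
      obtain r where r: "r > 0" "\<And>x y. x \<in> {0..1} \<Longrightarrow> y \<in> {0..1} \<Longrightarrow>
         r * \<bar>x - y\<bar> \<le> \<bar>foldr S v x - foldr S v y\<bar> \<and>
         \<bar>foldr S v x - foldr S v y\<bar> \<le> A * (1 + \<epsilon>) ^ ?m * r * \<bar>x - y\<bar>"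
        using A(2)[OF v(2)] by blast
      let ?D = "(1 + \<epsilon>) ^ ?m"
      have D: "?D > 0" using e by simp
      have "\<rho> < A * ?D * r * \<bar>x - y\<bar>" using r(2)[OF xy(1,2)] xy(3) by linarith
      also have "\<dots> \<le> A * ?D * r * 1" using xy1 A(1) D r(1) by (intro mult_left_mono) auto
      also have "\<dots> \<le> (A' * a0) * ?D * r" using A'(2) D r(1) by (simp add: mult_right_mono)
      finally have "\<rho> < (A' * ?D) * (r * a0)" by (simp add: mult_ac)
      then have low: "\<rho> / (A' * ?D) \<le> r * a0" using A'(1) D by (simp add: pos_divide_le_eq mult_ac)
      have "\<rho> / (A' * ?D) * \<bar>x - y\<bar> \<le> \<bar>foldr S w x - foldr S w y\<bar>" if xy: "x \<in> {0..1}" "y \<in> {0..1}" for x y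
      proof -
        have "\<rho> / (A' * ?D) * \<bar>x - y\<bar> \<le> r * a0 * \<bar>x - y\<bar>" using low by (rule mult_right_mono) simp
        also have "\<dots> = r * (a0 * \<bar>x - y\<bar>)" by simp
        also have "\<dots> \<le> r * \<bar>S i x - S i y\<bar>" using expansion[OF v(3) xy] r(1) by (intro mult_left_mono) auto
        also have "\<dots> \<le> \<bar>foldr S v (S i x) - foldr S v (S i y)\<bar>"
          using r(2)[OF maps[OF v(3) xy(1)] maps[OF v(3) xy(2)]] by blast
        finally show ?thesis using v(1) by simp
      qed
      then show ?thesis using m by blast
    qed
    then show "\<exists>W. cut_set W \<and> [] \<notin> W \<and> (\<forall>w\<in>W. small \<rho> w \<and> (\<exists>m. \<rho> < lam ^ m \<and>
        (\<forall>x\<in>{0..1}. \<forall>y\<in>{0..1}. \<rho> / (A' * (1 + \<epsilon>) ^ m) * \<bar>x - y\<bar> \<le> \<bar>foldr S w x - foldr S w y\<bar>)))"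
      using W by (intro exI[of _ W]) blast
  qed
qed

end

section \<open>Preimages of intervals and Jensen's inequality for powers\<close>

text \<open>A continuous injective map is strictly monotone. The last two claims feed the recursion
  on covers: a new endpoint is 0, 1, or is mapped to an old endpoint. Interior points are mapped
  into the open unit interval, so that old endpoint is neither 0 nor 1 and belongs to the separated
  set.\<close>

lemma monotone_preimage_Icc:
  fixes f :: "real \<Rightarrow> real"
  assumes cont: "continuous_on {0..1} f" and inj: "inj_on f {0..1}" and f01: "f ` {0..1} \<subseteq> {0..1}"
    and ne: "{x\<in>{0..1}. f x \<in> {a..b}} \<noteq> {}"
  defines "X \<equiv> {x\<in>{0..1}. f x \<in> {a..b}}"
  shows "X = {Inf X..Sup X}" "Inf X \<le> Sup X" "Inf X \<in> X" "Sup X \<in> X"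
    "Inf X \<in> {0, 1} \<or> f (Inf X) \<in> {a, b} \<inter> {0<..<1}"
    "Sup X \<in> {0, 1} \<or> f (Sup X) \<in> {a, b} \<inter> {0<..<1}"
proof -
  have mono: "strict_mono_on {0..1} f \<or> strict_antimono_on {0..1} f"
    using injective_eq_monotone_map[of "{0..1}" f] cont inj is_interval_cc by blast
  have btw: "f z \<in> {min (f x) (f y)..max (f x) (f y)}" if "x \<in> {0..1}" "y \<in> {0..1}" "x \<le> z" "z \<le> y" for x y z
    using mono
  proof
    assume *: "strict_mono_on {0..1} f"
    have "f x \<le> f z" "f z \<le> f y"
      using that strict_mono_on_leD[OF *, of x z] strict_mono_on_leD[OF *, of z y] by auto
    then show ?thesis by auto
  next
    assume *: "strict_antimono_on {0..1} f"
    have "f y \<le> f z" "f z \<le> f x" using that monotone_onD[OF *, of z y] monotone_onD[OF *, of x z]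
      by (cases "z = y"; cases "x = z"; force)+
    then show ?thesis by auto
  qed
  have "closed X"
    unfolding X_def using continuous_closed_preimage[OF cont, of "{a..b}"]
    by (simp add: vimage_def Int_def conj_commute)
  have bdd: "bdd_below X" "bdd_above X" by (auto simp: X_def intro: bdd_belowI[of _ 0] bdd_aboveI[of _ 1])
  have neX: "X \<noteq> {}" using ne by (simp add: X_def)
  show I: "Inf X \<in> X" and S: "Sup X \<in> X"
    using closed_contains_Inf closed_contains_Sup bdd neX \<open>closed X\<close> by auto
  show le: "Inf X \<le> Sup X" using I bdd by (intro cSup_upper)
  show "X = {Inf X..Sup X}"
  proof
    show "X \<subseteq> {Inf X..Sup X}" using bdd by (auto intro: cInf_lower cSup_upper)
    show "{Inf X..Sup X} \<subseteq> X"
    proof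
      fix z assume z: "z \<in> {Inf X..Sup X}"
      have "f z \<in> {min (f (Inf X)) (f (Sup X))..max (f (Inf X)) (f (Sup X))}"
        using z I S by (intro btw) (auto simp: X_def)
      then show "z \<in> X" using z I S by (auto simp: X_def)
    qed
  qed
  have interior: "f e \<in> {0<..<1}" if "0 < e" "e < 1" for e
  proof -
    have *: "f 0 \<in> {0..1}" "f 1 \<in> {0..1}" by (intro subsetD[OF f01 imageI]; simp)+
    from mono show ?thesis
    proof
      assume **: "strict_mono_on {0..1} f"
      have "f 0 < f e" "f e < f 1"
        using that strict_mono_onD[OF **, of 0 e] strict_mono_onD[OF **, of e 1] by auto
      then show ?thesis using * by auto
    next
      assume **: "strict_antimono_on {0..1} f"
      have "f e < f 0" "f 1 < f e" using that monotone_onD[OF **, of 0 e] monotone_onD[OF **, of e 1] by auto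
      then show ?thesis using * by auto
    qed
  qed
  \<comment> \<open>A point mapped strictly between a and b has a neighbourhood in \<open>X\<close>,
    hence cannot be extremal in \<open>X\<close> unless it is 0 or 1.\<close>
  have nbhd: "\<exists>d>0. \<forall>y\<in>{0..1}. \<bar>y - e\<bar> < d \<longrightarrow> y \<in> X" if e: "e \<in> {0..1}" "a < f e" "f e < b" for e
  proof -
    have "min (f e - a) (b - f e) > 0" using e by simp
    then obtain d where d: "d > 0" "\<forall>y\<in>{0..1}. dist y e < d \<longrightarrow> dist (f y) (f e) < min (f e - a) (b - f e)"
      using cont[unfolded continuous_on_iff] e(1) by meson
    have "y \<in> X" if "y \<in> {0..1}" "\<bar>y - e\<bar> < d" for y
    proof -
      have "\<bar>f y - f e\<bar> < min (f e - a) (b - f e)" using d(2) that by (simp add: dist_real_def)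
      then show ?thesis using that unfolding X_def by auto
    qed
    then show ?thesis using d by blast
  qed
  show "Inf X \<in> {0, 1} \<or> f (Inf X) \<in> {a, b} \<inter> {0<..<1}"
  proof (rule ccontr)
    assume neg: "\<not> ?thesis"
    let ?e = "Inf X"
    have e: "0 < ?e" "?e < 1" using neg I by (auto simp: X_def)
    then have "a < f ?e" "f ?e < b" using neg I interior[OF e] by (auto simp: X_def)
    then obtain d where d: "d > 0" "\<forall>y\<in>{0..1}. \<bar>y - ?e\<bar> < d \<longrightarrow> y \<in> X" using nbhd[of ?e] e by auto
    define y where "y = max 0 (?e - d / 2)"
    have "y \<in> {0..1}" "\<bar>y - ?e\<bar> < d" "y < ?e" using d e by (auto simp: y_def max_def)
    then show False using d cInf_lower[OF _ bdd(1), of y] by auto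
  qed
  show "Sup X \<in> {0, 1} \<or> f (Sup X) \<in> {a, b} \<inter> {0<..<1}"
  proof (rule ccontr)
    assume neg: "\<not> ?thesis"
    let ?e = "Sup X"
    have e: "0 < ?e" "?e < 1" using neg S by (auto simp: X_def)
    then have "a < f ?e" "f ?e < b" using neg S interior[OF e] by (auto simp: X_def)
    then obtain d where d: "d > 0" "\<forall>y\<in>{0..1}. \<bar>y - ?e\<bar> < d \<longrightarrow> y \<in> X" using nbhd[of ?e] e by auto
    define y where "y = min 1 (?e + d / 2)"
    have "y \<in> {0..1}" "\<bar>y - ?e\<bar> < d" "?e < y" using d e by (auto simp: y_def min_def)
    then show False using d cSup_upper[OF _ bdd(2), of y] by auto
  qed
qed

text \<open>Jensen's inequality for a concave power, from the tangent at the mean \<open>m\<close>;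
  the tangent bound is Young's inequality for y / m and 1. If the mean is 0, all terms
  vanish.\<close>

lemma powr_weighted_mean_ge:
  fixes q :: real
  assumes q: "0 < q" "q \<le> 1" and A: "finite A" and w: "\<And>i. i \<in> A \<Longrightarrow> w i \<ge> 0" "sum w A = 1"
    and x: "\<And>i. i \<in> A \<Longrightarrow> x i \<ge> 0"
  shows "(\<Sum>i\<in>A. w i * x i powr q) \<le> (\<Sum>i\<in>A. w i * x i) powr q"
proof -
  define m where "m = (\<Sum>i\<in>A. w i * x i)"
  have m: "m \<ge> 0" unfolding m_def using w x by (intro sum_nonneg mult_nonneg_nonneg) auto
  show ?thesis
  proof (cases "m = 0")
    case True
    then have "w i * x i = 0" if "i \<in> A" for i
      using sum_nonneg_eq_0_iff[OF A, of "\<lambda>i. w i * x i"] that w x unfolding m_def by auto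
    then have "w i * x i powr q = 0" if "i \<in> A" for i using that by fastforce
    then have "(\<Sum>i\<in>A. w i * x i powr q) = 0" by (intro sum.neutral) auto
    then show ?thesis by simp
  next
    case False
    then have "m > 0" using m by simp
    have tangent: "y powr q \<le> m powr q * (1 + q * (y / m - 1))" if "y \<ge> 0" for y
    proof -
      have "(y / m) powr q \<le> 1 + q * (y / m - 1)"
      proof (cases "y = 0")
        case True
        then show ?thesis using q by simp
      next
        case False
        then have z: "y / m > 0" using that \<open>m > 0\<close> by simp
        have "(y / m) powr q * 1 powr (1 - q) \<le> q * (y / m) + (1 - q) * 1"
          using q z by (intro Youngs_inequality_0) auto
        then show ?thesis by (simp add: algebra_simps)
      qed
      then have "m powr q * (y / m) powr q \<le> m powr q * (1 + q * (y / m - 1))" by (intro mult_left_mono) auto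
      then show ?thesis using that \<open>m > 0\<close> by (simp add: powr_mult[symmetric])
    qed
    have "(\<Sum>i\<in>A. w i * x i powr q) \<le> (\<Sum>i\<in>A. w i * (m powr q * (1 + q * (x i / m - 1))))"
      using w x tangent by (intro sum_mono mult_left_mono) auto
    also have "\<dots> = (\<Sum>i\<in>A. m powr q * (1 - q) * w i + (m powr q * q / m) * (w i * x i))"
      by (intro sum.cong) (auto simp: algebra_simps diff_divide_distrib add_divide_distrib)
    also have "\<dots> = m powr q * (1 - q) * sum w A + (m powr q * q / m) * m"
      unfolding sum.distrib m_def by (simp only: sum_distrib_left)
    also have "\<dots> = m powr q" using w(2) False by (simp add: algebra_simps)
    finally show ?thesis unfolding m_def .
  qed
qed

section \<open>Power sums over interval covers\<close>

context self_conformal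
begin

definition Jpow :: "real \<Rightarrow> real \<times> real \<Rightarrow> real" where
  "Jpow q = (\<lambda>(a, b). (measure \<nu> {a..b} * (b - a)) powr q)"

text \<open>\<open>N\<close> is the recursion counter. Pulling back under a nonempty word stretches
  distances by at least 1 / lam and lowers \<open>N\<close> by one; at \<open>N = 0\<close> the set
  \<open>F\<close> has at most one point. The endpoints 0 and 1 are exempt, since they reappear at
  every stage.\<close>

definition separated_cover :: "nat \<Rightarrow> real set \<Rightarrow> (real \<times> real) set \<Rightarrow> bool" where
  "separated_cover N F P \<longleftrightarrow> finite P \<and> F \<subseteq> {0<..<1} \<and> (\<forall>x\<in>F. \<forall>y\<in>F. x \<noteq> y \<longrightarrow> lam ^ N \<le> \<bar>x - y\<bar>) \<and>
     (\<forall>(a, b)\<in>P. a \<le> b \<and> a \<in> F \<union> {0, 1} \<and> b \<in> F \<union> {0, 1}) \<and> {0..1} \<subseteq> (\<Union>(a, b)\<in>P. {a..b})"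

text \<open>The window contains the indices of all cells that can meet a set of diameter at most one
  cell length through the point at position x. The bound 4 for each of two endpoints becomes the
  constant 8.\<close>

lemma card_cells_near_le: "card {k::nat. x - 2 \<le> real k \<and> real k < x + 1} \<le> 4"
proof -
  have "{k::nat. x - 2 \<le> real k \<and> real k < x + 1} \<subseteq> {nat \<lceil>x - 2\<rceil>..nat \<lceil>x - 2\<rceil> + 3}"
  proof
    fix k :: nat assume k: "k \<in> {k. x - 2 \<le> real k \<and> real k < x + 1}"
    then have k': "x - 2 \<le> real k" "real k < x + 1" by auto
    from k'(1) have "\<lceil>x - 2\<rceil> \<le> int k" by (intro ceiling_le) simp
    moreover have "int k < \<lceil>x - 2\<rceil> + 4" using k'(2) le_of_int_ceiling[of "x - 2"] by linarith
    ultimately have "\<lceil>x - 2\<rceil> \<le> int k" "int k < \<lceil>x - 2\<rceil> + 4" .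
    then show "k \<in> {nat \<lceil>x - 2\<rceil>..nat \<lceil>x - 2\<rceil> + 3}" by auto
  qed
  then have "card {k::nat. x - 2 \<le> real k \<and> real k < x + 1} \<le> card {nat \<lceil>x - 2\<rceil>..nat \<lceil>x - 2\<rceil> + 3}"
    by (intro card_mono) auto
  then show ?thesis by simp
qed

lemma finite_cells_near: "finite {k::nat. x - 2 \<le> real k \<and> real k < x + 1}"
  by (rule finite_subset[of _ "{..nat \<lceil>x + 1\<rceil>}"]) (auto, linarith)

text \<open>For every finite cover of \<open>[0,1]\<close> by intervals \<open>I\<close> the sum of \<open>(\<nu> I |I|) powr q\<close> is bounded below.
  Either an element of the cover contains a piece \<open>foldr S w ` {0..1}\<close>, or one passes to the preimages
  of the cover under the maps of \<open>W\<close>, the loss due to overlaps and distortion being compensated by the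
  hypothesis on the level \<open>n\<close> partition sum. The separation of the endpoints makes the recursion stop.\<close>

lemma cover_sum_lower_bound:
  assumes q: "0 < q" "q \<le> 1" and D: "D \<ge> 1" and n: "\<rho> = 1 / 2 ^ n"
    and W: "cut_set W" "[] \<notin> W" "\<And>w. w \<in> W \<Longrightarrow> small \<rho> w"
      "\<And>w x y. w \<in> W \<Longrightarrow> x \<in> {0..1} \<Longrightarrow> y \<in> {0..1} \<Longrightarrow> \<rho> / D * \<bar>x - y\<bar> \<le> \<bar>foldr S w x - foldr S w y\<bar>"
    and Z: "8 * D powr q \<le> (\<Sum>k<2 ^ n. (measure \<nu> (dyadic_cell n k) / 2 ^ n) powr q)"
  shows "\<exists>c>0. \<forall>N F P. separated_cover N F P \<longrightarrow> c \<le> (\<Sum>I\<in>P. Jpow q I)"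
proof -
  have \<rho>: "\<rho> > 0" using n by simp
  have fW: "finite W" and Ww: "\<And>w. w \<in> W \<Longrightarrow> w \<in> words" using W(1) by (auto simp: cut_set_def)
  have w0: "weight w \<ge> 0" if "w \<in> W" for w using weight_pos[OF Ww[OF that]] by simp
  have "W \<noteq> {}"
  proof
    assume "W = {}"
    then have "measure \<nu> {0..1} = 0" using W(1) by (auto simp: cut_set_def sets_nu_iff)
    then show False using prob_space by simp
  qed
  \<comment> \<open>A cover element that contains a whole piece has at least the smallest weight as
    mass and length at least \<rho> / D. By \<open>cover_big\<close> such an element alone secures
    the bound.\<close>
  define c where "c = (Min (weight ` W) * (\<rho> / D)) powr q"
  have "Min (weight ` W) > 0" using fW \<open>W \<noteq> {}\<close> weight_pos Ww by (auto simp: Min_gr_iff)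
  then have c: "c > 0" unfolding c_def using \<rho> D by simp
  let ?im = "\<lambda>w. foldr S w ` {0..1}"
  have inj: "inj_on (foldr S w) {0..1}" if "w \<in> W" for w
  proof (rule inj_onI)
    fix x y assume "x \<in> {0..1}" "y \<in> {0..1}" "foldr S w x = foldr S w y"
    then have "\<rho> / D * \<bar>x - y\<bar> \<le> 0" using W(4)[OF that, of x y] by simp
    then show "x = y" using \<rho> D by (simp add: divide_le_0_iff mult_le_0_iff)
  qed
  have conn: "e1 \<in> ?im w" if "w \<in> W" "u \<in> ?im w" "v \<in> ?im w" "u \<le> e1" "e1 \<le> v" for w u v e1
  proof -
    have "connected (?im w)" by (intro connected_continuous_image word_continuous Ww that) auto
    then show ?thesis using that connected_contains_Icc[of "?im w" u v] by auto
  qed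
  have near: "e \<in> ?im w \<Longrightarrow> y \<in> ?im w \<Longrightarrow> \<bar>y - e\<bar> \<le> \<rho>" if "w \<in> W" for w e y
    using W(3)[OF that] unfolding small_def by blast
  have near_cell: "real k \<in> {e / \<rho> - 2..<e / \<rho> + 1}"
    if we: "w \<in> W" "e \<in> ?im w" "?im w \<inter> dyadic_cell n k \<noteq> {}" for w e k
  proof -
    obtain y where y: "y \<in> ?im w" "y \<in> dyadic_cell n k" using we(3) by blast
    have "real k * \<rho> < y" "y \<le> (real k + 1) * \<rho>" using y(2) by (auto simp: dyadic_cell_def n add.commute)
    moreover have "\<bar>y - e\<bar> \<le> \<rho>" using near[OF we(1,2) y(1)] .
    ultimately have "real k * \<rho> < e + \<rho>" "e - \<rho> \<le> (real k + 1) * \<rho>" by linarith+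
    then show ?thesis using \<rho> by (auto simp: field_simps)
  qed
  have cover_big: "c \<le> (\<Sum>I\<in>P. Jpow q I)"
    if P: "finite P" "\<forall>(a, b)\<in>P. a \<le> b \<and> 0 \<le> a \<and> b \<le> 1" and ab: "(a, b) \<in> P" and w: "w \<in> W" "?im w \<subseteq> {a..b}" for P a b w
  proof -
    have ab01: "0 \<le> a" "b \<le> 1" "a \<le> b" using P(2) ab by auto
    have abs: "{a..b} \<in> sets \<nu>" using ab01 by (simp add: sets_nu_iff)
    have "weight w \<le> measure \<nu> {a..b}"
    proof -
      have "foldr S w -` {a..b} \<inter> {0..1} = {0..1}" using w(2) by auto
      then have "weight w = weight w * measure \<nu> (foldr S w -` {a..b} \<inter> {0..1})" using prob_space by simp
      also have "\<dots> \<le> (\<Sum>w\<in>W. weight w * measure \<nu> (foldr S w -` {a..b} \<inter> {0..1}))"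
        using fW w(1) by (intro member_le_sum) (auto intro!: mult_nonneg_nonneg w0)
      also have "\<dots> = measure \<nu> {a..b}" using W(1) abs by (auto simp: cut_set_def)
      finally show ?thesis .
    qed
    moreover have "Min (weight ` W) \<le> weight w" using fW w by (intro Min_le) auto
    ultimately have m: "Min (weight ` W) \<le> measure \<nu> {a..b}" by linarith
    have "\<rho> / D \<le> \<bar>foldr S w 1 - foldr S w 0\<bar>" using W(4)[OF w(1), of 1 0] by simp
    moreover have "foldr S w 1 \<in> {a..b}" "foldr S w 0 \<in> {a..b}" by (intro subsetD[OF w(2) imageI]; simp)+
    ultimately have "\<rho> / D \<le> b - a" by auto
    with m have "Min (weight ` W) * (\<rho> / D) \<le> measure \<nu> {a..b} * (b - a)"
      using \<rho> D by (intro mult_mono) auto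
    then have "c \<le> Jpow q (a, b)"
      unfolding c_def Jpow_def using \<rho> D q \<open>Min (weight ` W) > 0\<close> by (auto intro!: powr_mono2)
    also have "\<dots> \<le> (\<Sum>I\<in>P. Jpow q I)"
      using P(1) ab by (intro member_le_sum) (auto simp: Jpow_def)
    finally show ?thesis .
  qed
  \<comment> \<open>A word counts with its full weight for every cell its piece meets; thus
    \<open>wt k\<close> dominates the mass of cell k.\<close>
  define Om where "Om k = {w\<in>W. ?im w \<inter> dyadic_cell n k \<noteq> {}}" for k
  have Om: "Om k \<subseteq> W" "finite (Om k)" for k using fW by (auto simp: Om_def)
  define wt where "wt k = sum weight (Om k)" for k
  have wt: "measure \<nu> (dyadic_cell n k) \<le> wt k" if k: "k < 2 ^ n" for k
  proof -
    have "measure \<nu> (dyadic_cell n k) = (\<Sum>w\<in>W. weight w * measure \<nu> (foldr S w -` dyadic_cell n k \<inter> {0..1}))"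
      using W(1) dyadic_cell_sets[OF k] by (auto simp: cut_set_def)
    also have "\<dots> = (\<Sum>w\<in>Om k. weight w * measure \<nu> (foldr S w -` dyadic_cell n k \<inter> {0..1}))"
    proof (rule sum.mono_neutral_right[OF fW Om(1)], intro ballI)
      fix w assume "w \<in> W - Om k"
      then have "foldr S w -` dyadic_cell n k \<inter> {0..1} = {}" by (auto simp: Om_def)
      then show "weight w * measure \<nu> (foldr S w -` dyadic_cell n k \<inter> {0..1}) = 0" by (simp only: measure_empty mult_zero_right)
    qed
    also have "\<dots> \<le> (\<Sum>w\<in>Om k. weight w * 1)"
      using Om(1)[of k] w0 by (intro sum_mono mult_left_mono) auto
    finally show ?thesis by (simp add: wt_def)
  qed
  have main: "c \<le> (\<Sum>I\<in>P. Jpow q I)"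
    if "finite P" "F \<subseteq> {0<..<1}" "\<forall>x\<in>F. \<forall>y\<in>F. x \<noteq> y \<longrightarrow> lam ^ N \<le> \<bar>x - y\<bar>"
      "\<forall>(a, b)\<in>P. a \<le> b \<and> a \<in> F \<union> {0, 1} \<and> b \<in> F \<union> {0, 1}" "{0..1} \<subseteq> (\<Union>(a, b)\<in>P. {a..b})" for N F P
    using that
  proof (induction N arbitrary: F P)
    have P01: "\<forall>(a, b)\<in>P. a \<le> b \<and> 0 \<le> a \<and> b \<le> 1"
      if "F \<subseteq> {0<..<1}" "\<forall>(a, b)\<in>P. a \<le> b \<and> a \<in> F \<union> {0, 1} \<and> b \<in> F \<union> {0, 1}"
      for F :: "real set" and P
    proof (intro ballI, clarify)
      fix a b assume "(a, b) \<in> P"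
      with that(2) have "a \<le> b" "a \<in> F \<union> {0, 1}" "b \<in> F \<union> {0, 1}" by blast+
      moreover have "0 \<le> z \<and> z \<le> 1" if "z \<in> F \<union> {0, 1}" for z
        using that \<open>F \<subseteq> {0<..<1}\<close> by (auto dest: subsetD)
      ultimately show "a \<le> b \<and> 0 \<le> a \<and> b \<le> 1" by blast
    qed
    {
      case (0 F P)
      show ?case
      proof (rule ccontr)
        \<comment> \<open>Otherwise no cover element contains a piece, so every piece contains a
          point of \<open>F\<close>. For \<open>N = 0\<close> this point is common to all pieces,
          only four cells can be charged, and the sum in \<open>Z\<close> is at most 4.\<close>
        assume contr: "\<not> ?thesis"
        have notsub: "\<not> ?im w \<subseteq> {a..b}" if "w \<in> W" "(a, b) \<in> P" for w a b
          using cover_big[OF 0(1) P01[OF 0(2,4)] that(2,1)] contr by blast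
        have single: "x = y" if "x \<in> F" "y \<in> F" for x y
        proof (rule ccontr)
          assume "x \<noteq> y"
          then have "1 \<le> \<bar>x - y\<bar>" using 0(3) that by auto
          moreover have "x \<in> {0<..<1}" "y \<in> {0<..<1}" using subsetD[OF 0(2)] that by blast+
          ultimately show False by auto
        qed
        have "\<exists>y. \<forall>w\<in>W. y \<in> ?im w"
        proof -
          have hit: "\<exists>y\<in>F. y \<in> ?im w" if w: "w \<in> W" for w
          proof (rule ccontr)
            assume none: "\<not> (\<exists>y\<in>F. y \<in> ?im w)"
            have im01: "?im w \<subseteq> {0..1}" using word_maps[OF Ww[OF w]] by blast
            have "\<exists>s\<in>?im w. 0 < s \<and> s < 1"
            proof (rule ccontr)
              assume "\<not> ?thesis"
              then have "?im w \<subseteq> {0, 1}" using im01 by force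
              then have "finite (?im w)" by (rule finite_subset) simp
              then have "finite {0..1::real}" using inj[OF w] finite_image_iff by blast
              then show False using infinite_Icc[of 0 "1::real"] by simp
            qed
            then obtain s where s: "s \<in> ?im w" "0 < s" "s < 1" by blast
            then have "s \<in> {0..1}" by simp
            then have "s \<in> (\<Union>(a, b)\<in>P. {a..b})" using 0(5) by blast
            then obtain a b where ab: "(a, b) \<in> P" "a \<le> s" "s \<le> b" by auto
            have abF: "a \<in> F \<union> {0, 1}" "b \<in> F \<union> {0, 1}" using 0(4) ab(1) by auto
            have "?im w \<subseteq> {a..b}"
            proof
              fix v assume v: "v \<in> ?im w"
              have "a \<le> v"
              proof (rule ccontr)
                assume "\<not> a \<le> v"
                then have "a \<in> ?im w" using conn[OF w v s(1)] ab(2) by auto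
                then have "a \<notin> F" using none by blast
                then have "a = 0" using abF ab(2) s by auto
                then show False using \<open>\<not> a \<le> v\<close> subsetD[OF im01 v] by simp
              qed
              moreover have "v \<le> b"
              proof (rule ccontr)
                assume "\<not> v \<le> b"
                then have "b \<in> ?im w" using conn[OF w s(1) v] ab(3) by auto
                then have "b \<notin> F" using none by blast
                then have "b = 1" using abF ab(3) s by auto
                then show False using \<open>\<not> v \<le> b\<close> subsetD[OF im01 v] by simp
              qed
              ultimately show "v \<in> {a..b}" by simp
            qed
            then show False using notsub[OF w ab(1)] by blast
          qed
          obtain w0 where "w0 \<in> W" using \<open>W \<noteq> {}\<close> by blast
          then obtain y where "y \<in> F" using hit by blast
          then show ?thesis using hit single by (intro exI[of _ y]) blast
        qed
        then obtain y where y: "\<And>w. w \<in> W \<Longrightarrow> y \<in> ?im w" by blast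
        let ?K = "{k::nat. y / \<rho> - 2 \<le> real k \<and> real k < y / \<rho> + 1}"
        have zero: "measure \<nu> (dyadic_cell n k) = 0" if "k < 2 ^ n" "k \<notin> ?K" for k
        proof -
          have "Om k = {}"
          proof (rule ccontr)
            assume "Om k \<noteq> {}"
            then obtain w where w: "w \<in> W" "?im w \<inter> dyadic_cell n k \<noteq> {}" by (auto simp: Om_def)
            then show False using near_cell[OF w(1) y[OF w(1)] w(2)] that(2) by auto
          qed
          then have "wt k = 0" by (simp add: wt_def)
          then show ?thesis using wt[OF that(1)] measure_nonneg[of \<nu> "dyadic_cell n k"] by linarith
        qed
        have "(\<Sum>k<2 ^ n. (measure \<nu> (dyadic_cell n k) / 2 ^ n) powr q)
            = (\<Sum>k\<in>{..<2 ^ n} \<inter> ?K. (measure \<nu> (dyadic_cell n k) / 2 ^ n) powr q)"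
          using zero by (intro sum.mono_neutral_right) auto
        also have "\<dots> \<le> (\<Sum>k\<in>{..<2 ^ n} \<inter> ?K. 1)"
        proof (rule sum_mono)
          fix k
          have "measure \<nu> (dyadic_cell n k) / 2 ^ n \<le> 1 / 1" by (intro frac_le) auto
          then have "(measure \<nu> (dyadic_cell n k) / 2 ^ n) powr q \<le> 1 powr q"
            using q by (intro powr_mono2) auto
          then show "(measure \<nu> (dyadic_cell n k) / 2 ^ n) powr q \<le> 1" by simp
        qed
        also have "\<dots> \<le> real (card ?K)" using finite_cells_near by (simp add: card_mono)
        also have "\<dots> \<le> 4" using card_cells_near_le[of "y / \<rho>"] by linarith
        finally have "8 * D powr q \<le> 4" using Z by linarith
        moreover have "D powr q \<ge> 1" using D q by (simp add: ge_one_powr_ge_zero)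
        ultimately show False by linarith
      qed
    next
      case (Suc N F P)
      show ?case
      proof (rule ccontr)
        assume contr: "\<not> ?thesis"
        note P = Suc.prems
        have notsub: "\<not> ?im w \<subseteq> {a..b}" if "w \<in> W" "(a, b) \<in> P" for w a b
          using cover_big[OF P(1) P01[OF P(2,4)] that(2,1)] contr by blast
        \<comment> \<open>The pullback of a cover element, with its endpoints \<open>g\<close> and
          its value \<open>j\<close> of J. The empty pullback gets value 0 explicitly, as its
          infimum and supremum mean nothing.\<close>
        define X where "X w I = {x\<in>{0..1}. foldr S w x \<in> {fst I..snd I}}" for w and I :: "real \<times> real"
        define g where "g w I = (Inf (X w I), Sup (X w I))" for w I
        define j where "j w I = (if X w I = {} then 0 else measure \<nu> {Inf (X w I)..Sup (X w I)} * (Sup (X w I) - Inf (X w I)))" for w I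
        have X_props: "X w I = {Inf (X w I)..Sup (X w I)}" "Inf (X w I) \<le> Sup (X w I)" "Inf (X w I) \<in> X w I" "Sup (X w I) \<in> X w I"
            "Inf (X w I) \<in> {0, 1} \<or> foldr S w (Inf (X w I)) \<in> {fst I, snd I} \<inter> {0<..<1}"
            "Sup (X w I) \<in> {0, 1} \<or> foldr S w (Sup (X w I)) \<in> {fst I, snd I} \<inter> {0<..<1}"
          if wI: "w \<in> W" "X w I \<noteq> {}" for w I
        proof -
          have im01: "?im w \<subseteq> {0..1}" using word_maps[OF Ww[OF wI(1)]] by blast
          note M = monotone_preimage_Icc[OF word_continuous[OF Ww[OF wI(1)]] inj[OF wI(1)] im01
              wI(2)[unfolded X_def], folded X_def]
          show "X w I = {Inf (X w I)..Sup (X w I)}" by (rule M(1))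
          show "Inf (X w I) \<le> Sup (X w I)" by (rule M(2))
          show "Inf (X w I) \<in> X w I" by (rule M(3))
          show "Sup (X w I) \<in> X w I" by (rule M(4))
          show "Inf (X w I) \<in> {0, 1} \<or> foldr S w (Inf (X w I)) \<in> {fst I, snd I} \<inter> {0<..<1}" by (rule M(5))
          show "Sup (X w I) \<in> {0, 1} \<or> foldr S w (Sup (X w I)) \<in> {fst I, snd I} \<inter> {0<..<1}" by (rule M(6))
        qed
        \<comment> \<open>The nonempty pullbacks under w form a separated cover with counter
          \<open>N\<close>. Several elements may share a pullback; summing over the elements instead
          of the pullbacks can only increase the sum.\<close>
        have IH: "c \<le> (\<Sum>I\<in>P. j w I powr q)" if w: "w \<in> W" for w
        proof -
          let ?P = "{I\<in>P. X w I \<noteq> {}}"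
          define F' where "F' = {x\<in>{0<..<1}. foldr S w x \<in> F}"
          have "c \<le> (\<Sum>I\<in>g w ` ?P. Jpow q I)"
          proof (rule Suc.IH[of _ F'])
            show "finite (g w ` ?P)" using P(1) by auto
            show "F' \<subseteq> {0<..<1}" by (auto simp: F'_def)
            show "\<forall>x\<in>F'. \<forall>y\<in>F'. x \<noteq> y \<longrightarrow> lam ^ N \<le> \<bar>x - y\<bar>"
            proof (intro ballI impI)
              fix x y assume xy: "x \<in> F'" "y \<in> F'" "x \<noteq> y"
              then have xy01: "x \<in> {0..1}" "y \<in> {0..1}" and xyF: "foldr S w x \<in> F" "foldr S w y \<in> F"
                by (simp_all add: F'_def)
              have "foldr S w x \<noteq> foldr S w y" using inj_onD[OF inj[OF w] _ xy01] xy(3) by blast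
              then have "lam ^ Suc N \<le> \<bar>foldr S w x - foldr S w y\<bar>" using P(3) xyF by blast
              also have "\<dots> \<le> lam ^ length w * \<bar>x - y\<bar>" by (rule word_contraction[OF Ww[OF w] xy01])
              also have "\<dots> \<le> lam ^ 1 * \<bar>x - y\<bar>"
              proof (intro mult_right_mono power_decreasing)
                \<comment> \<open>A nonempty word contracts by at least the factor lam, so the
                  counter drops by one.\<close>
                show "1 \<le> length w" using w W(2) by (cases w) auto
              qed (use lam in auto)
              finally show "lam ^ N \<le> \<bar>x - y\<bar>" using lam by simp
            qed
            show "\<forall>(a, b)\<in>g w ` ?P. a \<le> b \<and> a \<in> F' \<union> {0, 1} \<and> b \<in> F' \<union> {0, 1}"
            proof (intro ballI, clarify)
              fix a b a' b' assume ab: "(a', b') \<in> P" "X w (a', b') \<noteq> {}" "(a, b) = g w (a', b')"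
              have mem: "z \<in> F' \<union> {0, 1}" if "z \<in> X w (a', b')" "z \<in> {0, 1} \<or> foldr S w z \<in> {a', b'} \<inter> {0<..<1}" for z
              proof (cases "z \<in> {0, 1}")
                case False
                then have z: "foldr S w z \<in> {a', b'} \<inter> {0<..<1}" "z \<in> {0<..<1}" using that by (auto simp: X_def)
                have "a' \<in> F \<union> {0, 1}" "b' \<in> F \<union> {0, 1}" using P(4) ab(1) by auto
                then show ?thesis using z by (auto simp: F'_def)
              qed auto
              show "a \<le> b \<and> a \<in> F' \<union> {0, 1} \<and> b \<in> F' \<union> {0, 1}"
                using X_props[OF w ab(2)] mem ab(3) by (auto simp: g_def)
            qed
            show "{0..1} \<subseteq> (\<Union>(a, b)\<in>g w ` ?P. {a..b})"
            proof
              fix x :: real assume x: "x \<in> {0..1}"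
              then have "foldr S w x \<in> (\<Union>(a, b)\<in>P. {a..b})" using word_maps[OF Ww[OF w] x] P(5) by blast
              then obtain I where I: "I \<in> P" "foldr S w x \<in> {fst I..snd I}" by auto
              then have xX: "x \<in> X w I" using x by (auto simp: X_def)
              then have "I \<in> ?P" "x \<in> {Inf (X w I)..Sup (X w I)}" using I X_props(1)[OF w] by blast+
              from imageI[OF this(1), of "g w"] show "x \<in> (\<Union>(a, b)\<in>g w ` ?P. {a..b})"
                by (rule UN_I) (use \<open>x \<in> {Inf (X w I)..Sup (X w I)}\<close> in \<open>simp add: g_def\<close>)
            qed
          qed
          also have "\<dots> \<le> (\<Sum>I\<in>?P. Jpow q (g w I))"
            using P(1) by (intro order_trans[OF sum_image_le]) (auto simp: Jpow_def g_def)
          also have "\<dots> = (\<Sum>I\<in>?P. j w I powr q)" by (intro sum.cong) (auto simp: Jpow_def g_def j_def)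
          also have "\<dots> \<le> (\<Sum>I\<in>P. j w I powr q)" using P(1) by (intro sum_mono2) auto
          finally show ?thesis .
        qed
        have j_nonneg: "j w I \<ge> 0" if "w \<in> W" for w I
          using X_props(2)[OF that] by (auto simp: j_def)
        define Pk where "Pk k = {I\<in>P. \<exists>w\<in>Om k. X w I \<noteq> {}}" for k
        \<comment> \<open>Average the induction hypothesis over the words of \<open>Om k\<close>
          with weights \<open>weight w / wt k\<close>, then move the mean inside the power.\<close>
        have piece: "c * (\<rho> / D * wt k) powr q \<le> (\<Sum>I\<in>Pk k. Jpow q I)" if k: "k < 2 ^ n" "wt k > 0" for k
        proof -
          \<comment> \<open>A pullback has length at most D / \<rho> times that of \<open>I\<close>,
            and the weighted masses of the pullbacks over all of \<open>W\<close> add up to the mass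
            of \<open>I\<close>.\<close>
          have JI: "(\<rho> / D * wt k) * (\<Sum>w\<in>Om k. weight w / wt k * j w I) \<le> measure \<nu> {fst I..snd I} * (snd I - fst I)"
            if I: "I \<in> P" for I
          proof -
            have I01: "fst I \<le> snd I" "0 \<le> fst I" "snd I \<le> 1" using P01[OF P(2,4)] I by auto
            have Is: "{fst I..snd I} \<in> sets \<nu>" using I01 by (simp add: sets_nu_iff)
            have vX: "foldr S w -` {fst I..snd I} \<inter> {0..1} = X w I" for w by (auto simp: X_def)
            have "(\<rho> / D * wt k) * (\<Sum>w\<in>Om k. weight w / wt k * j w I) = (\<Sum>w\<in>Om k. weight w * (\<rho> / D * j w I))"
              unfolding sum_distrib_left using k(2) by (intro sum.cong) (auto simp: field_simps)
            also have "\<dots> \<le> (\<Sum>w\<in>Om k. weight w * (measure \<nu> (X w I) * (snd I - fst I)))"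
            proof (intro sum_mono mult_left_mono)
              fix w assume "w \<in> Om k"
              then have w: "w \<in> W" using Om by blast
              show "weight w \<ge> 0" using weight_pos[OF Ww[OF w]] by simp
              show "\<rho> / D * j w I \<le> measure \<nu> (X w I) * (snd I - fst I)"
              proof (cases "X w I = {}")
                case True
                then show ?thesis using I01 by (simp add: j_def)
              next
                case False
                note Xp = X_props[OF w False]
                let ?i = "Inf (X w I)" and ?s = "Sup (X w I)"
                have "\<rho> / D * \<bar>?s - ?i\<bar> \<le> \<bar>foldr S w ?s - foldr S w ?i\<bar>"
                  using Xp(3,4) by (intro W(4)[OF w]) (auto simp: X_def)
                also have "\<dots> \<le> snd I - fst I" using Xp(3,4) by (auto simp: X_def)
                finally have "\<rho> / D * (?s - ?i) \<le> snd I - fst I" using Xp(2) by simp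
                then have "measure \<nu> (X w I) * (\<rho> / D * (?s - ?i)) \<le> measure \<nu> (X w I) * (snd I - fst I)"
                  by (intro mult_left_mono) auto
                then show ?thesis using Xp(1) False by (simp add: j_def mult_ac)
              qed
            qed
            also have "\<dots> = (\<Sum>w\<in>Om k. weight w * measure \<nu> (X w I)) * (snd I - fst I)"
              by (simp add: sum_distrib_right mult.assoc)
            also have "\<dots> \<le> (\<Sum>w\<in>W. weight w * measure \<nu> (X w I)) * (snd I - fst I)"
              using Om[of k] fW I01
              by (intro mult_right_mono sum_mono2) (auto intro!: mult_nonneg_nonneg w0)
            also have "(\<Sum>w\<in>W. weight w * measure \<nu> (X w I)) = measure \<nu> {fst I..snd I}"
              using W(1) Is unfolding cut_set_def vX[symmetric] by auto
            finally show ?thesis .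
          qed
          have cn: "weight w / wt k \<ge> 0" if "w \<in> Om k" for w
            using that Om(1)[of k] w0[of w] k(2) by auto
          have cj: "weight w / wt k * j w I \<ge> 0" if "w \<in> Om k" for w I
            using cn[OF that] j_nonneg[of w I] that Om(1)[of k] by (intro mult_nonneg_nonneg) auto
          have wsum: "(\<Sum>w\<in>Om k. weight w / wt k) = 1"
            using k(2) by (simp add: sum_divide_distrib[symmetric] wt_def)
          have "c = (\<Sum>w\<in>Om k. weight w / wt k * c)" by (simp only: sum_distrib_right[symmetric] wsum mult_1)
          also have "\<dots> \<le> (\<Sum>w\<in>Om k. weight w / wt k * (\<Sum>I\<in>P. j w I powr q))"
            using Om(1)[of k] IH cn by (intro sum_mono mult_left_mono) blast+
          also have "\<dots> = (\<Sum>I\<in>P. \<Sum>w\<in>Om k. weight w / wt k * j w I powr q)"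
            by (simp add: sum_distrib_left) (rule sum.swap)
          also have "\<dots> = (\<Sum>I\<in>Pk k. \<Sum>w\<in>Om k. weight w / wt k * j w I powr q)"
          proof (rule sum.mono_neutral_right[OF P(1)])
            show "Pk k \<subseteq> P" by (auto simp: Pk_def)
            show "\<forall>I\<in>P - Pk k. (\<Sum>w\<in>Om k. weight w / wt k * j w I powr q) = 0"
              by (intro ballI sum.neutral) (auto simp: Pk_def j_def)
          qed
          finally have "(\<rho> / D * wt k) powr q * c \<le> (\<rho> / D * wt k) powr q * (\<Sum>I\<in>Pk k. \<Sum>w\<in>Om k. weight w / wt k * j w I powr q)"
            by (intro mult_left_mono) auto
          also have "\<dots> = (\<Sum>I\<in>Pk k. (\<rho> / D * wt k) powr q * (\<Sum>w\<in>Om k. weight w / wt k * j w I powr q))"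
            by (rule sum_distrib_left)
          also have "\<dots> \<le> (\<Sum>I\<in>Pk k. Jpow q I)"
          proof (rule sum_mono)
            fix I assume "I \<in> Pk k"
            then have I: "I \<in> P" by (simp add: Pk_def)
            have "(\<Sum>w\<in>Om k. weight w / wt k * j w I powr q) \<le> (\<Sum>w\<in>Om k. weight w / wt k * j w I) powr q"
              by (rule powr_weighted_mean_ge[OF q Om(2), where w = "\<lambda>w. weight w / wt k"])
                (use cn wsum j_nonneg Om(1)[of k] in blast)+
            then have "(\<rho> / D * wt k) powr q * (\<Sum>w\<in>Om k. weight w / wt k * j w I powr q) \<le>
               (\<rho> / D * wt k) powr q * (\<Sum>w\<in>Om k. weight w / wt k * j w I) powr q"
              by (intro mult_left_mono) auto
            also have "\<dots> = ((\<rho> / D * wt k) * (\<Sum>w\<in>Om k. weight w / wt k * j w I)) powr q"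
              using \<rho> D k(2) sum_nonneg[OF cj] by (subst powr_mult) auto
            also have "\<dots> \<le> (measure \<nu> {fst I..snd I} * (snd I - fst I)) powr q"
              using \<rho> D k(2) q JI[OF I] sum_nonneg[OF cj]
              by (intro powr_mono2 mult_nonneg_nonneg) auto
            finally show "(\<rho> / D * wt k) powr q * (\<Sum>w\<in>Om k. weight w / wt k * j w I powr q) \<le> Jpow q I"
              by (simp add: Jpow_def case_prod_beta')
          qed
          finally show ?thesis by (simp add: mult_ac)
        qed
        \<comment> \<open>If \<open>I\<close> serves cell k, it meets a piece that touches this cell
          but does not contain that piece. By connectedness the piece contains an endpoint of
          \<open>I\<close>, which confines k to two windows.\<close>
        have mult8: "card {k\<in>{..<2 ^ n}. I \<in> Pk k} \<le> 8" if I: "I \<in> P" for I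
        proof -
          let ?N = "\<lambda>e. {k::nat. e / \<rho> - 2 \<le> real k \<and> real k < e / \<rho> + 1}"
          have "{k\<in>{..<2 ^ n}. I \<in> Pk k} \<subseteq> ?N (fst I) \<union> ?N (snd I)"
          proof
            fix k assume "k \<in> {k\<in>{..<2 ^ n}. I \<in> Pk k}"
            then obtain w x where w: "w \<in> Om k" "x \<in> X w I" by (auto simp: Pk_def)
            then have wW: "w \<in> W" "?im w \<inter> dyadic_cell n k \<noteq> {}" by (auto simp: Om_def)
            have u: "foldr S w x \<in> ?im w" "foldr S w x \<in> {fst I..snd I}" using w(2) by (auto simp: X_def)
            obtain v where v: "v \<in> ?im w" "v \<notin> {fst I..snd I}" 
              using notsub[OF wW(1), of "fst I" "snd I"] I unfolding prod.collapse by blast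
            then have "fst I \<in> ?im w \<or> snd I \<in> ?im w"
              using conn[OF wW(1) v(1) u(1), of "fst I"] conn[OF wW(1) u(1) v(1), of "snd I"] u(2) by auto
            then show "k \<in> ?N (fst I) \<union> ?N (snd I)"
              using near_cell[OF wW(1) _ wW(2)] by auto
          qed
          then have "card {k\<in>{..<2 ^ n}. I \<in> Pk k} \<le> card (?N (fst I) \<union> ?N (snd I))"
            by (intro card_mono) (auto simp: finite_cells_near)
          also have "\<dots> \<le> card (?N (fst I)) + card (?N (snd I))" by (rule card_Un_le)
          finally show ?thesis using card_cells_near_le[of "fst I / \<rho>"] card_cells_near_le[of "snd I / \<rho>"] by linarith
        qed
        have D0: "D powr q > 0" using D by simp
        \<comment> \<open>The factor \<open>D powr q\<close> in \<open>Z\<close> cancels the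
          distortion in \<open>piece\<close>, and the 8 cancels the multiplicity with which a cover
          element serves cells.\<close>
        have "8 * D powr q * (c / D powr q) \<le> (\<Sum>k<2 ^ n. (measure \<nu> (dyadic_cell n k) / 2 ^ n) powr q) * (c / D powr q)"
          using Z c D0 by (intro mult_right_mono) auto
        also have "\<dots> = (\<Sum>k<2 ^ n. c * (\<rho> / D * measure \<nu> (dyadic_cell n k)) powr q)"
          unfolding sum_distrib_right n using D
          by (intro sum.cong) (auto simp: powr_divide powr_mult)
        also have "\<dots> \<le> (\<Sum>k<2 ^ n. \<Sum>I\<in>Pk k. Jpow q I)"
        proof (rule sum_mono)
          fix k :: nat assume "k \<in> {..<2 ^ n}"
          then have k: "k < 2 ^ n" by simp
          show "c * (\<rho> / D * measure \<nu> (dyadic_cell n k)) powr q \<le> (\<Sum>I\<in>Pk k. Jpow q I)"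
          proof (cases "measure \<nu> (dyadic_cell n k) = 0")
            case True
            then show ?thesis by (auto simp: Jpow_def intro!: sum_nonneg)
          next
            case False
            then have pos: "measure \<nu> (dyadic_cell n k) > 0" using measure_nonneg[of \<nu> "dyadic_cell n k"] by linarith
            have "c * (\<rho> / D * measure \<nu> (dyadic_cell n k)) powr q \<le> c * (\<rho> / D * wt k) powr q"
              using c \<rho> D q wt[OF k] by (intro mult_left_mono powr_mono2) auto
            also have "\<dots> \<le> (\<Sum>I\<in>Pk k. Jpow q I)" using piece[OF k] pos wt[OF k] by linarith
            finally show ?thesis .
          qed
        qed
        also have "\<dots> = (\<Sum>k<2 ^ n. \<Sum>I\<in>P. if I \<in> Pk k then Jpow q I else 0)"
        proof (rule sum.cong[OF refl])
          fix k
          have "(\<Sum>I\<in>Pk k. Jpow q I) = (\<Sum>I\<in>{I\<in>P. I \<in> Pk k}. Jpow q I)"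
            by (rule sum.cong) (auto simp: Pk_def)
          also have "\<dots> = (\<Sum>I\<in>P. if I \<in> Pk k then Jpow q I else 0)" by (rule sum.inter_filter[OF P(1)])
          finally show "(\<Sum>I\<in>Pk k. Jpow q I) = (\<Sum>I\<in>P. if I \<in> Pk k then Jpow q I else 0)" .
        qed
        also have "\<dots> = (\<Sum>I\<in>P. \<Sum>k<2 ^ n. if I \<in> Pk k then Jpow q I else 0)" by (rule sum.swap)
        also have "\<dots> = (\<Sum>I\<in>P. real (card {k\<in>{..<2 ^ n}. I \<in> Pk k}) * Jpow q I)"
          by (intro sum.cong refl) (simp add: sum.inter_filter[symmetric])
        also have "\<dots> \<le> (\<Sum>I\<in>P. 8 * Jpow q I)"
        proof (intro sum_mono mult_right_mono)
          show "real (card {k\<in>{..<2 ^ n}. I \<in> Pk k}) \<le> 8" if "I \<in> P" for I using mult8[OF that] by linarith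
        qed (auto simp: Jpow_def)
        finally have "8 * c \<le> 8 * (\<Sum>I\<in>P. Jpow q I)" using D0 by (simp add: sum_distrib_left)
        then show False using contr by simp
      qed
    }
  qed
  have "c \<le> (\<Sum>I\<in>P. Jpow q I)" if "separated_cover N F P" for N F P
    using that unfolding separated_cover_def by (elim conjE) (rule main)
  with c show ?thesis by blast
qed

end

section \<open>Heavy closed cells and the eigenvalue count\<close>

context unit_interval_measure
begin

text \<open>Closed cells fit the lower bound: they are the plateaus of the tents, and unlike the
  half-open cells of one level they cover the point 0.\<close>

definition heavy_closed_cells :: "real \<Rightarrow> (nat \<times> nat) set" where
  "heavy_closed_cells t = {(n, k). k < 2 ^ n \<and> t \<le> measure \<nu> (closed_cell n k) / 2 ^ n}"

lemma heavy_closed_cells_level: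
  assumes "1 / 2 ^ L < t" "(n, k) \<in> heavy_closed_cells t"
  shows "n < L"
proof (rule ccontr)
  assume "\<not> n < L"
  then have "(2::real) ^ L \<le> 2 ^ n" by (intro power_increasing) auto
  have "t \<le> measure \<nu> (closed_cell n k) / 2 ^ n" using assms by (auto simp: heavy_closed_cells_def)
  also have "\<dots> \<le> 1 / 2 ^ n" by (intro divide_right_mono) auto
  also have "\<dots> \<le> 1 / 2 ^ L" using \<open>2 ^ L \<le> 2 ^ n\<close> by (intro divide_left_mono) auto
  finally show False using assms(1) by simp
qed

lemma finite_level_set:
  fixes H :: "(nat \<times> nat) set"
  assumes "\<And>n k. (n, k) \<in> H \<Longrightarrow> n < L \<and> k < 2 ^ n"
  shows "finite H" "card H = (\<Sum>n<L. card {k. (n, k) \<in> H})"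
proof -
  have H: "H = Sigma {..<L} (\<lambda>n. {k. (n, k) \<in> H})" using assms by auto
  have fin: "finite {k. (n, k) \<in> H}" for n
    by (rule finite_subset[of _ "{..<2 ^ n}"]) (use assms in auto)
  show "finite H" by (subst H) (auto intro: fin)
  have "card H = card (Sigma {..<L} (\<lambda>n. {k. (n, k) \<in> H}))" using H by simp
  also have "\<dots> = (\<Sum>n<L. card {k. (n, k) \<in> H})" using fin by simp
  finally show "card H = (\<Sum>n<L. card {k. (n, k) \<in> H})" .
qed

lemma finite_heavy_closed_cells:
  assumes "t > 0"
  shows "finite (heavy_closed_cells t)"
proof -
  obtain L where L: "1 / 2 ^ L < t" using exists_inverse_power_less[OF assms] by blast
  show ?thesis
    by (rule finite_level_set(1)[of _ L])
      (use heavy_closed_cells_level[OF L] in \<open>auto simp: heavy_closed_cells_def\<close>)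
qed

text \<open>Indices in one residue class modulo 3 are far enough apart for the tents; the summand 2
  accounts for the first and the last cell of the level.\<close>

lemma card_heavy_closed_level_le:
  assumes t: "t > 0"
  shows "card {k. (n, k) \<in> heavy_closed_cells t} \<le> 3 * eigenvalue_count \<nu> (2 / t) + 2"
proof -
  define K where "K = {k. (n, k) \<in> heavy_closed_cells t}"
  define R where "R r = {k\<in>K. 1 \<le> k \<and> k + 2 \<le> 2 ^ n \<and> k mod 3 = r}" for r :: nat
  have fK: "finite K" unfolding K_def
    by (rule finite_subset[of _ "{..<2 ^ n}"]) (auto simp: heavy_closed_cells_def)
  have R: "card (R r) \<le> eigenvalue_count \<nu> (2 / t)" for r
  proof (rule card_le_eigenvalue_count_tents[OF t, of _ n])
    show "finite (R r)" using fK by (simp add: R_def)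
    show "t \<le> measure \<nu> (closed_cell n k) / 2 ^ n" if "k \<in> R r" for k
      using that by (auto simp: R_def K_def heavy_closed_cells_def)
    show "k + 3 \<le> j" if "k \<in> R r" "j \<in> R r" "k < j" for k j
    proof -
      have "k mod 3 = j mod 3" using that by (auto simp: R_def)
      then have "3 dvd j - k" using \<open>k < j\<close> mod_eq_dvd_iff_nat[of k j 3] by simp
      then have "3 \<le> j - k" using \<open>k < j\<close> by (intro dvd_imp_le) auto
      then show ?thesis by simp
    qed
  qed (auto simp: R_def)
  have "K \<subseteq> R 0 \<union> R 1 \<union> R 2 \<union> {0, 2 ^ n - 1}"
  proof
    fix k assume k: "k \<in> K"
    have "k mod 3 < 3" by simp
    then have "k mod 3 = 0 \<or> k mod 3 = 1 \<or> k mod 3 = 2" by linarith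
    moreover have "k < 2 ^ n" using k by (auto simp: K_def heavy_closed_cells_def)
    ultimately show "k \<in> R 0 \<union> R 1 \<union> R 2 \<union> {0, 2 ^ n - 1}" using k unfolding R_def by auto
  qed
  then have "card K \<le> card (R 0 \<union> R 1 \<union> R 2 \<union> {0, 2 ^ n - 1})"
    using fK by (intro card_mono) (auto simp: R_def)
  also have "\<dots> \<le> card (R 0) + card (R 1) + card (R 2) + card {0, 2 ^ n - 1 :: nat}"
    by (intro order_trans[OF card_Un_le] add_mono order_refl)
  also have "card {0, 2 ^ n - 1 :: nat} \<le> 2" by (rule order_trans[OF card_insert_le_m1]) auto
  finally show ?thesis using R[of 0] R[of 1] R[of 2] by (simp add: K_def)
qed

text \<open>Heavy cells occupy only logarithmically many levels; this is the origin of the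
  logarithmic factors.\<close>

lemma exists_level_bound:
  assumes "0 < t" "t \<le> 1"
  obtains L :: nat where "1 / 2 ^ L < t" "real L \<le> log 2 (1 / t) + 1"
proof
  define L where "L = nat \<lfloor>log 2 (1 / t)\<rfloor> + 1"
  have l0: "log 2 (1 / t) \<ge> 0" using assms by (simp add: zero_le_log_cancel_iff)
  have L: "log 2 (1 / t) < real L" "real L \<le> log 2 (1 / t) + 1" using l0 unfolding L_def by linarith+
  then show "real L \<le> log 2 (1 / t) + 1" by blast
  have "1 / t < 2 powr real L" using L(1) assms by (subst (asm) log_less_iff) auto
  then show "1 / 2 ^ L < t" using assms by (simp add: powr_realpow field_simps)
qed

lemma card_heavy_closed_cells_le:
  assumes t: "0 < t" "t \<le> 1"
  shows "real (card (heavy_closed_cells t)) \<le> (log 2 (1 / t) + 1) * (3 * real (eigenvalue_count \<nu> (2 / t)) + 2)"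
proof -
  obtain L where L: "1 / 2 ^ L < t" "real L \<le> log 2 (1 / t) + 1" using exists_level_bound[OF t] .
  have "card (heavy_closed_cells t) = (\<Sum>n<L. card {k. (n, k) \<in> heavy_closed_cells t})"
    by (rule finite_level_set(2))
      (use heavy_closed_cells_level[OF L(1)] in \<open>auto simp: heavy_closed_cells_def\<close>)
  also have "\<dots> \<le> (\<Sum>n<L. 3 * eigenvalue_count \<nu> (2 / t) + 2)"
    by (intro sum_mono card_heavy_closed_level_le t)
  also have "\<dots> = L * (3 * eigenvalue_count \<nu> (2 / t) + 2)" by simp
  finally have "real (card (heavy_closed_cells t)) \<le> real (L * (3 * eigenvalue_count \<nu> (2 / t) + 2))"
    by (rule of_nat_mono)
  also have "\<dots> = real L * (3 * real (eigenvalue_count \<nu> (2 / t)) + 2)" by (simp add: algebra_simps)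
  also have "\<dots> \<le> (log 2 (1 / t) + 1) * (3 * real (eigenvalue_count \<nu> (2 / t)) + 2)"
    using L(2) by (intro mult_right_mono) auto
  finally show ?thesis .
qed

section \<open>Partition sums and their critical exponents\<close>

text \<open>Uncharged cells contribute \<open>0 powr q = 0\<close>, even for q = 0, so summing over
  all cells agrees with summing over the charged ones.\<close>

definition partition_sum :: "nat \<Rightarrow> real \<Rightarrow> real" where
  "partition_sum n q = (\<Sum>k<2 ^ n. (measure \<nu> (dyadic_cell n k) / 2 ^ n) powr q)"

lemma partition_term_le: "measure \<nu> (dyadic_cell n k) / 2 ^ n \<le> 1 / 2 ^ n"
  by (intro divide_right_mono) auto

lemma inj_dyadic_cell: "inj (dyadic_cell n)"
proof (rule injI)
  fix k j assume eq: "dyadic_cell n k = dyadic_cell n j"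
  have mem: "real (k + 1) / 2 ^ n \<in> dyadic_cell n k" for k
    by (auto simp: dyadic_cell_def divide_strict_right_mono)
  have le: "k \<le> j" if "real (k + 1) / 2 ^ n \<in> dyadic_cell n j" for k j
  proof -
    have "real (k + 1) / 2 ^ n \<le> real (j + 1) / 2 ^ n" using that by (simp add: dyadic_cell_def)
    then show ?thesis by (simp add: divide_le_cancel)
  qed
  show "k = j" using le[OF mem[of k, unfolded eq]] le[OF mem[of j, folded eq]] by (rule antisym)
qed

text \<open>The factor \<open>2 powr (n * q)\<close> is what turns the equation
  \<open>Lq_beta \<nu> n q = q\<close> into \<open>partition_sum n q = 1\<close>. Since
  \<open>charged_cells\<close> is a set of sets, injectivity of the indexing is needed.\<close>

lemma charged_cells_sum:
  "(\<Sum>C\<in>charged_cells \<nu> n. measure \<nu> C powr q) = 2 powr (real n * q) * partition_sum n q"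
proof -
  let ?K = "{k. k < 2 ^ n \<and> measure \<nu> (dyadic_cell n k) > 0}"
  have "charged_cells \<nu> n = dyadic_cell n ` ?K" by (auto simp: charged_cells_def)
  moreover have "inj_on (dyadic_cell n) ?K" using inj_dyadic_cell by (rule inj_on_subset) simp
  ultimately have "(\<Sum>C\<in>charged_cells \<nu> n. measure \<nu> C powr q) = (\<Sum>k\<in>?K. measure \<nu> (dyadic_cell n k) powr q)"
    by (simp add: sum.reindex)
  also have "\<dots> = (\<Sum>k<2 ^ n. measure \<nu> (dyadic_cell n k) powr q)"
  proof (rule sum.mono_neutral_left)
    show "\<forall>k\<in>{..<2 ^ n} - ?K. measure \<nu> (dyadic_cell n k) powr q = 0"
    proof
      fix k assume "k \<in> {..<2 ^ n} - ?K"
      then have "\<not> measure \<nu> (dyadic_cell n k) > 0" by simp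
      then have "measure \<nu> (dyadic_cell n k) = 0" by (simp add: zero_less_measure_iff)
      then show "measure \<nu> (dyadic_cell n k) powr q = 0" by simp
    qed
  qed auto
  also have "\<dots> = 2 powr (real n * q) * partition_sum n q"
    unfolding partition_sum_def sum_distrib_left
  proof (rule sum.cong[OF refl])
    fix k
    have "((2::real) ^ n) powr q = 2 powr (real n * q)" by (simp add: powr_realpow[symmetric] powr_powr)
    then show "measure \<nu> (dyadic_cell n k) powr q = 2 powr (real n * q) * (measure \<nu> (dyadic_cell n k) / 2 ^ n) powr q"
      by (simp add: powr_divide)
  qed
  finally show ?thesis .
qed

lemma partition_sum_antimono:
  assumes "q \<le> q'"
  shows "partition_sum n q' \<le> partition_sum n q"
  unfolding partition_sum_def
proof (rule sum_mono)
  fix k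
  let ?x = "measure \<nu> (dyadic_cell n k) / 2 ^ n"
  have "?x \<le> 1" using partition_term_le[of n k] by (rule order_trans) (simp add: divide_le_eq)
  then show "?x powr q' \<le> ?x powr q" using assms by (intro powr_mono') auto
qed

text \<open>Each term is at most 2^(-n), so lowering the exponent multiplies it by at least
  \<open>2 powr (n * (q' - q))\<close>. This gives uniqueness of the fixed point, and later the
  exponential gain that pays for distortion.\<close>

lemma partition_sum_ge:
  assumes "q \<le> q'"
  shows "2 powr (real n * (q' - q)) * partition_sum n q' \<le> partition_sum n q"
  unfolding partition_sum_def sum_distrib_left
proof (rule sum_mono)
  fix k
  let ?x = "measure \<nu> (dyadic_cell n k) / 2 ^ n"
  show "2 powr (real n * (q' - q)) * ?x powr q' \<le> ?x powr q"
  proof (cases "measure \<nu> (dyadic_cell n k) = 0")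
    case False
    then have x: "?x > 0" by (simp add: zero_less_measure_iff)
    have "?x powr (q' - q) \<le> (1 / 2 ^ n) powr (q' - q)"
      using partition_term_le x assms by (intro powr_mono2) auto
    also have "\<dots> = 2 powr (- (real n * (q' - q)))"
      by (simp add: powr_divide powr_realpow[symmetric] powr_powr powr_minus_divide)
    finally have "2 powr (real n * (q' - q)) * ?x powr (q' - q) \<le> 2 powr (real n * (q' - q)) * 2 powr (- (real n * (q' - q)))"
      by (intro mult_left_mono) auto
    also have "\<dots> = 1" by (simp add: powr_add[symmetric])
    finally have "2 powr (real n * (q' - q)) * ?x powr (q' - q) * ?x powr q \<le> 1 * ?x powr q"
      by (intro mult_right_mono) auto
    moreover have "?x powr (q' - q) * ?x powr q = ?x powr q'" by (simp add: powr_add[symmetric])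
    ultimately show ?thesis by (simp only: mult.assoc mult_1)
  qed simp
qed

lemma sum_dyadic_cells: "(\<Sum>k<2 ^ n. measure \<nu> (dyadic_cell n k)) = measure \<nu> {0<..1}"
proof -
  have disj: "dyadic_cell n k \<inter> dyadic_cell n j = {}" if "k \<noteq> j" for k j
  proof -
    have "{real k / 2 ^ n<..real (k + 1) / 2 ^ n} \<inter> {real j / 2 ^ n<..real (j + 1) / 2 ^ n} = {}" if "k < j" for k j
    proof -
      have "real (k + 1) / 2 ^ n \<le> real j / 2 ^ n" using that by (intro divide_right_mono) auto
      then show ?thesis by auto
    qed
    then show ?thesis using \<open>k \<noteq> j\<close> unfolding dyadic_cell_def by (metis Int_commute linorder_neqE_nat)
  qed
  have "(\<Sum>k<2 ^ n. measure \<nu> (dyadic_cell n k)) = measure \<nu> (\<Union>k<2 ^ n. dyadic_cell n k)"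
    using disj dyadic_cell_sets by (intro finite_measure_finite_Union[symmetric]) (auto simp: disjoint_family_on_def)
  also have "(\<Union>k<2 ^ n. dyadic_cell n k) = {0<..1}"
  proof (intro equalityI subsetI)
    fix x assume "x \<in> (\<Union>k<2 ^ n. dyadic_cell n k)"
    then obtain k where k: "k < 2 ^ n" "x \<in> dyadic_cell n k" by auto
    have "0 < x" using le_less_trans[of 0 "real k / 2 ^ n" x] k(2) by (simp add: dyadic_cell_def)
    moreover have "x \<le> 1" using subsetD[OF dyadic_cell_subset[OF k(1)] k(2)] by simp
    ultimately show "x \<in> {0<..1}" by simp
  next
    fix x :: real assume x: "x \<in> {0<..1}"
    define y where "y = 2 ^ n * x"
    have y: "0 < y" "y \<le> 2 ^ n" using x by (auto simp: y_def)
    define k where "k = nat (\<lceil>y\<rceil> - 1)"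
    have c: "\<lceil>y\<rceil> \<ge> 1" using y by linarith
    have "real k < y" "y \<le> real k + 1" using c unfolding k_def by linarith+
    moreover from this have "real k < 2 ^ n" using y by linarith
    then have "k < 2 ^ n" by (metis of_nat_less_iff of_nat_numeral of_nat_power)
    ultimately have "x \<in> dyadic_cell n k" by (auto simp: dyadic_cell_def y_def field_simps)
    then show "x \<in> (\<Union>k<2 ^ n. dyadic_cell n k)" using \<open>k < 2 ^ n\<close> by auto
  qed
  finally show ?thesis .
qed

text \<open>The sum is at least 1 at q = 0 because some cell is charged, which is what
  \<open>pos\<close> ensures, and at most 1 at q = 1. Continuity and strict monotonicity then give
  exactly one solution, and it lies in [0,1].\<close>

lemma Lq_fixed_point_props:
  assumes pos: "measure \<nu> {0<..1} > 0" and n: "n \<ge> 1"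
  shows "0 \<le> Lq_fixed_point \<nu> n" "Lq_fixed_point \<nu> n \<le> 1" "partition_sum n (Lq_fixed_point \<nu> n) = 1"
proof -
  let ?x = "\<lambda>k. measure \<nu> (dyadic_cell n k) / 2 ^ n"
  have "\<exists>k<2 ^ n. measure \<nu> (dyadic_cell n k) > 0"
  proof (rule ccontr)
    assume "\<not> ?thesis"
    then have "(\<Sum>k<2 ^ n. measure \<nu> (dyadic_cell n k)) \<le> 0"
      by (intro sum_nonpos) (meson lessThan_iff not_le)
    then show False using pos sum_dyadic_cells[of n] by simp
  qed
  then obtain k0 where k0: "k0 < 2 ^ n" "measure \<nu> (dyadic_cell n k0) > 0" by blast
  have pp: "partition_sum n q > 0" for q
    unfolding partition_sum_def using k0 by (intro sum_pos2[of _ k0]) auto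
  have iff: "Lq_beta \<nu> n q = q \<longleftrightarrow> partition_sum n q = 1" for q
  proof -
    have l: "ln (2 ^ n) > (0::real)" using n by (simp add: ln_realpow)
    have "ln (\<Sum>C\<in>charged_cells \<nu> n. measure \<nu> C powr q) = q * ln (2 ^ n) + ln (partition_sum n q)"
      unfolding charged_cells_sum using pp[of q] by (simp add: ln_mult ln_powr ln_realpow)
    then have "Lq_beta \<nu> n q = q + ln (partition_sum n q) / ln (2 ^ n)"
      unfolding Lq_beta_def using l by (simp add: field_simps)
    then show ?thesis using l pp[of q] by auto
  qed
  have p0: "partition_sum n 0 \<ge> 1"
  proof -
    have "?x k0 powr 0 \<le> partition_sum n 0"
      unfolding partition_sum_def using k0 by (intro member_le_sum) auto
    then show ?thesis using k0 by simp
  qed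
  have p1: "partition_sum n 1 \<le> 1"
  proof -
    have "partition_sum n 1 = (\<Sum>k<2 ^ n. measure \<nu> (dyadic_cell n k)) / 2 ^ n"
      unfolding partition_sum_def by (simp add: sum_divide_distrib)
    also have "\<dots> = measure \<nu> {0<..1} / 2 ^ n" by (simp add: sum_dyadic_cells)
    also have "\<dots> \<le> 1 / 1" by (intro frac_le) auto
    finally show ?thesis by simp
  qed
  have "continuous_on {0..1} (partition_sum n)"
    unfolding partition_sum_def
  proof (intro continuous_on_sum)
    fix k show "continuous_on {0..1} (\<lambda>q. ?x k powr q)"
      by (cases "?x k = 0") (auto intro!: continuous_intros)
  qed
  then obtain q where q: "0 \<le> q" "q \<le> 1" "partition_sum n q = 1"
    using IVT2'[of "partition_sum n" 1 1 0] p0 p1 by auto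
  have unique: "q' = q" if "partition_sum n q' = 1" for q'
  proof -
    have strict: "partition_sum n b < partition_sum n a" if "a < b" for a b
    proof -
      have "1 < 2 powr (real n * (b - a))" using that n powr_less_mono[of 0 "real n * (b - a)" 2] by simp
      then have "partition_sum n b < 2 powr (real n * (b - a)) * partition_sum n b" using pp[of b] by simp
      then show ?thesis using partition_sum_ge[of a b n] that by simp
    qed
    show ?thesis
    proof (rule ccontr)
      assume "q' \<noteq> q"
      then consider "q < q'" | "q' < q" by linarith
      then show False by cases (use strict[of q q'] strict[of q' q] that q(3) in auto)
    qed
  qed
  have "Lq_fixed_point \<nu> n = q"
    unfolding Lq_fixed_point_def iff by (rule the_equality) (use q unique in blast)+
  then show "0 \<le> Lq_fixed_point \<nu> n" "Lq_fixed_point \<nu> n \<le> 1" "partition_sum n (Lq_fixed_point \<nu> n) = 1"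
    using q by auto
qed

text \<open>Markov's inequality on each level: the number of heavy cells times
  \<open>t powr q\<close> is at most the partition sum. Levels below \<open>n0\<close> contribute at
  most \<open>2 ^ n0\<close> each, and levels from \<open>L\<close> on have no heavy cells.\<close>

lemma card_heavy_cells_le:
  assumes t: "0 < t" "t \<le> 1" and q: "0 \<le> q" and n0: "\<And>n. n \<ge> n0 \<Longrightarrow> partition_sum n q \<le> 1"
  shows "real (card (heavy_cells t)) \<le> real n0 * 2 ^ n0 + (log 2 (1 / t) + 1) * (1 / t) powr q"
proof -
  obtain L where L: "1 / 2 ^ L < t" "real L \<le> log 2 (1 / t) + 1" using exists_level_bound[OF t] .
  have level: "real (card {k. (n, k) \<in> heavy_cells t}) \<le> (1 / t) powr q" if "n \<ge> n0" for n
  proof -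
    let ?K = "{k. (n, k) \<in> heavy_cells t}"
    have K: "?K \<subseteq> {..<2 ^ n}" by (auto simp: heavy_cells_def)
    have "real (card ?K) * t powr q = (\<Sum>k\<in>?K. t powr q)" by simp
    also have "\<dots> \<le> (\<Sum>k\<in>?K. (measure \<nu> (dyadic_cell n k) / 2 ^ n) powr q)"
      using t q by (intro sum_mono powr_mono2) (auto simp: heavy_cells_def)
    also have "\<dots> \<le> partition_sum n q"
      unfolding partition_sum_def using K by (intro sum_mono2) auto
    also have "\<dots> \<le> 1" by (rule n0[OF that])
    finally show ?thesis using t by (simp add: powr_divide field_simps)
  qed
  have level0: "real (card {k. (n, k) \<in> heavy_cells t}) \<le> 2 ^ n0" if "n < n0" for n
  proof -
    have "card {k. (n, k) \<in> heavy_cells t} \<le> card {..<2 ^ n :: nat}"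
      by (intro card_mono) (auto simp: heavy_cells_def)
    then have "real (card {k. (n, k) \<in> heavy_cells t}) \<le> 2 ^ n"
      by (metis card_lessThan of_nat_le_iff of_nat_numeral of_nat_power)
    also have "\<dots> \<le> 2 ^ n0" using that by (intro power_increasing) auto
    finally show ?thesis .
  qed
  have "real (card (heavy_cells t)) = (\<Sum>n<L. real (card {k. (n, k) \<in> heavy_cells t}))"
    by (subst finite_level_set(2)[of "heavy_cells t" L])
      (use heavy_cells_level[OF t(1) L(1)] in \<open>auto simp: heavy_cells_def\<close>)
  also have "\<dots> \<le> (\<Sum>n<L. (if n < n0 then 2 ^ n0 else 0) + (1 / t) powr q)"
  proof (rule sum_mono)
    fix n
    have "(1 / t) powr q \<ge> 0" by simp
    then show "real (card {k. (n, k) \<in> heavy_cells t}) \<le> (if n < n0 then 2 ^ n0 else 0) + (1 / t) powr q"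
    proof (cases "n < n0")
      case True
      then show ?thesis using level0[OF True] \<open>(1 / t) powr q \<ge> 0\<close> by (simp only: True if_True)
    next
      case False
      then show ?thesis using level[of n] by simp
    qed
  qed
  also have "\<dots> = (\<Sum>n<L. if n < n0 then 2 ^ n0 else 0) + real L * (1 / t) powr q"
    by (simp add: sum.distrib)
  also have "(\<Sum>n<L. if n < n0 then 2 ^ n0 else 0) \<le> (\<Sum>n<n0. 2 ^ n0 :: real)"
  proof -
    have "(\<Sum>n<L. if n < n0 then 2 ^ n0 else 0) = (\<Sum>n\<in>{..<L} \<inter> {..<n0}. 2 ^ n0 :: real)"
      by (simp add: sum.If_cases Int_def)
    also have "\<dots> \<le> (\<Sum>n<n0. 2 ^ n0)" by (intro sum_mono2) auto
    finally show ?thesis .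
  qed
  also have "real L * (1 / t) powr q \<le> (log 2 (1 / t) + 1) * (1 / t) powr q"
    using L(2) by (intro mult_right_mono) auto
  finally show ?thesis by simp
qed

lemma ln_ratio_le:
  assumes "x > 1" "q \<ge> 0" "real N \<le> x powr q"
  shows "ln (real N) / ln x \<le> q"
\<comment> \<open>For \<open>N = 0\<close> the quotient is 0, by the convention
  \<open>ln 0 = 0\<close>.\<close>
proof (cases "N = 0")
  case False
  then have "ln (real N) \<le> ln (x powr q)" using assms by (subst ln_le_cancel_iff) auto
  then show ?thesis using assms by (simp add: ln_powr field_simps)
qed (use assms in simp)

lemma ln_ratio_ge:
  assumes "x > 1" "x powr q \<le> real N"
  shows "q \<le> ln (real N) / ln x"
proof -
  have "0 < x powr q" using assms by simp
  then have "ln (x powr q) \<le> ln (real N)" using assms(2) by (intro ln_mono)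
  then show ?thesis using assms by (simp add: ln_powr field_simps)
qed

lemma upper_spectral_dim_le:
  assumes pos: "measure \<nu> {0<..1} > 0"
  shows "upper_spectral_dim \<nu> \<le> Lq_upper_fixed_point \<nu>"
proof (rule dense_ge)
  fix y assume y: "Lq_upper_fixed_point \<nu> < y"
  then obtain q :: real where q: "Lq_upper_fixed_point \<nu> < ereal q" "ereal q < y" using ereal_dense2 by blast
  \<comment> \<open>At \<open>q1\<close> the partition sums are eventually at most 1, and the gap
    between \<open>q1\<close> and \<open>q\<close> absorbs the logarithmic factor.\<close>
  from q(1) obtain q1 :: real where q1: "Lq_upper_fixed_point \<nu> < ereal q1" "ereal q1 < ereal q" using ereal_dense2 by blast
  have "\<forall>\<^sub>F n in sequentially. ereal (Lq_fixed_point \<nu> n) < ereal q1"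
    using q1(1) unfolding Lq_upper_fixed_point_def by (rule Limsup_lessD)
  then obtain n1 where n1: "\<And>n. n \<ge> n1 \<Longrightarrow> Lq_fixed_point \<nu> n < q1" by (auto simp: eventually_sequentially)
  define n0 where "n0 = max n1 1"
  have q10: "0 < q1" using n1[of n0] Lq_fixed_point_props(1)[OF pos, of n0] by (auto simp: n0_def)
  have Z: "partition_sum n q1 \<le> 1" if "n \<ge> n0" for n
    using partition_sum_antimono[of "Lq_fixed_point \<nu> n" q1 n] n1[of n] that Lq_fixed_point_props(3)[OF pos, of n]
    by (simp add: n0_def)
  have qq: "0 < q1" "q1 < q" using q10 q1(2) by auto
  have bound: "real (eigenvalue_count \<nu> x) \<le> real n0 * 2 ^ n0 + (log 2 (2 * x) + 1) * (2 * x) powr q1" if "x \<ge> 1" for x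
  proof -
    \<comment> \<open>The factor 2 makes \<open>t * x\<close> equal to 1/2, below the admissible
      limit 1.\<close>
    have "eigenvalue_count \<nu> x \<le> card (heavy_cells (1 / (2 * x)))"
      by (rule eigenvalue_count_le_card_heavy_cells(1)) (use that in auto)
    then have "real (eigenvalue_count \<nu> x) \<le> real (card (heavy_cells (1 / (2 * x))))" by simp
    also have "\<dots> \<le> real n0 * 2 ^ n0 + (log 2 (1 / (1 / (2 * x))) + 1) * (1 / (1 / (2 * x))) powr q1"
      by (rule card_heavy_cells_le[OF _ _ less_imp_le[OF qq(1)] Z]) (use that in auto)
    finally show ?thesis by simp
  qed
  have "\<forall>\<^sub>F x in at_top. C + (log 2 (2 * x) + 1) * (2 * x) powr q1 \<le> x powr q" for C :: real
    using qq unfolding log_def by real_asymp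
  from this[of "real n0 * 2 ^ n0"] have "\<forall>\<^sub>F x in at_top. ereal (ln (real (eigenvalue_count \<nu> x)) / ln x) \<le> y"
    using eventually_gt_at_top[of 1]
  proof eventually_elim
    case (elim x)
    have "ln (real (eigenvalue_count \<nu> x)) / ln x \<le> q"
      by (rule ln_ratio_le) (use elim bound[of x] qq in auto)
    then show ?case using q(2) by (meson ereal_less_eq(3) less_imp_le order_trans)
  qed
  then show "upper_spectral_dim \<nu> \<le> y" unfolding upper_spectral_dim_def by (rule Limsup_bounded)
qed

end

section \<open>The lower bound at all scales from one good level\<close>

context self_conformal
begin

text \<open>Descend from the unit cell through heavy cells and stop at the first cell that is not
  heavy. These leaves cover [0,1], each contributes at most \<open>t powr q\<close>, and apart from
  the root each is one of the two children of a heavy cell.\<close>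

lemma heavy_closed_cells_lower_bound:
  assumes q: "q > 0" and t: "t > 0"
    and c: "\<And>N F P. separated_cover N F P \<Longrightarrow> c \<le> (\<Sum>I\<in>P. Jpow q I)"
  shows "c \<le> (1 + 2 * real (card (heavy_closed_cells t))) * t powr q"
proof -
  let ?H = "heavy_closed_cells t"
  obtain L where L: "1 / 2 ^ L < t" using exists_inverse_power_less[OF t] by blast
  \<comment> \<open>All endpoints of leaves are multiples of 2^(-L), hence separated by more than
    \<open>lam ^ N\<close>. The constant \<open>c\<close> does not depend on \<open>N\<close>, so no
    uniformity in t is lost.\<close>
  obtain N where N: "lam ^ N < 1 / 2 ^ L" using real_arch_pow_inv[of "1 / 2 ^ L" lam] lam by auto
  note level = heavy_closed_cells_level[OF L]
  define Lf where "Lf = {(n, k). k < 2 ^ n \<and> n \<le> L \<and> (n, k) \<notin> ?H \<and> (n = 0 \<or> (n - 1, k div 2) \<in> ?H)}"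
  define e where "e = (\<lambda>(n, k). (real k / 2 ^ n, real (k + 1) / 2 ^ n) :: real \<times> real)"
  define F where "F = {real m / 2 ^ L | m. 0 < m \<and> m < 2 ^ L}"
  have fH: "finite ?H" by (rule finite_heavy_closed_cells[OF t])
  have sub: "Lf \<subseteq> insert (0, 0) ((\<lambda>(m, j). (m + 1, 2 * j)) ` ?H \<union> (\<lambda>(m, j). (m + 1, 2 * j + 1)) ` ?H)"
  proof
    fix x assume "x \<in> Lf"
    then obtain n k where nk: "x = (n, k)" "k < 2 ^ n" "n = 0 \<or> (n - 1, k div 2) \<in> ?H" by (auto simp: Lf_def)
    show "x \<in> insert (0, 0) ((\<lambda>(m, j). (m + 1, 2 * j)) ` ?H \<union> (\<lambda>(m, j). (m + 1, 2 * j + 1)) ` ?H)"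
    proof (cases "n = 0")
      case True
      then show ?thesis using nk by simp
    next
      case False
      then have H: "(n - 1, k div 2) \<in> ?H" using nk by blast
      have "x = (\<lambda>(m, j). (m + 1, 2 * j)) (n - 1, k div 2) \<or> x = (\<lambda>(m, j). (m + 1, 2 * j + 1)) (n - 1, k div 2)"
        using nk(1) False by (cases "even k") auto
      then show ?thesis using H by blast
    qed
  qed
  have fLf: "finite Lf" by (rule finite_subset[OF sub]) (use fH in auto)
  have "card Lf \<le> card (insert (0, 0) ((\<lambda>(m, j). (m + 1, 2 * j)) ` ?H \<union> (\<lambda>(m, j). (m + 1, 2 * j + 1)) ` ?H))"
    using fH by (intro card_mono[OF _ sub]) auto
  also have "\<dots> \<le> Suc (card ((\<lambda>(m, j). (m + 1, 2 * j)) ` ?H \<union> (\<lambda>(m, j). (m + 1, 2 * j + 1)) ` ?H))"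
    using fH by (simp add: card_insert_if)
  also have "\<dots> \<le> Suc (card ?H + card ?H)"
    by (intro Suc_leI le_imp_less_Suc order_trans[OF card_Un_le] add_mono card_image_le fH)
  finally have cLf: "real (card Lf) \<le> 1 + 2 * real (card ?H)" by linarith
  have "c \<le> (\<Sum>I\<in>e ` Lf. Jpow q I)"
  proof (rule c[of N F], unfold separated_cover_def, intro conjI)
    show "finite (e ` Lf)" using fLf by simp
    show "F \<subseteq> {0<..<1}" by (auto simp: F_def)
    show "\<forall>x\<in>F. \<forall>y\<in>F. x \<noteq> y \<longrightarrow> lam ^ N \<le> \<bar>x - y\<bar>"
    proof (intro ballI impI)
      fix x y assume "x \<in> F" "y \<in> F" "x \<noteq> y"
      then obtain m m' where m: "x = real m / 2 ^ L" "y = real m' / 2 ^ L" "m \<noteq> m'" by (auto simp: F_def)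
      have "1 \<le> \<bar>real m - real m'\<bar>" using m(3) by linarith
      then have "1 / 2 ^ L \<le> \<bar>real m - real m'\<bar> / 2 ^ L" by (intro divide_right_mono) auto
      also have "\<dots> = \<bar>x - y\<bar>" unfolding m by (simp add: diff_divide_distrib[symmetric])
      finally show "lam ^ N \<le> \<bar>x - y\<bar>" using N by linarith
    qed
    have endp: "real k / 2 ^ n \<in> F \<union> {0, 1}" if "k \<le> 2 ^ n" "n \<le> L" for k n
    proof -
      define m where "m = k * 2 ^ (L - n)"
      have "(2::real) ^ L = 2 ^ n * 2 ^ (L - n)" using that by (simp flip: power_add)
      then have eq: "real k / 2 ^ n = real m / 2 ^ L" by (simp add: m_def)
      have "m \<le> 2 ^ n * 2 ^ (L - n)" unfolding m_def using that by (intro mult_right_mono) auto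
      also have "\<dots> = 2 ^ L" using that by (simp flip: power_add)
      finally have "m \<le> 2 ^ L" .
      then consider "m = 0" | "m = 2 ^ L" | "0 < m" "m < 2 ^ L" by linarith
      then show ?thesis unfolding eq by cases (auto simp: F_def)
    qed
    show "\<forall>(a, b)\<in>e ` Lf. a \<le> b \<and> a \<in> F \<union> {0, 1} \<and> b \<in> F \<union> {0, 1}"
    proof (intro ballI, clarify)
      fix a b n k assume nk: "(a, b) = e (n, k)" "(n, k) \<in> Lf"
      then have "k \<le> 2 ^ n" "k + 1 \<le> 2 ^ n" "n \<le> L" by (auto simp: Lf_def)
      moreover have "a = real k / 2 ^ n" "b = real (k + 1) / 2 ^ n" using nk(1) by (auto simp: e_def)
      moreover have "real k / 2 ^ n \<le> real (k + 1) / 2 ^ n" by (intro divide_right_mono) auto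
      ultimately show "a \<le> b \<and> a \<in> F \<union> {0, 1} \<and> b \<in> F \<union> {0, 1}" using endp by blast
    qed
    have leaf: "\<exists>(n', k')\<in>Lf. x \<in> closed_cell n' k'"
      if "n + d = L" "k < 2 ^ n" "x \<in> closed_cell n k" "n = 0 \<or> (n - 1, k div 2) \<in> ?H" for n k d x
      using that
    proof (induction d arbitrary: n k)
      case 0
      then have "(n, k) \<notin> ?H" using level[of n k] by auto
      then have "(n, k) \<in> Lf" using 0 by (auto simp: Lf_def)
      then show ?case using 0(3) by blast
    next
      case (Suc d)
      show ?case
      proof (cases "(n, k) \<in> ?H")
        case True
        have "x \<in> closed_cell (n + 1) (2 * k) \<or> x \<in> closed_cell (n + 1) (2 * k + 1)"
          using Suc.prems(3) unfolding mem_closed_cell_iff by auto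
        then obtain i where i: "i < 2" "x \<in> closed_cell (n + 1) (2 * k + i)"
          by (metis add_0_right one_less_numeral_iff semiring_norm(76) zero_less_numeral)
        have "2 * k + i < 2 ^ (n + 1)" "(2 * k + i) div 2 = k" using Suc.prems(2) i(1) by auto
        then show ?thesis using Suc.IH[of "n + 1" "2 * k + i"] i(2) True Suc.prems(1) by auto
      next
        case False
        then have "(n, k) \<in> Lf" using Suc.prems by (auto simp: Lf_def)
        then show ?thesis using Suc.prems(3) by blast
      qed
    qed
    show "{0..1} \<subseteq> (\<Union>(a, b)\<in>e ` Lf. {a..b})"
    proof
      fix x :: real assume "x \<in> {0..1}"
      then have "x \<in> closed_cell 0 0" by (simp add: closed_cell_def)
      then obtain n k where nk: "(n, k) \<in> Lf" "x \<in> closed_cell n k" using leaf[of 0 L 0 x] by auto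
      from imageI[OF nk(1), of e] show "x \<in> (\<Union>(a, b)\<in>e ` Lf. {a..b})"
        by (rule UN_I) (use nk(2) in \<open>simp add: e_def closed_cell_def\<close>)
    qed
  qed
  also have "\<dots> \<le> (\<Sum>x\<in>Lf. Jpow q (e x))"
    using fLf by (intro order_trans[OF sum_image_le]) (auto simp: Jpow_def case_prod_beta')
  also have "\<dots> \<le> (\<Sum>x\<in>Lf. t powr q)"
  proof (rule sum_mono)
    fix x assume "x \<in> Lf"
    then obtain n k where nk: "x = (n, k)" "k < 2 ^ n" "(n, k) \<notin> ?H" by (auto simp: Lf_def)
    have "real (k + 1) / 2 ^ n - real k / 2 ^ n = 1 / 2 ^ n" by (simp add: diff_divide_distrib[symmetric])
    then have "Jpow q (e x) = (measure \<nu> (closed_cell n k) / 2 ^ n) powr q"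
      unfolding nk(1) Jpow_def e_def closed_cell_def by (simp del: of_nat_add)
    also have "\<dots> \<le> t powr q"
      using nk(2,3) q by (intro powr_mono2) (auto simp: heavy_closed_cells_def)
    finally show "Jpow q (e x) \<le> t powr q" .
  qed
  also have "\<dots> = real (card Lf) * t powr q" by simp
  also have "\<dots> \<le> (1 + 2 * real (card ?H)) * t powr q" using cLf by (intro mult_right_mono) auto
  finally show ?thesis .
qed

text \<open>A single sufficiently large level of \<open>Z\<close> is used; the constant then holds
  for every t. Half of the gain \<open>2 powr (n * \<delta>)\<close> pays for the distortion and the
  other half for the constant \<open>8 * A\<close>.\<close>

lemma heavy_closed_cells_growth:
  assumes q: "0 < q" "q \<le> 1" and \<delta>: "\<delta> > 0"
    and Z: "\<exists>\<^sub>\<infinity>n. 2 powr (real n * \<delta>) \<le> partition_sum n q"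
  shows "\<exists>c>0. \<forall>t>0. c \<le> (1 + 2 * real (card (heavy_closed_cells t))) * t powr q"
proof -
  \<comment> \<open>With this choice \<open>\<rho> < lam ^ m\<close> gives (1 + \<epsilon>)^m \<le>
    \<rho> powr (- \<delta> / 2), which for \<rho> = 2^(-n) is half of the gain in the
    exponent.\<close>
  define \<epsilon> where "\<epsilon> = lam powr (- \<delta> / 2) - 1"
  have "lam powr (- \<delta> / 2) > lam powr 0" using lam \<delta> by (intro powr_less_mono') auto
  then have \<epsilon>: "\<epsilon> > 0" using lam by (simp add: \<epsilon>_def)
  obtain A where A: "A \<ge> 1" "\<And>\<rho>. 0 < \<rho> \<Longrightarrow> \<rho> < 1 \<Longrightarrow> \<exists>W. cut_set W \<and> [] \<notin> W \<and>
     (\<forall>w\<in>W. small \<rho> w \<and> (\<exists>m. \<rho> < lam ^ m \<and>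
        (\<forall>x\<in>{0..1}. \<forall>y\<in>{0..1}. \<rho> / (A * (1 + \<epsilon>) ^ m) * \<bar>x - y\<bar> \<le> \<bar>foldr S w x - foldr S w y\<bar>)))"
    using cut_set_fine[OF \<epsilon>] by blast
  have "filterlim (\<lambda>n. 2 powr (real n * \<delta> / 2)) at_top sequentially" using \<delta> by real_asymp
  then have "\<forall>\<^sub>F n in sequentially. 8 * A \<le> 2 powr (real n * \<delta> / 2)" by (simp add: filterlim_at_top)
  then obtain n0 where n0: "\<And>n. n \<ge> n0 \<Longrightarrow> 8 * A \<le> 2 powr (real n * \<delta> / 2)"
    by (auto simp: eventually_sequentially)
  obtain n where n: "n \<ge> max n0 1" "2 powr (real n * \<delta>) \<le> partition_sum n q"
    using Z unfolding INFM_nat_le by blast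
  define \<rho> where "\<rho> = (1::real) / 2 ^ n"
  have \<rho>: "0 < \<rho>" "\<rho> < 1" using n(1) by (auto simp: \<rho>_def)
  define D where "D = A * 2 powr (real n * \<delta> / 2)"
  have two: "2 powr (real n * \<delta> / 2) \<ge> 1" using \<delta> by (simp add: ge_one_powr_ge_zero)
  then have D: "D \<ge> 1" using A(1) mult_mono[of 1 A 1 "2 powr (real n * \<delta> / 2)"] by (simp add: D_def)
  obtain W where W: "cut_set W" "[] \<notin> W" "\<And>w. w \<in> W \<Longrightarrow> small \<rho> w \<and> (\<exists>m. \<rho> < lam ^ m \<and>
        (\<forall>x\<in>{0..1}. \<forall>y\<in>{0..1}. \<rho> / (A * (1 + \<epsilon>) ^ m) * \<bar>x - y\<bar> \<le> \<bar>foldr S w x - foldr S w y\<bar>))"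
    using A(2)[OF \<rho>] by blast
  have lip: "\<rho> / D * \<bar>x - y\<bar> \<le> \<bar>foldr S w x - foldr S w y\<bar>" if wxy: "w \<in> W" "x \<in> {0..1}" "y \<in> {0..1}" for w x y
  proof -
    obtain m where m: "\<rho> < lam ^ m" "\<rho> / (A * (1 + \<epsilon>) ^ m) * \<bar>x - y\<bar> \<le> \<bar>foldr S w x - foldr S w y\<bar>"
      using W(3)[OF wxy(1)] wxy by blast
    have "(1 + \<epsilon>) ^ m = (lam ^ m) powr (- \<delta> / 2)"
      using lam by (simp add: \<epsilon>_def powr_realpow[symmetric] powr_powr powr_gt_zero mult.commute)
    also have "\<dots> \<le> \<rho> powr (- \<delta> / 2)"
      using m(1) \<rho> \<delta> by (intro powr_mono2') auto
    also have "\<dots> = 2 powr (real n * \<delta> / 2)"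
      by (simp add: \<rho>_def powr_divide powr_realpow[symmetric] powr_powr powr_minus_divide)
    finally have "A * (1 + \<epsilon>) ^ m \<le> D" using A(1) by (simp add: D_def)
    then have "\<rho> / D \<le> \<rho> / (A * (1 + \<epsilon>) ^ m)"
      using \<rho> D A(1) \<epsilon> by (intro divide_left_mono mult_pos_pos) auto
    then have "\<rho> / D * \<bar>x - y\<bar> \<le> \<rho> / (A * (1 + \<epsilon>) ^ m) * \<bar>x - y\<bar>" by (rule mult_right_mono) simp
    then show ?thesis using m(2) by linarith
  qed
  \<comment> \<open>Here q \<le> 1 and \<open>D \<ge> 1\<close> remove the power.\<close>
  have "8 * D powr q \<le> 8 * D powr 1" using D q by (intro mult_left_mono powr_mono) auto
  also have "\<dots> = (8 * A) * 2 powr (real n * \<delta> / 2)" using D by (simp add: D_def)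
  also have "\<dots> \<le> 2 powr (real n * \<delta> / 2) * 2 powr (real n * \<delta> / 2)"
    using n0[of n] n(1) by (intro mult_right_mono) auto
  also have "\<dots> = 2 powr (real n * \<delta>)" by (simp add: powr_add[symmetric] mult.commute)
  also have "\<dots> \<le> partition_sum n q" by (rule n(2))
  finally have Zn: "8 * D powr q \<le> (\<Sum>k<2 ^ n. (measure \<nu> (dyadic_cell n k) / 2 ^ n) powr q)"
    by (simp add: partition_sum_def)
  from W(3) have sm: "\<And>w. w \<in> W \<Longrightarrow> small \<rho> w" by blast
  obtain c where c: "c > 0" "\<And>N F P. separated_cover N F P \<Longrightarrow> c \<le> (\<Sum>I\<in>P. Jpow q I)"
    using cover_sum_lower_bound[OF q D \<rho>_def W(1,2) sm lip Zn] by blast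
  have "c \<le> (1 + 2 * real (card (heavy_closed_cells t))) * t powr q" if "t > 0" for t
    by (rule heavy_closed_cells_lower_bound[OF q(1) that c(2)])
  with c(1) show ?thesis by blast
qed

lemma lower_spectral_dim_ge:
  assumes pos: "measure \<nu> {0<..1} > 0"
  shows "Lq_upper_fixed_point \<nu> \<le> lower_spectral_dim \<nu>"
proof (rule dense_le)
  fix y assume y: "y < Lq_upper_fixed_point \<nu>"
  then obtain q :: real where q: "y < ereal q" "ereal q < Lq_upper_fixed_point \<nu>" using ereal_dense2 by blast
  have "\<forall>\<^sub>F x in at_top. y \<le> ereal (ln (real (eigenvalue_count \<nu> x)) / ln x)"
  proof (cases "q \<le> 0")
    \<comment> \<open>The logarithm of a natural number is nonnegative, with \<open>ln 0 = 0\<close>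
      for a zero count, so exponents up to 0 are trivial.\<close>
    case True
    show ?thesis using eventually_gt_at_top[of 1]
    proof eventually_elim
      case (elim x)
      have "ln (real (eigenvalue_count \<nu> x)) \<ge> 0" by (cases "eigenvalue_count \<nu> x = 0") auto
      then have "q \<le> ln (real (eigenvalue_count \<nu> x)) / ln x" using True elim by (meson divide_nonneg_pos ln_gt_zero order_trans)
      then show ?case using q(1) by (meson ereal_less_eq(3) less_imp_le order_trans)
    qed
  next
    case False
    obtain q2 :: real where q2: "ereal q < ereal q2" "ereal q2 < Lq_upper_fixed_point \<nu>" using ereal_dense2[OF q(2)] by blast
    \<comment> \<open>The gap between \<open>q1\<close> and \<open>q2\<close> is the exponential
      gain \<delta> of \<open>heavy_closed_cells_growth\<close>; the gap between \<open>q\<close>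
      and \<open>q1\<close> absorbs the logarithmic factor.\<close>
    define q1 where "q1 = (q + q2) / 2"
    have qs: "0 < q" "q < q1" "q1 < q2" using False q2(1) by (auto simp: q1_def)
    have freq: "\<exists>\<^sub>\<infinity>n. q2 < Lq_fixed_point \<nu> n \<and> 1 \<le> n"
    proof -
      have "\<exists>\<^sub>F n in sequentially. q2 < Lq_fixed_point \<nu> n"
      proof (rule ccontr)
        assume "\<not> ?thesis"
        then have "\<forall>\<^sub>F n in sequentially. ereal (Lq_fixed_point \<nu> n) \<le> ereal q2"
          by (auto simp: not_frequently not_less)
        then have "Lq_upper_fixed_point \<nu> \<le> ereal q2"
          unfolding Lq_upper_fixed_point_def by (rule Limsup_bounded)
        then show False using q2(2) by simp
      qed
      then have "\<exists>\<^sub>F n in sequentially. q2 < Lq_fixed_point \<nu> n \<and> 1 \<le> n"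
        using frequently_eventually_frequently eventually_ge_at_top[of 1] by blast
      then show ?thesis by (simp add: cofinite_eq_sequentially)
    qed
    then obtain n where "q2 < Lq_fixed_point \<nu> n" "1 \<le> n" by (auto dest: INFM_EX)
    then have "q2 < 1" using Lq_fixed_point_props(2)[OF pos] by force
    have Zn: "2 powr (real n * (q2 - q1)) \<le> partition_sum n q1" if "q2 < Lq_fixed_point \<nu> n \<and> 1 \<le> n" for n
    proof -
      have "2 powr (real n * (q2 - q1)) \<le> 2 powr (real n * (Lq_fixed_point \<nu> n - q1))"
        using that by (intro powr_mono mult_left_mono) auto
      also have "\<dots> \<le> partition_sum n q1"
        using partition_sum_ge[of q1 "Lq_fixed_point \<nu> n" n] Lq_fixed_point_props(3)[OF pos, of n] that qs by simp
      finally show ?thesis .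
    qed
    have "\<exists>\<^sub>\<infinity>n. 2 powr (real n * (q2 - q1)) \<le> partition_sum n q1"
      using freq by (rule INFM_mono) (rule Zn)
    then obtain c where c: "c > 0" "\<And>t. t > 0 \<Longrightarrow> c \<le> (1 + 2 * real (card (heavy_closed_cells t))) * t powr q1"
      using heavy_closed_cells_growth[of q1 "q2 - q1"] qs \<open>q2 < 1\<close> by auto
    have bound: "c * (x / 2) powr q1 \<le> 1 + 2 * ((log 2 (x / 2) + 1) * (3 * real (eigenvalue_count \<nu> x) + 2))"
      if x: "x \<ge> 2" for x
    proof -
      \<comment> \<open>Chosen so that the tent bound at \<open>?t\<close> counts the eigenvalues up
        to x.\<close>
      let ?t = "2 / x"
      have t: "0 < ?t" "?t \<le> 1" using x by auto
      have "c * (x / 2) powr q1 \<le> ((1 + 2 * real (card (heavy_closed_cells ?t))) * ?t powr q1) * (x / 2) powr q1"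
        using c(2)[OF t(1)] by (intro mult_right_mono) auto
      also have "\<dots> = (1 + 2 * real (card (heavy_closed_cells ?t))) * (?t * (x / 2)) powr q1"
        using x by (subst powr_mult) auto
      also have "?t * (x / 2) = 1" using x by simp
      finally have "c * (x / 2) powr q1 \<le> 1 + 2 * real (card (heavy_closed_cells ?t))" by simp
      also have "real (card (heavy_closed_cells ?t)) \<le> (log 2 (x / 2) + 1) * (3 * real (eigenvalue_count \<nu> x) + 2)"
        using card_heavy_closed_cells_le[OF t] x by simp
      finally show ?thesis by simp
    qed
    have "\<forall>\<^sub>F x in at_top. 1 + 2 * ((log 2 (x / 2) + 1) * (3 * x powr q + 2)) < c * (x / 2) powr q1"
      using qs c(1) unfolding log_def by real_asymp
    then show ?thesis using eventually_ge_at_top[of 2]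
    proof eventually_elim
      case (elim x)
      have "x powr q \<le> real (eigenvalue_count \<nu> x)"
      proof (rule ccontr)
        assume "\<not> ?thesis"
        moreover have "log 2 (x / 2) \<ge> 0" using elim(2) by (simp add: zero_le_log_cancel_iff)
        ultimately have "(log 2 (x / 2) + 1) * (3 * real (eigenvalue_count \<nu> x) + 2) \<le> (log 2 (x / 2) + 1) * (3 * x powr q + 2)"
          by (intro mult_left_mono) auto
        then show False using elim(1) bound[OF elim(2)] by linarith
      qed
      then have "q \<le> ln (real (eigenvalue_count \<nu> x)) / ln x" using elim(2) by (intro ln_ratio_ge) auto
      then show ?case using q(1) by (meson ereal_less_eq(3) less_imp_le order_trans)
    qed
  qed
  then show "y \<le> lower_spectral_dim \<nu>" unfolding lower_spectral_dim_def by (rule Liminf_bounded)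
qed

lemma spectral_dim_eq:
  assumes pos: "measure \<nu> {0<..1} > 0"
  shows "lower_spectral_dim \<nu> = upper_spectral_dim \<nu>" "upper_spectral_dim \<nu> = Lq_upper_fixed_point \<nu>"
proof -
  have "lower_spectral_dim \<nu> \<le> upper_spectral_dim \<nu>"
    unfolding lower_spectral_dim_def upper_spectral_dim_def by (rule Liminf_le_Limsup) simp
  then show "lower_spectral_dim \<nu> = upper_spectral_dim \<nu>" "upper_spectral_dim \<nu> = Lq_upper_fixed_point \<nu>"
    using lower_spectral_dim_ge[OF pos] upper_spectral_dim_le[OF pos] by auto
qed

end

section \<open>Conformal maps\<close>

definition low_distortion_on :: "real \<Rightarrow> real set \<Rightarrow> (real \<Rightarrow> real) \<Rightarrow> bool" where
  "low_distortion_on \<epsilon> X f \<longleftrightarrow>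
     (\<exists>m>0. \<forall>u\<in>X. \<forall>v\<in>X. m * \<bar>u - v\<bar> \<le> \<bar>f u - f v\<bar> \<and> \<bar>f u - f v\<bar> \<le> (1 + \<epsilon>) * m * \<bar>u - v\<bar>)"

text \<open>The locale assumptions for a single map, with constants of its own.\<close>

definition distortion_bounds :: "(real \<Rightarrow> real) \<Rightarrow> real \<Rightarrow> real \<Rightarrow> bool" where
  "distortion_bounds f c a \<longleftrightarrow> 0 < c \<and> c < 1 \<and> 0 < a \<and> (\<forall>x\<in>{0..1}. f x \<in> {0..1}) \<and>
    (\<forall>x\<in>{0..1}. \<forall>y\<in>{0..1}. a * \<bar>x - y\<bar> \<le> \<bar>f x - f y\<bar> \<and> \<bar>f x - f y\<bar> \<le> c * \<bar>x - y\<bar>) \<and>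
    (\<forall>\<epsilon>>0. \<exists>\<eta>>0. \<forall>X\<subseteq>{0..1}. (\<forall>u\<in>X. \<forall>v\<in>X. \<bar>u - v\<bar> \<le> \<eta>) \<longrightarrow> low_distortion_on \<epsilon> X f)"

text \<open>By the mean value theorem, difference quotients are values of the derivative. Its
  modulus is continuous on [0,1], hence bounded below by some a > 0 and uniformly continuous; the
  latter gives near similarity at small scales.\<close>

lemma C1_conformal_contraction_bounds:
  assumes "C1_conformal_contraction f"
  shows "\<exists>c a. distortion_bounds f c a"
proof -
  obtain U T c where f: "f ` {0..1} \<subseteq> {0..1}" and U: "open U" "{0..1} \<subseteq> U" "\<forall>x\<in>{0..1}. T x = f x"
    and C1: "T C1_differentiable_on U" and d0: "\<forall>x\<in>U. \<bar>deriv T x\<bar> > 0"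
    and c: "0 < c" "c < 1" "\<forall>x\<in>U. \<forall>y\<in>U. \<bar>T x - T y\<bar> \<le> c * \<bar>x - y\<bar>"
    using assms unfolding C1_conformal_contraction_def by (elim conjE exE) (rule that; assumption)
  have Tf: "T x = f x" if "x \<in> {0..1}" for x using bspec[OF U(3) that] .
  obtain D where D: "\<forall>x\<in>U. (T has_vector_derivative D x) (at x)" "continuous_on U D"
    using C1 unfolding C1_differentiable_on_def by (elim exE conjE)
  have D': "(T has_real_derivative D x) (at x)" if "x \<in> U" for x
    using bspec[OF D(1) that] by (simp add: has_real_derivative_iff_has_vector_derivative)
  have Dpos: "\<bar>D x\<bar> > 0" if "x \<in> U" for x
    using bspec[OF d0 that] DERIV_imp_deriv[OF D'[OF that]] by simp
  have contD: "continuous_on {0..1} (\<lambda>x. \<bar>D x\<bar>)"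
    by (intro continuous_intros continuous_on_subset[OF D(2) U(2)])
  have "\<exists>x\<in>{0..1}. \<forall>y\<in>{0..1}. \<bar>D x\<bar> \<le> \<bar>D y\<bar>"
    by (rule continuous_attains_inf[OF _ _ contD]) auto
  then obtain x0 where x0: "x0 \<in> {0..1}" "\<And>y. y \<in> {0..1} \<Longrightarrow> \<bar>D x0\<bar> \<le> \<bar>D y\<bar>" by blast
  define a where "a = \<bar>D x0\<bar>"
  have a: "a > 0" unfolding a_def using Dpos subsetD[OF U(2) x0(1)] by blast
  have mvt: "\<exists>z. min x y \<le> z \<and> z \<le> max x y \<and> \<bar>f x - f y\<bar> = \<bar>D z\<bar> * \<bar>x - y\<bar>"
    if "x \<in> {0..1}" "y \<in> {0..1}" for x y
  proof -
    have *: "\<exists>z. x \<le> z \<and> z \<le> y \<and> \<bar>f x - f y\<bar> = \<bar>D z\<bar> * \<bar>x - y\<bar>" if xy: "x \<in> {0..1}" "y \<in> {0..1}" "x < y" for x y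
    proof -
      have "\<exists>z>x. z < y \<and> T y - T x = (y - x) * D z"
        using xy by (intro MVT2 D' subsetD[OF U(2)]) auto
      then obtain z where z: "x < z" "z < y" "T y - T x = (y - x) * D z" by blast
      have "\<bar>f x - f y\<bar> = \<bar>T y - T x\<bar>" using Tf[OF xy(1)] Tf[OF xy(2)] by (simp add: abs_minus_commute)
      also have "\<dots> = \<bar>D z\<bar> * \<bar>x - y\<bar>" unfolding z(3) by (simp add: abs_mult abs_minus_commute mult.commute)
      finally show ?thesis using z by (intro exI[of _ z]) auto
    qed
    consider "x < y" | "y < x" | "x = y" by linarith
    then show ?thesis
    proof cases
      case 1
      then show ?thesis using *[of x y] that by auto
    next
      case 2
      then show ?thesis using *[of y x] that by (auto simp: abs_minus_commute)
    qed auto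
  qed
  have "distortion_bounds f c a"
    unfolding distortion_bounds_def
  proof (intro conjI ballI allI impI c(1,2) a)
    show "f x \<in> {0..1}" if "x \<in> {0..1}" for x using subsetD[OF f imageI[OF that]] .
    show "\<bar>f x - f y\<bar> \<le> c * \<bar>x - y\<bar>" if "x \<in> {0..1}" "y \<in> {0..1}" for x y
      using bspec[OF bspec[OF c(3) subsetD[OF U(2) that(1)]] subsetD[OF U(2) that(2)]] Tf[OF that(1)] Tf[OF that(2)] by simp
    show "a * \<bar>x - y\<bar> \<le> \<bar>f x - f y\<bar>" if xy: "x \<in> {0..1}" "y \<in> {0..1}" for x y
    proof -
      obtain z where z: "min x y \<le> z" "z \<le> max x y" "\<bar>f x - f y\<bar> = \<bar>D z\<bar> * \<bar>x - y\<bar>" using mvt[OF xy] by blast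
      have "z \<in> {0..1}" using z xy by auto
      then show ?thesis unfolding z(3) a_def by (intro mult_right_mono x0(2)) auto
    qed
    fix \<epsilon> :: real assume e: "\<epsilon> > 0"
    \<comment> \<open>Solves the condition that \<open>\<bar>D s\<bar> + \<delta> \<le> (1 +
      \<epsilon>) * (\<bar>D s\<bar> - \<delta>)\<close> whenever
      \<open>\<bar>D s\<bar> \<ge> a\<close>.\<close>
    define \<delta> where "\<delta> = a * \<epsilon> / (2 + \<epsilon>)"
    have \<delta>: "\<delta> > 0" using a e by (simp add: \<delta>_def)
    have "\<delta> < a" using a e by (simp add: \<delta>_def field_simps)
    have "uniformly_continuous_on {0..1} (\<lambda>x. \<bar>D x\<bar>)"
      by (rule compact_uniformly_continuous[OF contD]) simp
    then obtain \<eta>0 where \<eta>0: "\<eta>0 > 0" "\<And>x y. x \<in> {0..1} \<Longrightarrow> y \<in> {0..1} \<Longrightarrow> dist y x < \<eta>0 \<Longrightarrow> dist \<bar>D y\<bar> \<bar>D x\<bar> < \<delta>"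
      using \<delta> unfolding uniformly_continuous_on_def by blast
    show "\<exists>\<eta>>0. \<forall>X\<subseteq>{0..1}. (\<forall>u\<in>X. \<forall>v\<in>X. \<bar>u - v\<bar> \<le> \<eta>) \<longrightarrow> low_distortion_on \<epsilon> X f"
      unfolding low_distortion_on_def
    proof (rule exI[of _ "\<eta>0 / 2"], intro conjI allI impI)
      show "\<eta>0 / 2 > 0" using \<eta>0 by simp
      fix X :: "real set" assume X: "X \<subseteq> {0..1}" "\<forall>u\<in>X. \<forall>v\<in>X. \<bar>u - v\<bar> \<le> \<eta>0 / 2"
      show "\<exists>m>0. \<forall>u\<in>X. \<forall>v\<in>X. m * \<bar>u - v\<bar> \<le> \<bar>f u - f v\<bar> \<and> \<bar>f u - f v\<bar> \<le> (1 + \<epsilon>) * m * \<bar>u - v\<bar>"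
      proof (cases "X = {}")
        case True
        then show ?thesis by (intro exI[of _ 1]) auto
      next
        case False
        then obtain s where s: "s \<in> X" by blast
        then have s01: "s \<in> {0..1}" using X by blast
        define m where "m = \<bar>D s\<bar> - \<delta>"
        have Ds: "a \<le> \<bar>D s\<bar>" unfolding a_def by (rule x0(2)[OF s01])
        have m: "m > 0" using Ds \<open>\<delta> < a\<close> by (simp add: m_def)
        have "\<delta> * (2 + \<epsilon>) = a * \<epsilon>" using e by (simp add: \<delta>_def)
        also have "\<dots> \<le> \<bar>D s\<bar> * \<epsilon>" using Ds e by (intro mult_right_mono) auto
        finally have M: "\<bar>D s\<bar> + \<delta> \<le> (1 + \<epsilon>) * m" by (simp add: m_def algebra_simps)
        have "m * \<bar>u - v\<bar> \<le> \<bar>f u - f v\<bar> \<and> \<bar>f u - f v\<bar> \<le> (1 + \<epsilon>) * m * \<bar>u - v\<bar>" if uv: "u \<in> X" "v \<in> X" for u v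
        proof -
          have uv01: "u \<in> {0..1}" "v \<in> {0..1}" using uv X by blast+
          obtain z where z: "min u v \<le> z" "z \<le> max u v" "\<bar>f u - f v\<bar> = \<bar>D z\<bar> * \<bar>u - v\<bar>" using mvt[OF uv01] by blast
          have z01: "z \<in> {0..1}" using z uv01 by auto
          have "\<bar>u - s\<bar> \<le> \<eta>0 / 2" "\<bar>v - s\<bar> \<le> \<eta>0 / 2" using X(2) uv s by blast+
          \<comment> \<open>The set \<open>X\<close> need not be an interval, but z lies between two
            points that are close to s.\<close>
          then have "\<bar>z - s\<bar> \<le> \<eta>0 / 2" using z(1,2) unfolding abs_le_iff min_le_iff_disj le_max_iff_disj by linarith
          then have "dist z s < \<eta>0" using \<eta>0(1) by (simp add: dist_real_def)
          then have "dist \<bar>D z\<bar> \<bar>D s\<bar> < \<delta>" by (rule \<eta>0(2)[OF s01 z01])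
          then have "m \<le> \<bar>D z\<bar>" "\<bar>D z\<bar> \<le> (1 + \<epsilon>) * m" using M by (auto simp: m_def dist_real_def)
          then show ?thesis unfolding z(3) by (auto intro!: mult_right_mono)
        qed
        then show ?thesis using m by blast
      qed
    qed
  qed
  then show ?thesis by blast
qed

text \<open>Finitely many maps allow common constants by maxima and minima; there is at least one
  map because the weights sum to 1.\<close>

lemma self_conformal_locale:
  assumes ifs: "C1_conformal_ifs l S" and p: "\<forall>i<l. p i > 0" "(\<Sum>i<l. p i) = 1"
    and nu: "self_conformal_measure l S p \<nu>"
  shows "\<exists>lam a0. self_conformal \<nu> l S p lam a0"
proof -
  interpret unit_interval_measure \<nu>
    using nu by unfold_locales (auto simp: self_conformal_measure_def)
  have "\<exists>c a. distortion_bounds (S i) c a" if "i < l" for i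
    using ifs that by (intro C1_conformal_contraction_bounds) (simp add: C1_conformal_ifs_def)
  then obtain c a where good: "\<And>i. i < l \<Longrightarrow> distortion_bounds (S i) (c i) (a i)" by metis
  have good1: "0 < c i" "c i < 1" "0 < a i" if "i < l" for i
    using good[OF that] by (simp_all add: distortion_bounds_def)
  have good2: "S i x \<in> {0..1}" "a i * \<bar>x - y\<bar> \<le> \<bar>S i x - S i y\<bar>" "\<bar>S i x - S i y\<bar> \<le> c i * \<bar>x - y\<bar>"
    if "i < l" "x \<in> {0..1}" "y \<in> {0..1}" for i x y
    using good[OF that(1)] that(2,3) unfolding distortion_bounds_def by blast+
  have good3: "\<exists>\<eta>>0. \<forall>X\<subseteq>{0..1}. (\<forall>u\<in>X. \<forall>v\<in>X. \<bar>u - v\<bar> \<le> \<eta>) \<longrightarrow> low_distortion_on \<epsilon> X (S i)"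
    if "i < l" "\<epsilon> > 0" for i \<epsilon>
    using good[OF that(1)] that(2) unfolding distortion_bounds_def by blast
  have l: "{..<l} \<noteq> {}" using p(2) by (cases "l = 0") (auto simp: lessThan_empty_iff)
  define lam where "lam = Max (c ` {..<l})"
  define a0 where "a0 = Min (a ` {..<l})"
  have lam: "0 < lam" "lam < 1" "\<And>i. i < l \<Longrightarrow> c i \<le> lam"
    unfolding lam_def using good1 l by (auto simp: Max_gr_iff Max_less_iff)
  have a0: "0 < a0" "\<And>i. i < l \<Longrightarrow> a0 \<le> a i"
    unfolding a0_def using good1 l by (auto simp: Min_gr_iff)
  have "self_conformal \<nu> l S p lam a0"
  proof unfold_locales
    show "S i x \<in> {0..1}" if "i < l" "x \<in> {0..1}" for i x by (rule good2(1)[OF that that(2)])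
    show "\<bar>S i x - S i y\<bar> \<le> lam * \<bar>x - y\<bar>" if "i < l" "x \<in> {0..1}" "y \<in> {0..1}" for i x y
    proof -
      have "\<bar>S i x - S i y\<bar> \<le> c i * \<bar>x - y\<bar>" by (rule good2(3)[OF that])
      also have "\<dots> \<le> lam * \<bar>x - y\<bar>" using lam(3)[OF that(1)] by (rule mult_right_mono) simp
      finally show ?thesis .
    qed
    show "a0 * \<bar>x - y\<bar> \<le> \<bar>S i x - S i y\<bar>" if "i < l" "x \<in> {0..1}" "y \<in> {0..1}" for i x y
    proof -
      have "a0 * \<bar>x - y\<bar> \<le> a i * \<bar>x - y\<bar>" using a0(2)[OF that(1)] by (rule mult_right_mono) simp
      also have "\<dots> \<le> \<bar>S i x - S i y\<bar>" by (rule good2(2)[OF that])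
      finally show ?thesis .
    qed
    show "\<exists>\<eta>>0. \<forall>i<l. \<forall>X\<subseteq>{0..1}. (\<forall>u\<in>X. \<forall>v\<in>X. \<bar>u - v\<bar> \<le> \<eta>) \<longrightarrow>
      (\<exists>m>0. \<forall>u\<in>X. \<forall>v\<in>X. m * \<bar>u - v\<bar> \<le> \<bar>S i u - S i v\<bar> \<and> \<bar>S i u - S i v\<bar> \<le> (1 + \<epsilon>) * m * \<bar>u - v\<bar>)"
      if e: "\<epsilon> > 0" for \<epsilon>
      unfolding low_distortion_on_def[symmetric]
    proof -
      obtain \<eta> where \<eta>: "\<And>i. i < l \<Longrightarrow> \<eta> i > 0"
        "\<And>i X. i < l \<Longrightarrow> X \<subseteq> {0..1} \<Longrightarrow> (\<forall>u\<in>X. \<forall>v\<in>X. \<bar>u - v\<bar> \<le> \<eta> i) \<Longrightarrow> low_distortion_on \<epsilon> X (S i)"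
        using good3[OF _ e] by metis
      define h where "h = Min (\<eta> ` {..<l})"
      have h: "h > 0" "\<And>i. i < l \<Longrightarrow> h \<le> \<eta> i" unfolding h_def using \<eta>(1) l by (auto simp: Min_gr_iff)
      have "low_distortion_on \<epsilon> X (S i)"
        if "i < l" "X \<subseteq> {0..1}" "\<forall>u\<in>X. \<forall>v\<in>X. \<bar>u - v\<bar> \<le> h" for i X
        using that h(2)[OF that(1)] by (intro \<eta>(2)) (auto intro: order_trans)
      then show "\<exists>\<eta>>0. \<forall>i<l. \<forall>X\<subseteq>{0..1}. (\<forall>u\<in>X. \<forall>v\<in>X. \<bar>u - v\<bar> \<le> \<eta>) \<longrightarrow> low_distortion_on \<epsilon> X (S i)"
        using h(1) by blast
    qed
    show "measure \<nu> B = (\<Sum>i<l. p i * measure \<nu> (S i -` B \<inter> {0..1}))" if "B \<in> sets \<nu>" for B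
      using nu that by (simp add: self_conformal_measure_def)
  qed (use lam a0 p in auto)
  then show ?thesis by blast
qed

text \<open>Otherwise \<nu> is the point mass at 0. If \<open>S i\<close> moves 0, then the preimage
  of {0} under \<open>S i\<close> lies in the null set (0, 1], and self-similarity leaves at most 1
  - p i for the mass of {0}. The absence of a common fixed point enters here.\<close>

lemma (in self_conformal) measure_greaterThanAtMost_pos:
  assumes fix0: "\<not> (\<forall>i<l. S i 0 = 0)"
  shows "measure \<nu> {0<..1} > 0"
proof (rule ccontr)
  assume "\<not> ?thesis"
  then have z: "measure \<nu> {0<..1} = 0" by (simp add: zero_less_measure_iff)
  have "{0::real} \<union> {0<..1} = {0..1}" by auto
  then have "measure \<nu> {0..1} = measure \<nu> {0} + measure \<nu> {0<..1}"
    using finite_measure_Union[of "{0}" "{0<..1}"] by (simp add: sets_nu_iff subset_eq)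
  then have one: "measure \<nu> {0} = 1" using z prob_space by simp
  obtain i where i: "i < l" "S i 0 \<noteq> 0" using fix0 by blast
  have "S i -` {0} \<inter> {0..1} \<subseteq> {0<..1}" using i(2) by (auto simp: less_le)
  then have "measure \<nu> (S i -` {0} \<inter> {0..1}) \<le> measure \<nu> {0<..1}"
    by (intro finite_measure_mono) (auto simp: sets_nu_iff)
  then have zi: "measure \<nu> (S i -` {0} \<inter> {0..1}) = 0" using z by (simp add: measure_le_0_iff)
  have "1 = (\<Sum>j<l. p j * measure \<nu> (S j -` {0} \<inter> {0..1}))"
    using self_similar[of "{0}"] one by (simp add: sets_nu_iff)
  also have "\<dots> = (\<Sum>j\<in>{..<l} - {i}. p j * measure \<nu> (S j -` {0} \<inter> {0..1}))"
    using i zi by (subst sum.remove[of _ i]) auto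
  also have "\<dots> \<le> (\<Sum>j\<in>{..<l} - {i}. p j * 1)"
    using p_pos by (intro sum_mono mult_left_mono) (auto intro: less_imp_le)
  also have "\<dots> = 1 - p i" using p_sum i by (simp add: sum_diff1)
  finally show False using p_pos[OF i(1)] by simp
qed

theorem theorem1p14:
  fixes l :: nat and S :: "nat \<Rightarrow> real \<Rightarrow> real" and p :: "nat \<Rightarrow> real" and \<nu> :: "real measure"
  assumes "C1_conformal_ifs l S"
    and "\<not> (\<exists>x\<in>{0..1}. \<forall>i<l. S i x = x)"
    and "\<forall>i<l. p i > 0" and "(\<Sum>i<l. p i) = 1"
    and "self_conformal_measure l S p \<nu>"
  shows "lower_spectral_dim \<nu> = upper_spectral_dim \<nu> \<and>
         upper_spectral_dim \<nu> = Lq_upper_fixed_point \<nu>"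
proof -
  obtain lam a0 where "self_conformal \<nu> l S p lam a0"
    using self_conformal_locale[OF assms(1,3,4,5)] by blast
  then interpret self_conformal \<nu> l S p lam a0 .
  have "measure \<nu> {0<..1} > 0" using assms(2) by (intro measure_greaterThanAtMost_pos) auto
  then show ?thesis using spectral_dim_eq by blast
qed

end
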